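(* Let $K$ be an infinite field, $S=K[x_1,\dots,x_m,y_1,\dots,y_n]$ the standard bigraded polynomial ring, $P=(x_1,\dots,x_m)$, $Q=(y_1,\dots,y_n)$. Let $I\subseteq S$ be a monomial ideal and set $R=S/I$. Assume that $R$ is relative Cohen--Macaulay with respect to $P$ with $\operatorname{cd}(P,R)=p$ and relative unmixed with respect to $Q$ with $\operatorname{cd}(Q,R)=q$. Then $R$ is unmixed.
   Context: The bigrading on $S$ is given by $\deg x_i=(1,0)$ and $\deg y_j=(0,1)$. For $J\in\{P,Q\}$ and a nonzero finitely generated bigraded $S$-module $M$, $\operatorname{grade}(J,M)$ is the least $i$ with $H^i_J(M)\ne 0$ and the cohomological dimension $\operatorname{cd}(J,M)$ is the largest $i$ with $H^i_J(M)\neq 0$. $M$ is relative Cohen--Macaulay with respect to $J$ if $\operatorname{grade}(J,M)=\operatorname{cd}(J,M)$. $M$ is relative unmixed with respect to $J$ if $\operatorname{cd}(J,M)=\operatorname{cd}(J,S/\mathfrak p)$ for all $\mathfrak p\in\operatorname{Ass}(M)$. $M$ is unmixed if $\dim S/\mathfrak p=\dim M$ for all $\mathfrak p\in\operatorname{Ass}(M)$. For the $S$-module $R=S/I$ all these notions are taken over $S$. *)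

theory Defs
  imports
    "HOL-Algebra.Module"
    "HOL-Algebra.QuotRing"
    "HOL-Algebra.Ideal_Product"
    "HOL-Algebra.Algebraic_Closure_Type"
    "HOL-Library.Poly_Mapping"
    "HOL-Library.Extended_Nat"
begin

section \<open>Modules over a commutative ring\<close>

definition module_hom ::
  "('a, 'r) ring_scheme \<Rightarrow> ('a, 'b, 's) module_scheme \<Rightarrow> ('a, 'c, 't) module_scheme \<Rightarrow> ('b \<Rightarrow> 'c) set"
  where "module_hom R M N =
    {f \<in> carrier M \<rightarrow> carrier N.
      (\<forall>x\<in>carrier M. \<forall>y\<in>carrier M. f (x \<oplus>\<^bsub>M\<^esub> y) = f x \<oplus>\<^bsub>N\<^esub> f y) \<and>
      (\<forall>a\<in>carrier R. \<forall>x\<in>carrier M. f (a \<odot>\<^bsub>M\<^esub> x) = a \<odot>\<^bsub>N\<^esub> f x)}"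

text \<open>
  Module records extend ring records; the multiplication and the unit of a module record
  are never used and are left unspecified.
\<close>

definition quotient_module ::
  "('a, 'b, 's) module_scheme \<Rightarrow> 'b set \<Rightarrow> ('a, 'b set) module"
  where "quotient_module M N =
    \<lparr>carrier = a_rcosets\<^bsub>M\<^esub> N, monoid.mult = undefined, one = undefined,
     ring.zero = N, add = set_add M,
     module.smult = (\<lambda>a C. \<Union>x\<in>C. N +>\<^bsub>M\<^esub> (a \<odot>\<^bsub>M\<^esub> x))\<rparr>"

definition regular_module :: "('a, 'r) ring_scheme \<Rightarrow> ('a, 'a) module"
  where "regular_module R =
    \<lparr>carrier = carrier R, monoid.mult = undefined, one = undefined,
     ring.zero = \<zero>\<^bsub>R\<^esub>, add = ring.add R, module.smult = monoid.mult R\<rparr>"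

text \<open>The \<open>R\<close>-module \<open>R/I\<close>.\<close>

definition cyclic_module :: "('a, 'r) ring_scheme \<Rightarrow> 'a set \<Rightarrow> ('a, 'a set) module"
  where "cyclic_module R I = quotient_module (regular_module R) I"

definition annihilator :: "('a, 'r) ring_scheme \<Rightarrow> ('a, 'b, 's) module_scheme \<Rightarrow> 'a set"
  where "annihilator R M = {a \<in> carrier R. \<forall>x\<in>carrier M. a \<odot>\<^bsub>M\<^esub> x = \<zero>\<^bsub>M\<^esub>}"

definition associated_primes :: "('a, 'r) ring_scheme \<Rightarrow> ('a, 'b, 's) module_scheme \<Rightarrow> 'a set set"
  where "associated_primes R M =
    {\<pp>. primeideal \<pp> R \<and> (\<exists>x\<in>carrier M. \<pp> = {a \<in> carrier R. a \<odot>\<^bsub>M\<^esub> x = \<zero>\<^bsub>M\<^esub>})}"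


section \<open>Dimension and unmixedness\<close>

definition krull_dim :: "('a, 'r) ring_scheme \<Rightarrow> enat"
  where "krull_dim R =
    Sup {enat n | n. \<exists>C :: nat \<Rightarrow> 'a set.
      (\<forall>i\<le>n. primeideal (C i) R) \<and> (\<forall>i<n. C i \<subset> C (Suc i))}"

definition module_dim :: "('a, 'r) ring_scheme \<Rightarrow> ('a, 'b, 's) module_scheme \<Rightarrow> enat"
  where "module_dim R M = krull_dim (R Quot (annihilator R M))"

definition unmixed :: "('a, 'r) ring_scheme \<Rightarrow> ('a, 'b, 's) module_scheme \<Rightarrow> bool"
  where "unmixed R M \<longleftrightarrow>
    (\<forall>\<pp>\<in>associated_primes R M. module_dim R (cyclic_module R \<pp>) = module_dim R M)"


section \<open>Local cohomology\<close>

primrec ideal_power :: "('a, 'r) ring_scheme \<Rightarrow> 'a set \<Rightarrow> nat \<Rightarrow> 'a set"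
  where
    "ideal_power R J 0 = carrier R"
  | "ideal_power R J (Suc k) = J \<cdot>\<^bsub>R\<^esub> ideal_power R J k"

text \<open>The torsion functor \<open>\<Gamma>\<^sub>J\<close> on objects; on morphisms it is restriction.\<close>

definition torsion :: "('a, 'r) ring_scheme \<Rightarrow> 'a set \<Rightarrow> ('a, 'b, 's) module_scheme \<Rightarrow> 'b set"
  where "torsion R J M =
    {x \<in> carrier M. \<exists>k. \<forall>a\<in>ideal_power R J k. a \<odot>\<^bsub>M\<^esub> x = \<zero>\<^bsub>M\<^esub>}"

text \<open>
  Quantification over types is not available, so the test modules \<open>B\<close> range over the modules
  whose elements have the same type \<open>'e\<close> as those of \<open>E\<close>. As soon as \<open>R\<close> embeds into \<open>'e\<close>
  as a set, these include copies of \<open>R\<close> with all its ideals, and by Baer's criterion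
  the definition then agrees with injectivity with respect to all modules.
\<close>

definition injective_module :: "('a, 'r) ring_scheme \<Rightarrow> ('a, 'e) module \<Rightarrow> bool"
  where "injective_module R E \<longleftrightarrow> module R E \<and>
    (\<forall>(B :: ('a, 'e) module) A f.
      module R B \<and> submodule A R B \<and> f \<in> module_hom R (B\<lparr>carrier := A\<rparr>) E \<longrightarrow>
      (\<exists>g\<in>module_hom R B E. \<forall>x\<in>A. g x = f x))"

definition injective_resolution ::
  "('a, 'r) ring_scheme \<Rightarrow> ('a, 'b, 's) module_scheme \<Rightarrow>
    (nat \<Rightarrow> ('a, 'e) module) \<Rightarrow> (nat \<Rightarrow> 'e \<Rightarrow> 'e) \<Rightarrow> ('b \<Rightarrow> 'e) \<Rightarrow> bool"
  where "injective_resolution R M E d \<epsilon> \<longleftrightarrow>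
    (\<forall>i. injective_module R (E i)) \<and>
    (\<forall>i. d i \<in> module_hom R (E i) (E (Suc i))) \<and>
    \<epsilon> \<in> module_hom R M (E 0) \<and> inj_on \<epsilon> (carrier M) \<and>
    \<epsilon> ` carrier M = {x \<in> carrier (E 0). d 0 x = \<zero>\<^bsub>E 1\<^esub>} \<and>
    (\<forall>i. d i ` carrier (E i) = {x \<in> carrier (E (Suc i)). d (Suc i) x = \<zero>\<^bsub>E (Suc (Suc i))\<^esub>})"

text \<open>
  A chosen injective resolution of \<open>M\<close>. Its terms have elements of type \<open>'a list \<Rightarrow> 'b\<close>, which
  is large enough when \<open>R\<close> is an algebra over a field \<open>K\<close>: if \<open>V\<close> is a \<open>K\<close>-vector space, then
  the \<open>R\<close>-module \<open>Hom\<^sub>K(R, V)\<close> is injective, and so \<open>M\<close> has a resolution whose \<open>i\<close>-th term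
  is \<open>Hom\<^sub>K(R, Hom\<^sub>K(R, \<dots> Hom\<^sub>K(R, M)))\<close> with \<open>i + 1\<close> copies of \<open>R\<close>, a set of functions of
  \<open>i + 1\<close> arguments from \<open>R\<close> with values in \<open>M\<close>.
\<close>

definition chosen_resolution ::
  "('a, 'r) ring_scheme \<Rightarrow> ('a, 'b, 's) module_scheme \<Rightarrow>
    (nat \<Rightarrow> ('a, 'a list \<Rightarrow> 'b) module) \<times> (nat \<Rightarrow> ('a list \<Rightarrow> 'b) \<Rightarrow> ('a list \<Rightarrow> 'b))"
  where "chosen_resolution R M =
    (SOME (E, d). \<exists>\<epsilon>. injective_resolution R M E d \<epsilon>)"

text \<open>
  \<open>H\<^sup>i\<^sub>J(M)\<close>, the \<open>i\<close>-th right derived functor of \<open>\<Gamma>\<^sub>J\<close> at \<open>M\<close>: the \<open>i\<close>-th cohomology of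
  \<open>\<Gamma>\<^sub>J(E\<^sup>\<bullet>)\<close>. Up to isomorphism it does not depend on the chosen resolution \<open>E\<^sup>\<bullet>\<close>.
\<close>

definition local_cohomology ::
  "('a, 'r) ring_scheme \<Rightarrow> 'a set \<Rightarrow> nat \<Rightarrow> ('a, 'b, 's) module_scheme \<Rightarrow>
    ('a, ('a list \<Rightarrow> 'b) set) module"
  where "local_cohomology R J i M =
    (let (E, d) = chosen_resolution R M;
         Z = {x \<in> torsion R J (E i). d i x = \<zero>\<^bsub>E (Suc i)\<^esub>};
         B = (case i of 0 \<Rightarrow> {\<zero>\<^bsub>E 0\<^esub>} | Suc j \<Rightarrow> d j ` torsion R J (E j))
     in quotient_module ((E i)\<lparr>carrier := Z\<rparr>) B)"

definition zero_module :: "('a, 'b, 's) module_scheme \<Rightarrow> bool"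
  where "zero_module M \<longleftrightarrow> carrier M = {\<zero>\<^bsub>M\<^esub>}"


section \<open>Relative Cohen--Macaulay and relative unmixed modules\<close>

definition grade :: "('a, 'r) ring_scheme \<Rightarrow> 'a set \<Rightarrow> ('a, 'b, 's) module_scheme \<Rightarrow> nat"
  where "grade R J M = (LEAST i. \<not> zero_module (local_cohomology R J i M))"

definition cohomological_dim :: "('a, 'r) ring_scheme \<Rightarrow> 'a set \<Rightarrow> ('a, 'b, 's) module_scheme \<Rightarrow> nat"
  where "cohomological_dim R J M = (GREATEST i. \<not> zero_module (local_cohomology R J i M))"

definition relative_Cohen_Macaulay ::
  "('a, 'r) ring_scheme \<Rightarrow> 'a set \<Rightarrow> ('a, 'b, 's) module_scheme \<Rightarrow> bool"
  where "relative_Cohen_Macaulay R J M \<longleftrightarrow> grade R J M = cohomological_dim R J M"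

definition relative_unmixed ::
  "('a, 'r) ring_scheme \<Rightarrow> 'a set \<Rightarrow> ('a, 'b, 's) module_scheme \<Rightarrow> bool"
  where "relative_unmixed R J M \<longleftrightarrow>
    (\<forall>\<pp>\<in>associated_primes R M.
      cohomological_dim R J M = cohomological_dim R J (cyclic_module R \<pp>))"


section \<open>The bigraded polynomial ring\<close>

text \<open>
  The variables \<open>x\<^sub>1, \<dots>, x\<^sub>m\<close> are indexed by the finite type \<open>'m\<close> and \<open>y\<^sub>1, \<dots>, y\<^sub>n\<close> by the
  finite type \<open>'n\<close>. A polynomial is a finitely supported map from exponent vectors to
  coefficients, multiplied by convolution.
\<close>

type_synonym ('m, 'n, 'k) bipoly = "(('m + 'n) \<Rightarrow>\<^sub>0 nat) \<Rightarrow>\<^sub>0 'k"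

abbreviation bipoly_ring :: "('m::finite, 'n::finite, 'k::field) bipoly ring"
  where "bipoly_ring \<equiv> ring_of_type_algebra"

definition monomial :: "(('m + 'n) \<Rightarrow>\<^sub>0 nat) \<Rightarrow> ('m, 'n, 'k::field) bipoly"
  where "monomial t = Poly_Mapping.single t 1"

definition x_var :: "'m \<Rightarrow> ('m, 'n, 'k::field) bipoly"
  where "x_var i = monomial (Poly_Mapping.single (Inl i) 1)"

definition y_var :: "'n \<Rightarrow> ('m, 'n, 'k::field) bipoly"
  where "y_var j = monomial (Poly_Mapping.single (Inr j) 1)"

definition ideal_P :: "('m::finite, 'n::finite, 'k::field) bipoly set"
  where "ideal_P = genideal bipoly_ring (range x_var)"

definition ideal_Q :: "('m::finite, 'n::finite, 'k::field) bipoly set"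
  where "ideal_Q = genideal bipoly_ring (range y_var)"

definition monomial_ideal :: "('m::finite, 'n::finite, 'k::field) bipoly set \<Rightarrow> bool"
  where "monomial_ideal I \<longleftrightarrow> (\<exists>T. I = genideal bipoly_ring (monomial ` T))"

end

theory Submission
  imports Defs "HOL-Library.Function_Algebras"
begin

text \<open>
  Let \<open>S = K[x, y]\<close> and \<open>R = S/I\<close>. The associated primes of a monomial quotient are generated
  by sets \<open>V\<close> of variables and are annihilators \<open>(I : u)\<close> of monomials \<open>u\<close>
  (\<open>associated_prime_monomial\<close>). For a set \<open>W\<close> of variables and such a \<open>V\<close>, the module
  \<open>H\<^sup>i\<^sub>W(R)\<close> with \<open>i = card (W - V)\<close> is not zero (\<open>local_cohomology_nonzero\<close>). Hence the
  grade of \<open>R\<close> with respect to \<open>P\<close> is at most the number of variables \<open>x\<^sub>i\<close> outside \<open>V\<close> and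
  the cohomological dimension is at least this number; so for a relative Cohen--Macaulay \<open>R\<close>
  every associated prime misses exactly \<open>p\<close> of the \<open>x\<^sub>i\<close>. For \<open>S/(V)\<close> in place of \<open>R\<close> the
  same class and a vanishing theorem (\<open>local_cohomology_vanishes\<close>) give \<open>cd(Q, S/(V)) = card
  (Q - V)\<close>, so by relative unmixedness every associated prime misses exactly \<open>q\<close> of the
  \<open>y\<^sub>j\<close>. All associated primes are therefore generated by the same number of variables. A
  renaming of the variables identifies their residue rings, which then have the same
  dimension; and this is \<open>dim R\<close>, since every prime containing \<open>I\<close> contains an associated
  prime (\<open>unmixed_monomial\<close>).

  Both facts on local cohomology come from an arbitrary injective resolution \<open>E\<close> by adding
  the variables of \<open>W\<close> one at a time. If \<open>w\<close> is not in \<open>W\<close>, then \<open>w\<close> acts surjectively on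
  the \<open>W\<close>-torsion \<open>\<Gamma>\<^sub>W(E)\<close> of an injective module (\<open>var_torsion_divisible\<close>). Thus \<open>\<Gamma>\<^sub>W(E) /
  \<Gamma>\<^bsub>W \<union> {w}\<^esub>(E)\<close> is the localization of \<open>\<Gamma>\<^sub>W(E)\<close> at \<open>w\<close>, and there is a long exact sequence
  relating \<open>H\<^sub>W\<close>, its localization and \<open>H\<^bsub>W \<union> {w}\<^esub>\<close>. The cohomological dimension grows by at
  most one with each variable, and does not grow for variables that are nilpotent on the
  module (\<open>vanish\<close>).

  For the nonvanishing, let the \<open>w\<^sub>i\<close> be the variables in \<open>W - V\<close>. The nonzero class is the
  image of a fraction \<open>m / (w\<^sub>1 \<cdots> w\<^sub>r)\<^sup>N\<close> of negative degree in each \<open>w\<^sub>i\<close>, where \<open>m\<close> is a multiple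
  of \<open>u\<close> by a monomial in the \<open>w\<^sub>i\<close>, under the iterated connecting map. To see that it is
  not zero, it is mapped to the local cohomology of \<open>S/I'\<close> for a larger ideal
  \<open>I'\<close>, generated by the powers \<open>v\<^bsup>a+1\<^esup>\<close> of the variables \<open>v\<close> other than the \<open>w\<^sub>i\<close>, where
  \<open>a\<close> is the exponent of \<open>v\<close> in \<open>u\<close>. There the connecting maps are surjective by the
  vanishing theorem, so that a relation in the last cohomology module can be pulled back
  step by step to \<open>S/I'\<close>; it would put a monomial outside \<open>I'\<close> into the sum of \<open>I'\<close> and the
  ideal of powers of the \<open>w\<^sub>i\<close> that do not divide it (\<open>climbs_down\<close>).

  The resolutions that are constructed have the same module in every degree, the functionals
  \<open>Hom\<^sub>K(S, F)\<close> on \<open>S\<close> with values in a large function space \<open>F\<close>. It is injective because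
  linear maps to \<open>F\<close> extend, and each of its submodules is the kernel of an endomorphism
  (\<open>submodule_is_kernel_of_endo\<close>), so that a resolution can be continued forever without
  forming quotients.
\<close>

section \<open>Polynomials and monomial ideals\<close>

abbreviation (input) type_ring :: "'r::comm_ring_1 ring" ("\<R>")
  where "\<R> \<equiv> ring_of_type_algebra"

abbreviation (input) lookup :: "('a \<Rightarrow>\<^sub>0 'b::zero) \<Rightarrow> 'a \<Rightarrow> 'b"
  where "lookup \<equiv> Poly_Mapping.lookup"

abbreviation (input) keys :: "('a \<Rightarrow>\<^sub>0 'b::zero) \<Rightarrow> 'a set"
  where "keys \<equiv> Poly_Mapping.keys"

abbreviation (input) single :: "'a \<Rightarrow> 'b \<Rightarrow> 'a \<Rightarrow>\<^sub>0 'b::zero"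
  where "single \<equiv> Poly_Mapping.single"

lemma ring_of_type_algebra_simps [simp]:
  "carrier \<R> = UNIV"
  "x \<otimes>\<^bsub>\<R>\<^esub> y = x * y"
  "\<one>\<^bsub>\<R>\<^esub> = 1"
  "\<zero>\<^bsub>\<R>\<^esub> = 0"
  "x \<oplus>\<^bsub>\<R>\<^esub> y = x + y"
  by (simp_all add: ring_of_type_algebra_def)

lemma cring_of_type_algebra: "cring (\<R> :: 'r::comm_ring_1 ring)"
  by (rule cring_from_type_algebra)

lemma ideal_of_type_algebra_iff:
  fixes I :: "'r::comm_ring_1 set"
  shows "ideal I \<R> \<longleftrightarrow>
    0 \<in> I \<and> (\<forall>a\<in>I. \<forall>b\<in>I. a + b \<in> I) \<and> (\<forall>a. \<forall>b\<in>I. a * b \<in> I)"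
proof
  assume "ideal I \<R>"
  then interpret ideal I "\<R> :: 'r ring" .
  show "0 \<in> I \<and> (\<forall>a\<in>I. \<forall>b\<in>I. a + b \<in> I) \<and> (\<forall>a. \<forall>b\<in>I. a * b \<in> I)"
    using additive_subgroup.zero_closed[OF additive_subgroup_axioms]
      additive_subgroup.a_closed[OF additive_subgroup_axioms] I_l_closed by auto
next
  assume I: "0 \<in> I \<and> (\<forall>a\<in>I. \<forall>b\<in>I. a + b \<in> I) \<and> (\<forall>a. \<forall>b\<in>I. a * b \<in> I)"
  interpret R: cring "\<R> :: 'r ring" by (rule cring_of_type_algebra)
  have neg: "- a \<in> I" if "a \<in> I" for a
    using I that by (metis mult_minus1)
  have inv: "\<ominus>\<^bsub>\<R>\<^esub> a = - a" for a :: 'r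
    by (rule R.minus_equality) simp_all
  show "ideal I \<R>"
  proof (rule idealI)
    show "subgroup I (add_monoid (\<R> :: 'r ring))"
      using I neg inv by unfold_locales (auto simp: a_inv_def)
  next
    fix a x :: 'r assume "a \<in> I"
    then have "x * a \<in> I" "a * x \<in> I" using I by (simp_all add: mult.commute[of a x])
    then show "x \<otimes>\<^bsub>\<R>\<^esub> a \<in> I" "a \<otimes>\<^bsub>\<R>\<^esub> x \<in> I" by simp_all
  qed (rule R.ring_axioms)
qed

lemma ideal_uminus:
  fixes I :: "'r::comm_ring_1 set"
  assumes "ideal I \<R>" "a \<in> I" shows "- a \<in> I"
  using assms by (metis ideal_of_type_algebra_iff mult_minus1)

lemma ideal_diff:
  fixes I :: "'r::comm_ring_1 set"
  assumes "ideal I \<R>" "a \<in> I" "b \<in> I" shows "a - b \<in> I"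
  using assms ideal_uminus[of I b] by (metis ideal_of_type_algebra_iff diff_conv_add_uminus)

lemma ideal_sum:
  fixes I :: "'r::comm_ring_1 set"
  assumes I: "ideal I \<R>" and g: "\<And>z. z \<in> Z \<Longrightarrow> g z \<in> I"
  shows "(\<Sum>z\<in>Z. g z) \<in> I"
  using g
  by (induction Z rule: infinite_finite_induct)
    (use I in \<open>auto simp: ideal_of_type_algebra_iff\<close>)

type_synonym ('v, 'k) mpoly = "('v \<Rightarrow>\<^sub>0 nat) \<Rightarrow>\<^sub>0 'k"

abbreviation mon :: "('v \<Rightarrow>\<^sub>0 nat) \<Rightarrow> ('v, 'k::field) mpoly"
  where "mon t \<equiv> single t 1"

lemma poly_eq_sum_singles:
  fixes f :: "('v, 'k::field) mpoly"
  shows "f = (\<Sum>t\<in>keys f. single t (lookup f t))"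
proof (rule poly_mapping_eqI)
  fix s
  have "(\<Sum>t\<in>keys f. lookup (single t (lookup f t)) s)
    = (\<Sum>t\<in>keys f. if t = s then lookup f t else 0)"
    by (intro sum.cong) (auto simp: lookup_single when_def)
  also have "\<dots> = lookup f s"
    by (auto simp: sum.delta' in_keys_iff)
  finally show "lookup f s = lookup
     (\<Sum>t\<in>keys f. single t (lookup f t)) s"
    by (simp add: lookup_sum)
qed

lemma poly_induct [case_names zero single add]:
  fixes f :: "('v, 'k::field) mpoly"
  assumes "P 0" "\<And>t c. P (single t c)" "\<And>f g. P f \<Longrightarrow> P g \<Longrightarrow> P (f + g)"
  shows "P f"
proof -
  have "P (\<Sum>t\<in>Z. single t (lookup f t))" if "finite Z" for Z
    using that by induction (use assms in auto)
  from this[OF finite_keys] show ?thesis by (subst poly_eq_sum_singles) 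
qed

lemma lookup_single_times_add:
  fixes f :: "('v, 'k::field) mpoly"
  shows "lookup (single t c * f) (t + s) = c * lookup f s"
proof (induction f rule: poly_induct)
  case (single u b)
  then show ?case by (auto simp: mult_single lookup_single when_def)
qed (auto simp: lookup_add algebra_simps)

lemma lookup_single_times_not:
  fixes f :: "('v, 'k::field) mpoly"
  assumes "\<And>r. s \<noteq> t + r"
  shows "lookup (single t c * f) s = 0"
proof (induction f rule: poly_induct)
  case (single u b)
  then show ?case using assms[of u] by (auto simp: mult_single lookup_single when_def)
qed (auto simp: lookup_add algebra_simps)

lemma monom_le_imp_add:
  fixes s t :: "'v \<Rightarrow>\<^sub>0 nat"
  assumes "\<And>v. lookup t v \<le> lookup s v"
  shows "s = t + (s - t)"
  by (rule poly_mapping_eqI) (simp add: lookup_add lookup_minus assms)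

lemma monom_eq_single_add:
  fixes t :: "'v \<Rightarrow>\<^sub>0 nat"
  assumes "k \<le> lookup t v"
  shows "t = single v k + (t - single v k)"
  by (rule monom_le_imp_add) (use assms in \<open>auto simp: lookup_single when_def\<close>)

text \<open>A monomial ideal is spanned by the monomials it contains, so it is encoded by the set of
  their exponents, which is closed under adding exponents.\<close>

definition span_mon :: "('v \<Rightarrow>\<^sub>0 nat) set \<Rightarrow> ('v, 'k::field) mpoly set"
  where "span_mon U = {f. keys f \<subseteq> U}"

definition upset :: "('v \<Rightarrow>\<^sub>0 nat) set \<Rightarrow> bool"
  where "upset U \<longleftrightarrow> (\<forall>t\<in>U. \<forall>s. t + s \<in> U)"

lemma mon_in_span_mon [simp]: "mon t \<in> span_mon U \<longleftrightarrow> t \<in> U"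
  by (simp add: span_mon_def)

lemma ideal_span_mon:
  assumes "upset U"
  shows "ideal (span_mon U :: ('v, 'k::field) mpoly set) \<R>"
  unfolding ideal_of_type_algebra_iff
proof (intro conjI ballI allI)
  fix a b :: "('v, 'k) mpoly" assume "b \<in> span_mon U"
  then show "a * b \<in> span_mon U"
    using keys_mult[of a b] assms unfolding span_mon_def upset_def
    by (smt (verit, ccfv_SIG) add.commute mem_Collect_eq subset_iff)
next
  fix a b :: "('v, 'k) mpoly" assume "a \<in> span_mon U" "b \<in> span_mon U"
  then show "a + b \<in> span_mon U"
    using keys_add[of a b] unfolding span_mon_def by blast
qed (simp add: span_mon_def)

lemma span_mon_subset_ideal:
  fixes I :: "('v, 'k::field) mpoly set"
  assumes I: "ideal I \<R>" and "\<And>t. t \<in> U \<Longrightarrow> mon t \<in> I"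
  shows "span_mon U \<subseteq> I"
proof
  fix f :: "('v, 'k) mpoly" assume f: "f \<in> span_mon U"
  have "single t (lookup f t) \<in> I" if "t \<in> keys f" for t
  proof -
    have "single 0 (lookup f t) * mon t \<in> I"
      using I assms(2) f that unfolding ideal_of_type_algebra_iff span_mon_def by blast
    then show ?thesis by (simp add: mult_single)
  qed
  then show "f \<in> I"
    by (subst poly_eq_sum_singles) (intro ideal_sum I)
qed

lemma genideal_monomials:
  fixes T :: "('v \<Rightarrow>\<^sub>0 nat) set"
  shows "genideal \<R> (mon ` T :: ('v, 'k::field) mpoly set) =
    span_mon {t + s | t s. t \<in> T}"
proof -
  interpret R: cring "\<R> :: ('v, 'k) mpoly ring" by (rule cring_of_type_algebra)
  let ?U = "{t + s | t s. t \<in> T}"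
  have up: "upset ?U" unfolding upset_def by (auto simp: add.assoc) blast
  have G: "ideal (genideal \<R> (mon ` T :: ('v, 'k) mpoly set)) \<R>"
    by (rule R.genideal_ideal) simp
  show ?thesis
  proof
    show "genideal \<R> (mon ` T :: ('v, 'k) mpoly set) \<subseteq> span_mon ?U"
      by (rule R.genideal_minimal[OF ideal_span_mon[OF up]])
        (auto, metis add_0_right)
    show "span_mon ?U \<subseteq> genideal \<R> (mon ` T :: ('v, 'k) mpoly set)"
    proof (rule span_mon_subset_ideal[OF G])
      fix u assume "u \<in> ?U"
      then obtain t s where u: "u = t + s" "t \<in> T" by blast
      have "mon t \<in> genideal \<R> (mon ` T :: ('v, 'k) mpoly set)"
        using R.genideal_self[of "mon ` T"] u by auto
      then have "mon s * mon t \<in> genideal \<R> (mon ` T :: ('v, 'k) mpoly set)"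
        using G unfolding ideal_of_type_algebra_iff by blast
      then show "mon u \<in> genideal \<R> (mon ` T :: ('v, 'k) mpoly set)"
        by (simp add: mult_single u add.commute)
    qed
  qed
qed

text \<open>The exponents of the monomials in the ideal generated by the variables in \<open>V\<close>.\<close>

definition meets :: "'v set \<Rightarrow> ('v \<Rightarrow>\<^sub>0 nat) set"
  where "meets V = {t. \<exists>v\<in>V. lookup t v \<noteq> 0}"

lemma upset_meets: "upset (meets V)"
  by (auto simp: upset_def meets_def lookup_add)

lemma genideal_vars:
  "genideal \<R> ((\<lambda>v. mon (single v 1) :: ('v, 'k::field) mpoly) ` V)
    = span_mon (meets V)"
proof -
  have "{t + s | t s. t \<in> (\<lambda>v. single v (1::nat)) ` V} = meets V"
  proof (intro equalityI subsetI)
    fix t assume "t \<in> meets V"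
    then obtain v where v: "v \<in> V" "lookup t v \<noteq> 0" by (auto simp: meets_def)
    have "t = single v 1 + (t - single v 1)"
      by (rule monom_eq_single_add) (use v in simp)
    then show "t \<in> {t + s | t s. t \<in> (\<lambda>v. single v (1::nat)) ` V}"
      using v by blast
  qed (auto simp: meets_def lookup_add, metis One_nat_def lookup_single_eq zero_less_one)
  then show ?thesis
    using genideal_monomials[of "(\<lambda>v. single v (1::nat)) ` V", where ?'k = 'k]
    by (simp add: image_image)
qed

section \<open>Modules over a ring given by a type class\<close>

locale cmodule =
  fixes M :: "('r::comm_ring_1, 'b, 's) module_scheme" (structure)
  assumes is_module: "module \<R> M"
begin

sublocale module "\<R> :: 'r ring" M
  by (rule is_module)

lemma smult_carrier [simp, intro]: "x \<in> carrier M \<Longrightarrow> a \<odot> x \<in> carrier M"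
  by (rule smult_closed) simp_all

lemma smult_add_left: "x \<in> carrier M \<Longrightarrow> (a + b) \<odot> x = a \<odot> x \<oplus> b \<odot> x"
  using smult_l_distr[of a b x] by simp

lemma smult_add_right: "x \<in> carrier M \<Longrightarrow> y \<in> carrier M \<Longrightarrow> a \<odot> (x \<oplus> y) = a \<odot> x \<oplus> a \<odot> y"
  using smult_r_distr[of a x y] by simp

lemma smult_times: "x \<in> carrier M \<Longrightarrow> (a * b) \<odot> x = a \<odot> (b \<odot> x)"
  using smult_assoc1[of a b x] by simp

lemma smult_1 [simp]: "x \<in> carrier M \<Longrightarrow> 1 \<odot> x = x"
  using smult_one[of x] by simp

lemma smult_0 [simp]: "x \<in> carrier M \<Longrightarrow> 0 \<odot> x = \<zero>"
  using smult_l_null[of x] by simp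

lemma smult_zero [simp]: "a \<odot> \<zero> = \<zero>"
  using smult_r_null[of a] by simp

lemma smult_commute: "x \<in> carrier M \<Longrightarrow> a \<odot> (b \<odot> x) = b \<odot> (a \<odot> x)"
  by (metis smult_times mult.commute)

lemma smult_uminus_right: "x \<in> carrier M \<Longrightarrow> a \<odot> (\<ominus> x) = \<ominus> (a \<odot> x)"
  using smult_r_minus[of a x] by simp

lemma smult_minus: "x \<in> carrier M \<Longrightarrow> y \<in> carrier M \<Longrightarrow> a \<odot> (x \<ominus> y) = a \<odot> x \<ominus> a \<odot> y"
  by (simp add: a_minus_def smult_add_right smult_uminus_right)

lemma smult_sum_eq_zero:
  assumes "x \<in> carrier M" "\<And>z. z \<in> Z \<Longrightarrow> g z \<odot> x = \<zero>"
  shows "(\<Sum>z\<in>Z. g z) \<odot> x = \<zero>"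
  using assms(2) by (induction Z rule: infinite_finite_induct)
    (use assms(1) in \<open>auto simp: smult_add_left\<close>)

end

lemma module_homD:
  assumes "f \<in> module_hom R M N"
  shows "x \<in> carrier M \<Longrightarrow> f x \<in> carrier N"
    "x \<in> carrier M \<Longrightarrow> y \<in> carrier M \<Longrightarrow> f (x \<oplus>\<^bsub>M\<^esub> y) = f x \<oplus>\<^bsub>N\<^esub> f y"
    "a \<in> carrier R \<Longrightarrow> x \<in> carrier M \<Longrightarrow> f (a \<odot>\<^bsub>M\<^esub> x) = a \<odot>\<^bsub>N\<^esub> f x"
  using assms by (auto simp: module_hom_def)

lemma module_hom_zero:
  assumes "module R M" "module R N" "f \<in> module_hom R M N"
  shows "f \<zero>\<^bsub>M\<^esub> = \<zero>\<^bsub>N\<^esub>"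
proof -
  interpret M: module R M by fact
  interpret N: module R N by fact
  have "f \<zero>\<^bsub>M\<^esub> = f (\<zero>\<^bsub>R\<^esub> \<odot>\<^bsub>M\<^esub> \<zero>\<^bsub>M\<^esub>)" by simp
  also have "\<dots> = \<zero>\<^bsub>R\<^esub> \<odot>\<^bsub>N\<^esub> f \<zero>\<^bsub>M\<^esub>" by (rule module_homD[OF assms(3)]) simp_all
  also have "\<dots> = \<zero>\<^bsub>N\<^esub>" using module_homD(1)[OF assms(3), of "\<zero>\<^bsub>M\<^esub>"] by simp
  finally show ?thesis .
qed

lemma module_hom_minus:
  assumes "module R M" "module R N" "f \<in> module_hom R M N" "x \<in> carrier M" "y \<in> carrier M"
  shows "f (x \<ominus>\<^bsub>M\<^esub> y) = f x \<ominus>\<^bsub>N\<^esub> f y"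
proof -
  interpret M: module R M by fact
  interpret N: module R N by fact
  note h = module_homD[OF assms(3)]
  have "f (x \<ominus>\<^bsub>M\<^esub> y) \<oplus>\<^bsub>N\<^esub> f y = f (x \<ominus>\<^bsub>M\<^esub> y \<oplus>\<^bsub>M\<^esub> y)"
    using h(2)[of "x \<ominus>\<^bsub>M\<^esub> y" y] assms(4,5) by simp
  also have "x \<ominus>\<^bsub>M\<^esub> y \<oplus>\<^bsub>M\<^esub> y = x"
    using assms(4,5) by (simp add: a_minus_def M.M.a_assoc M.M.l_neg)
  finally show ?thesis
    using assms(4,5) h(1) by (metis M.M.minus_closed N.M.minus_equality N.M.a_comm a_minus_def
        N.M.add.inv_solve_right')
qed

section \<open>The module of functionals\<close>

text \<open>The coinduced module \<open>Hom\<^sub>K(S, V)\<close>, for the space \<open>V\<close> of functions \<open>'z \<Rightarrow> 'k\<close>: a linear map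
  on \<open>S\<close> is given by its values at the monomials, and \<open>S\<close> acts by multiplication in the
  argument.\<close>

type_synonym ('v, 'z, 'k) cofun = "('v \<Rightarrow>\<^sub>0 nat) \<Rightarrow> 'z \<Rightarrow> 'k"

definition act :: "('v, 'k::field) mpoly \<Rightarrow> ('v, 'z, 'k) cofun \<Rightarrow> ('v, 'z, 'k) cofun"
  where "act s x = (\<lambda>t z. \<Sum>u\<in>keys s. lookup s u * x (t + u) z)"

lemma act_superset:
  assumes "finite Z" "keys s \<subseteq> Z"
  shows "act s x = (\<lambda>t z. \<Sum>u\<in>Z. lookup s u * x (t + u) z)"
  unfolding act_def using assms
  by (intro ext sum.mono_neutral_left) (auto simp: in_keys_iff)

lemma act_single: "act (single u c) x = (\<lambda>t z. c * x (t + u) z)"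
  by (subst act_superset[of "{u}"]) auto

lemma act_add_left: "act (s + s') x = act s x + act s' x"
proof -
  let ?Z = "keys s \<union> keys s'"
  have "finite ?Z" by simp
  then show ?thesis
    using keys_add[of s s']
    by (subst (1 2 3) act_superset[of ?Z])
      (auto simp: fun_eq_iff lookup_add sum.distrib algebra_simps)
qed

lemma act_zero_left [simp]: "act 0 x = 0"
  by (simp add: act_def zero_fun_def)

lemma act_add_right: "act s (x + y) = act s x + act s y"
  by (simp add: act_def fun_eq_iff sum.distrib algebra_simps)

lemma act_zero_right [simp]: "act s 0 = 0"
  by (simp add: act_def fun_eq_iff)

lemma act_times: "act (s * s') x = act s (act s' x)"
proof (induction s rule: poly_induct)
  case (single t c)
  show ?case
    by (induction s' rule: poly_induct)
      (simp_all add: mult_single act_single algebra_simps act_add_left act_add_right)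
qed (simp_all add: act_add_left algebra_simps)

lemma act_one [simp]: "act 1 x = x"
  using act_single[of 0 1 x] by simp

lemma act_uminus_right: "act s (- x) = - act s x"
  by (metis act_add_right act_zero_right add.inverse_unique add.right_inverse)

lemma act_diff_right: "act s (x - y) = act s x - act s y"
  by (metis act_add_right act_uminus_right diff_conv_add_uminus)

lemma act_sum_right: "act s (\<Sum>z\<in>Z. g z) = (\<Sum>z\<in>Z. act s (g z))"
  by (induction Z rule: infinite_finite_induct)
    (simp_all only: sum.infinite sum.empty sum.insert act_zero_right act_add_right not_False_eq_True)

definition cofun_module :: "(('v, 'k::field) mpoly, ('v, 'z, 'k) cofun) module"
  where "cofun_module =
    \<lparr>carrier = UNIV, monoid.mult = undefined, one = undefined, ring.zero = 0, add = (+),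
     module.smult = act\<rparr>"

lemma cofun_module_simps [simp]:
  "carrier cofun_module = UNIV" "\<zero>\<^bsub>cofun_module\<^esub> = 0"
  "x \<oplus>\<^bsub>cofun_module\<^esub> y = x + y" "s \<odot>\<^bsub>cofun_module\<^esub> x = act s x"
  by (simp_all add: cofun_module_def)

lemma abelian_groupI_class:
  fixes M :: "('a, 'b::ab_group_add, 's) module_scheme"
  assumes "carrier M = UNIV" "\<zero>\<^bsub>M\<^esub> = 0" "\<And>x y. x \<oplus>\<^bsub>M\<^esub> y = x + y"
  shows "abelian_group M"
  by (rule abelian_groupI) (auto simp: assms algebra_simps intro: exI[of _ "- x" for x])

lemma module_cofun_module:
  "module \<R> (cofun_module :: (('v, 'k::field) mpoly, ('v, 'z, 'k) cofun) module)"
  by (rule moduleI[OF cring_of_type_algebra abelian_groupI_class])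
    (simp_all add: act_add_left act_add_right act_times)

subsection \<open>Injectivity\<close>

text \<open>Zorn's lemma is applied to the graphs of the partial extensions, that is, to the linear
  subsets of \<open>B \<times> V\<close> that contain the graph of \<open>h\<close> and have trivial fibre over zero: a
  maximal such graph is defined everywhere, because a missing element could be added with
  value zero.\<close>

lemma constant_linear_extension:
  fixes B :: "(('v, 'k::field) mpoly, 'b, 's) module_scheme" and h :: "'b \<Rightarrow> 'z \<Rightarrow> 'k"
  assumes "module \<R> B" "submodule A \<R> B"
    and add: "\<And>a b. a \<in> A \<Longrightarrow> b \<in> A \<Longrightarrow> h (a \<oplus>\<^bsub>B\<^esub> b) = h a + h b"
    and scale: "\<And>a c. a \<in> A \<Longrightarrow> h (single 0 c \<odot>\<^bsub>B\<^esub> a) = (\<lambda>z. c * h a z)"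
  shows "\<exists>H. (\<forall>a\<in>A. H a = h a) \<and>
    (\<forall>a\<in>carrier B. \<forall>b\<in>carrier B. H (a \<oplus>\<^bsub>B\<^esub> b) = H a + H b) \<and>
    (\<forall>c. \<forall>a\<in>carrier B. H (single 0 c \<odot>\<^bsub>B\<^esub> a) = (\<lambda>z. c * H a z))"
proof -
  interpret B: cmodule B by (rule cmodule.intro) fact
  interpret A: submodule A \<R> B by fact
  have AB: "A \<subseteq> carrier B" using A.subset by simp
  have A0: "\<zero>\<^bsub>B\<^esub> \<in> A" using A.one_closed by simp
  have Aadd: "a \<oplus>\<^bsub>B\<^esub> b \<in> A" if "a \<in> A" "b \<in> A" for a b using A.m_closed that by simp
  have Asm: "s \<odot>\<^bsub>B\<^esub> a \<in> A" if "a \<in> A" for s a using A.smult_closed that by simp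
  define K :: "'k \<Rightarrow> ('v, 'k) mpoly" where "K = single 0"
  have K_add: "K (c + d) = K c + K d" and K_mult: "K (c * d) = K c * K d"
    and K1: "K 1 = 1" and K0: "K 0 = 0" for c d
    by (simp_all add: K_def single_add mult_single)
  define linear_graph where "linear_graph g \<longleftrightarrow>
    (\<forall>b u. (b, u) \<in> g \<longrightarrow> b \<in> carrier B) \<and> (\<forall>a\<in>A. (a, h a) \<in> g) \<and>
    (\<forall>b u b' u'. (b, u) \<in> g \<longrightarrow> (b', u') \<in> g \<longrightarrow> (b \<oplus>\<^bsub>B\<^esub> b', u + u') \<in> g) \<and>
    (\<forall>c b u. (b, u) \<in> g \<longrightarrow> (K c \<odot>\<^bsub>B\<^esub> b, (\<lambda>z. c * u z)) \<in> g) \<and>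
    (\<forall>u. (\<zero>\<^bsub>B\<^esub>, u) \<in> g \<longrightarrow> u = 0)" for g :: "('b \<times> ('z \<Rightarrow> 'k)) set"
  have h0: "h \<zero>\<^bsub>B\<^esub> = 0"
    using add[OF A0 A0] by simp
  have "\<exists>G\<in>Collect linear_graph. \<forall>g\<in>Collect linear_graph. G \<subseteq> g \<longrightarrow> g = G"
  proof (rule subset_Zorn_nonempty)
    have "linear_graph ((\<lambda>a. (a, h a)) ` A)"
      unfolding linear_graph_def using AB
      by (auto simp: Aadd Asm add scale h0 K_def)
    then show "Collect linear_graph \<noteq> {}" by blast
  next
    fix C assume C: "C \<noteq> {}" "subset.chain (Collect linear_graph) C"
    then have lin: "linear_graph g" if "g \<in> C" for g
      using that by (auto simp: subset_chain_def)
    have two: "\<exists>g\<in>C. p \<in> g \<and> q \<in> g" if "p \<in> \<Union>C" "q \<in> \<Union>C" for p q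
      using C that unfolding subset_chain_def by blast
    have "linear_graph (\<Union>C)"
      unfolding linear_graph_def
    proof (intro conjI allI ballI impI)
      show "b \<in> carrier B" if "(b, u) \<in> \<Union>C" for b u
        using that lin unfolding linear_graph_def by blast
      show "(a, h a) \<in> \<Union>C" if "a \<in> A" for a
        using that C(1) lin unfolding linear_graph_def by blast
      show "(b \<oplus>\<^bsub>B\<^esub> b', u + u') \<in> \<Union>C" if "(b, u) \<in> \<Union>C" "(b', u') \<in> \<Union>C" for b b' u u'
        using two[OF that] lin unfolding linear_graph_def by (metis Union_iff)
      show "(K c \<odot>\<^bsub>B\<^esub> b, (\<lambda>z. c * u z)) \<in> \<Union>C" if "(b, u) \<in> \<Union>C" for c b u
        using that lin unfolding linear_graph_def by (metis Union_iff)
      show "u = 0" if "(\<zero>\<^bsub>B\<^esub>, u) \<in> \<Union>C" for u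
        using that lin unfolding linear_graph_def by (metis Union_iff)
    qed
    then show "\<Union>C \<in> Collect linear_graph" by simp
  qed
  then obtain G where G: "linear_graph G" and max: "\<And>g. linear_graph g \<Longrightarrow> G \<subseteq> g \<Longrightarrow> g = G"
    by auto
  have Gc: "b \<in> carrier B" if "(b, u) \<in> G" for b u using G that unfolding linear_graph_def by blast
  have GA: "(a, h a) \<in> G" if "a \<in> A" for a using G that unfolding linear_graph_def by blast
  have Gadd: "(b \<oplus>\<^bsub>B\<^esub> b', u + u') \<in> G" if "(b, u) \<in> G" "(b', u') \<in> G" for b u b' u'
    using G that unfolding linear_graph_def by blast
  have Gsc: "(K c \<odot>\<^bsub>B\<^esub> b, (\<lambda>z. c * u z)) \<in> G" if "(b, u) \<in> G" for c b u
    using G that unfolding linear_graph_def by blast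
  have G0: "u = 0" if "(\<zero>\<^bsub>B\<^esub>, u) \<in> G" for u using G that unfolding linear_graph_def by blast
  have G00: "(\<zero>\<^bsub>B\<^esub>, 0) \<in> G" using GA[OF A0] h0 by simp
  have total: "\<exists>u. (b, u) \<in> G" if b: "b \<in> carrier B" for b
  proof (rule ccontr)
    assume no: "\<nexists>u. (b, u) \<in> G"
    let ?g = "{(a \<oplus>\<^bsub>B\<^esub> K c \<odot>\<^bsub>B\<^esub> b, u) | a c u. (a, u) \<in> G}"
    have "linear_graph ?g"
      unfolding linear_graph_def
    proof (intro conjI)
      show "\<forall>b u. (b, u) \<in> ?g \<longrightarrow> b \<in> carrier B" using Gc b by auto
      have "(a, u) \<in> ?g" if "(a, u) \<in> G" for a u
        using that Gc[OF that] b by (auto intro!: exI[of _ a] exI[of _ 0] simp: K0)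
      then show "\<forall>a\<in>A. (a, h a) \<in> ?g" using GA by blast
      have "(a \<oplus>\<^bsub>B\<^esub> K c \<odot>\<^bsub>B\<^esub> b \<oplus>\<^bsub>B\<^esub> (a' \<oplus>\<^bsub>B\<^esub> K c' \<odot>\<^bsub>B\<^esub> b), u + u') \<in> ?g"
        if "(a, u) \<in> G" "(a', u') \<in> G" for a c u a' c' u'
      proof -
        have "a \<oplus>\<^bsub>B\<^esub> K c \<odot>\<^bsub>B\<^esub> b \<oplus>\<^bsub>B\<^esub> (a' \<oplus>\<^bsub>B\<^esub> K c' \<odot>\<^bsub>B\<^esub> b) = a \<oplus>\<^bsub>B\<^esub> a' \<oplus>\<^bsub>B\<^esub> K (c + c') \<odot>\<^bsub>B\<^esub> b"
          using that Gc b by (simp add: K_add B.smult_add_left B.M.add.m_ac)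
        then show ?thesis using Gadd that by blast
      qed
      then show "\<forall>b u b' u'. (b, u) \<in> ?g \<longrightarrow> (b', u') \<in> ?g \<longrightarrow> (b \<oplus>\<^bsub>B\<^esub> b', u + u') \<in> ?g" by blast
      have "(K d \<odot>\<^bsub>B\<^esub> (a \<oplus>\<^bsub>B\<^esub> K c \<odot>\<^bsub>B\<^esub> b), (\<lambda>z. d * u z)) \<in> ?g" if "(a, u) \<in> G" for a c d u
      proof -
        have "K d \<odot>\<^bsub>B\<^esub> (a \<oplus>\<^bsub>B\<^esub> K c \<odot>\<^bsub>B\<^esub> b) = K d \<odot>\<^bsub>B\<^esub> a \<oplus>\<^bsub>B\<^esub> K (d * c) \<odot>\<^bsub>B\<^esub> b"
          using that Gc b by (simp add: K_mult B.smult_add_right B.smult_times)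
        then show ?thesis using Gsc that by blast
      qed
      then show "\<forall>c b u. (b, u) \<in> ?g \<longrightarrow> (K c \<odot>\<^bsub>B\<^esub> b, (\<lambda>z. c * u z)) \<in> ?g" by blast
      have "u = 0" if eq: "\<zero>\<^bsub>B\<^esub> = a \<oplus>\<^bsub>B\<^esub> K c \<odot>\<^bsub>B\<^esub> b" and au: "(a, u) \<in> G" for a c u
      proof (cases "c = 0")
        case True
        then show ?thesis using eq au Gc[OF au] b G0 by (simp add: K0)
      next
        case False
        have "K c \<odot>\<^bsub>B\<^esub> b = K (- 1) \<odot>\<^bsub>B\<^esub> a"
        proof -
          have "K (- 1) \<odot>\<^bsub>B\<^esub> a \<oplus>\<^bsub>B\<^esub> a = (K (- 1) + K 1) \<odot>\<^bsub>B\<^esub> a"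
            using Gc[OF au] by (simp add: B.smult_add_left K1)
          also have "\<dots> = \<zero>\<^bsub>B\<^esub>" using Gc[OF au] by (simp flip: K_add add: K0)
          finally have "K (- 1) \<odot>\<^bsub>B\<^esub> a = \<ominus>\<^bsub>B\<^esub> a"
            using Gc[OF au] by (metis B.M.minus_equality B.smult_carrier)
          moreover have "K c \<odot>\<^bsub>B\<^esub> b = \<ominus>\<^bsub>B\<^esub> a"
            using eq Gc[OF au] b by (metis B.M.minus_equality B.smult_carrier B.M.a_comm)
          ultimately show ?thesis by simp
        qed
        then have "K (inverse c) \<odot>\<^bsub>B\<^esub> (K c \<odot>\<^bsub>B\<^esub> b) = K (inverse c) \<odot>\<^bsub>B\<^esub> (K (- 1) \<odot>\<^bsub>B\<^esub> a)" by simp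
        then have "b = K (inverse c * (- 1)) \<odot>\<^bsub>B\<^esub> a"
          using b Gc[OF au] False by (simp flip: B.smult_times K_mult add: K1)
        then show ?thesis using no Gsc[OF au] by blast
      qed
      then show "\<forall>u. (\<zero>\<^bsub>B\<^esub>, u) \<in> ?g \<longrightarrow> u = 0" by blast
    qed
    moreover have "G \<subseteq> ?g"
    proof
      fix p assume "p \<in> G"
      then obtain a u where p: "p = (a, u)" "(a, u) \<in> G" by (cases p) auto
      then show "p \<in> ?g" using Gc[OF p(2)] b
        by (auto intro!: exI[of _ a] exI[of _ 0] simp: K0)
    qed
    ultimately have "?g = G" by (rule max)
    moreover have "(b, 0) \<in> ?g"
      using G00 b by (auto intro!: exI[of _ "\<zero>\<^bsub>B\<^esub>"] exI[of _ 1] simp: K1)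
    ultimately show False using no by blast
  qed
  have unique: "u = u'" if "(b, u) \<in> G" "(b, u') \<in> G" for b u u'
  proof -
    have "(b \<oplus>\<^bsub>B\<^esub> K (- 1) \<odot>\<^bsub>B\<^esub> b, u + (\<lambda>z. - 1 * u' z)) \<in> G" by (intro Gadd Gsc that)
    moreover have "b \<oplus>\<^bsub>B\<^esub> K (- 1) \<odot>\<^bsub>B\<^esub> b = (K 1 + K (- 1)) \<odot>\<^bsub>B\<^esub> b"
      using Gc[OF that(1)] by (simp add: B.smult_add_left K1)
    moreover have "\<dots> = \<zero>\<^bsub>B\<^esub>" using Gc[OF that(1)] by (simp flip: K_add add: K0)
    ultimately have "u + (\<lambda>z. - 1 * u' z) = 0" using G0 by simp
    then show ?thesis by (auto simp: fun_eq_iff)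
  qed
  define H where "H b = (THE u. (b, u) \<in> G)" for b
  have HG: "(b, u) \<in> G \<Longrightarrow> H b = u" for b u
    unfolding H_def using unique by blast
  have "(b, H b) \<in> G" if "b \<in> carrier B" for b
    using total[OF that] HG by blast
  then show ?thesis
    using HG GA Gadd Gsc by (intro exI[of _ H]) (simp flip: K_def)
qed

text \<open>A homomorphism into \<open>Hom\<^sub>K(S, V)\<close> amounts to a \<open>K\<close>-linear map into \<open>V\<close>, its value at the
  monomial \<open>1\<close>; and \<open>K\<close>-linear maps extend.\<close>

theorem cofun_module_injective:
  fixes B :: "(('v, 'k::field) mpoly, 'b) module"
    and f :: "'b \<Rightarrow> ('v, 'z, 'k) cofun"
  assumes B: "module \<R> B" and A: "submodule A \<R> B"
    and f: "f \<in> module_hom \<R> (B\<lparr>carrier := A\<rparr>) cofun_module"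
  shows "\<exists>g\<in>module_hom \<R> B cofun_module. \<forall>x\<in>A. g x = f x"
proof -
  interpret B: cmodule B by (rule cmodule.intro) fact
  interpret A: submodule A \<R> B by fact
  have AB: "a \<in> carrier B" if "a \<in> A" for a using A.subset that by auto
  have Asm: "s \<odot>\<^bsub>B\<^esub> a \<in> A" if "a \<in> A" for s a using A.smult_closed that by simp
  have fadd: "f (a \<oplus>\<^bsub>B\<^esub> b) = f a + f b" if "a \<in> A" "b \<in> A" for a b
    using module_homD(2)[OF f] that by simp
  have fsm: "f (s \<odot>\<^bsub>B\<^esub> a) = act s (f a)" if "a \<in> A" for a s
    using module_homD(3)[OF f] that by simp
  have "\<exists>H. (\<forall>a\<in>A. H a = f a 0) \<and>
    (\<forall>a\<in>carrier B. \<forall>b\<in>carrier B. H (a \<oplus>\<^bsub>B\<^esub> b) = H a + H b) \<and>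
    (\<forall>c. \<forall>a\<in>carrier B. H (single 0 c \<odot>\<^bsub>B\<^esub> a) = (\<lambda>z. c * H a z))"
    by (rule constant_linear_extension[OF B A]) (simp_all add: fadd fsm act_single)
  then obtain H where H: "\<forall>a\<in>A. H a = f a 0"
    and Hadd: "\<forall>a\<in>carrier B. \<forall>b\<in>carrier B. H (a \<oplus>\<^bsub>B\<^esub> b) = H a + H b"
    and Hsc: "\<forall>c. \<forall>a\<in>carrier B. H (single 0 c \<odot>\<^bsub>B\<^esub> a) = (\<lambda>z. c * H a z)"
    by (elim exE conjE)
  \<comment> \<open>the homomorphism with value \<open>H\<close> at the monomial \<open>1\<close>\<close>
  define g where "g b = (\<lambda>t. H (mon t \<odot>\<^bsub>B\<^esub> b))" for b
  have gadd: "g (a \<oplus>\<^bsub>B\<^esub> b) = g a + g b" if "a \<in> carrier B" "b \<in> carrier B" for a b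
    using that by (simp add: g_def fun_eq_iff B.smult_add_right Hadd)
  have gsm: "g (s \<odot>\<^bsub>B\<^esub> b) = act s (g b)" if b: "b \<in> carrier B" for s b
  proof (induction s rule: poly_induct)
    case zero
    have "g \<zero>\<^bsub>B\<^esub> + g \<zero>\<^bsub>B\<^esub> = g \<zero>\<^bsub>B\<^esub>" using gadd[of "\<zero>\<^bsub>B\<^esub>" "\<zero>\<^bsub>B\<^esub>"] by simp
    then show ?case using b by (metis add_cancel_right_right B.smult_0 act_zero_left)
  next
    case (single u c)
    have "mon t \<odot>\<^bsub>B\<^esub> (single u c \<odot>\<^bsub>B\<^esub> b) = single 0 c \<odot>\<^bsub>B\<^esub> (mon (t + u) \<odot>\<^bsub>B\<^esub> b)" for t
      using b by (simp flip: B.smult_times add: mult_single)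
    then show ?case using b by (simp add: g_def Hsc act_single)
  next
    case (add s s')
    then show ?case using b by (simp add: B.smult_add_left act_add_left gadd)
  qed
  have "g a = f a" if a: "a \<in> A" for a
    using a by (simp add: g_def H Asm fsm act_single)
  then show ?thesis
    by (intro bexI[of _ g]) (auto simp: module_hom_def gadd gsm)
qed

section \<open>Resolutions by modules of functionals\<close>

text \<open>The map is the projection along the subspace onto a complement, so it vanishes on a basis
  of the subspace and fixes the other elements of an extended basis.\<close>

lemma (in vector_space) subspace_is_kernel:
  assumes U: "subspace U"
  shows "\<exists>g. Vector_Spaces.linear scale scale g \<and> (\<forall>x. g x = 0 \<longleftrightarrow> x \<in> U)"
proof -
  interpret vector_space_pair scale scale by unfold_locales
  obtain C where C: "C \<subseteq> U" "independent C" "U \<subseteq> span C"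
    using maximal_independent_subset[of U] by auto
  have spanC: "span C = U" using C U by (simp add: span_minimal subset_antisym)
  obtain g where g: "Vector_Spaces.linear scale scale g"
    "\<forall>b\<in>extend_basis C. g b = (if b \<in> C then 0 else b)"
    using linear_independent_extend[OF independent_extend_basis[OF C(2)], of "\<lambda>b. if b \<in> C then 0 else b"]
    by (elim exE conjE)
  interpret g: Vector_Spaces.linear scale scale g by (rule g(1))
  have sub: "x - g x \<in> U" for x
  proof -
    have "x \<in> span (extend_basis C)" using span_extend_basis[OF C(2)] by simp
    then show ?thesis
    proof (induction rule: span_induct_alt)
      case base
      then show ?case using U by (simp add: g.zero subspace_0)
    next
      case (step c b y)
      have "b - g b \<in> U"
        using g(2) step(1) C(1) U by (auto simp: subspace_0)
      then have "scale c (b - g b) + (y - g y) \<in> U"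
        using step(2) U subspace_add subspace_scale by blast
      moreover have "scale c (b - g b) + (y - g y) = (scale c b + y) - g (scale c b + y)"
        by (simp add: g.add g.scale scale_right_diff_distrib)
      ultimately show ?case by simp
    qed
  qed
  have "g x = 0" if "x \<in> U" for x
  proof -
    have "x \<in> span C" using that spanC by simp
    then show ?thesis
    proof (induction rule: span_induct_alt)
      case base
      then show ?case by (simp add: g.zero)
    next
      case (step c b y)
      then show ?case using g(2) extend_basis_superset[OF C(2)] by (auto simp: g.add g.scale)
    qed
  qed
  moreover have "x \<in> U" if "g x = 0" for x using sub[of x] that by simp
  ultimately show ?thesis using g(1) by blast
qed

text \<open>The functionals are functions of an exponent vector and of the argument of their values. If
  this argument is a list of exponent vectors, then consing both into one longer list embeds
  the space of functionals linearly into the space of their values; this is what allows to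
  repeat the construction of a map out of the module.\<close>

type_synonym ('v, 'k) cofree = "('v, ('v \<Rightarrow>\<^sub>0 nat) list, 'k) cofun"

definition uncurry_list :: "('v, 'k::field) cofree \<Rightarrow> ('v \<Rightarrow>\<^sub>0 nat) list \<Rightarrow> 'k"
  where "uncurry_list x = (\<lambda>l. case l of [] \<Rightarrow> 0 | t # l' \<Rightarrow> x t l')"

definition submodule_of_cofree :: "('v, 'k::field) cofree set \<Rightarrow> bool"
  where "submodule_of_cofree U \<longleftrightarrow> 0 \<in> U \<and> (\<forall>x\<in>U. \<forall>y\<in>U. x + y \<in> U) \<and> (\<forall>s. \<forall>x\<in>U. act s x \<in> U)"

definition cofree_endo :: "(('v, 'k::field) cofree \<Rightarrow> ('v, 'k) cofree) \<Rightarrow> bool"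
  where "cofree_endo D \<longleftrightarrow> (\<forall>x y. D (x + y) = D x + D y) \<and> (\<forall>s x. D (act s x) = act s (D x))"

text \<open>If \<open>\<pi>\<close> is a linear map with kernel a submodule \<open>U\<close>, then \<open>x \<mapsto> (t \<mapsto> \<pi> (t x))\<close> is linear over
  the polynomial ring and has kernel \<open>U\<close> too.\<close>

lemma submodule_is_kernel_of_endo:
  fixes U :: "('v, 'k::field) cofree set"
  assumes U: "submodule_of_cofree U"
  shows "\<exists>D. cofree_endo D \<and> (\<forall>x. D x = 0 \<longleftrightarrow> x \<in> U)"
proof -
  let ?sc = "\<lambda>(c::'k) (x :: ('v, 'k) cofree). (\<lambda>t l. c * x t l)"
  interpret V: vector_space ?sc
    by unfold_locales (auto simp: fun_eq_iff algebra_simps)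
  have "V.subspace U"
  proof (rule V.subspaceI)
    show "?sc c x \<in> U" if "x \<in> U" for c x
    proof -
      have "act (single 0 c) x \<in> U" using U that by (simp add: submodule_of_cofree_def)
      then show ?thesis by (simp add: act_single)
    qed
  qed (use U in \<open>simp_all add: submodule_of_cofree_def\<close>)
  then obtain g where g: "Vector_Spaces.linear ?sc ?sc g" "\<And>x. g x = 0 \<longleftrightarrow> x \<in> U"
    using V.subspace_is_kernel by blast
  interpret g: Vector_Spaces.linear ?sc ?sc g by (rule g(1))
  define D where "D x = (\<lambda>t. uncurry_list (g (act (mon t) x)))" for x
  have g_sc: "g (\<lambda>t l. c * x t l) = (\<lambda>t l. c * g x t l)" for c x by (rule g.scale)
  have D_add: "D (x + y) = D x + D y" for x y
    by (auto simp: D_def fun_eq_iff act_add_right g.add uncurry_list_def split: list.splits)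
  have D0: "D 0 = 0"
    by (auto simp: D_def fun_eq_iff g.zero uncurry_list_def split: list.splits)
  have "D (act s x) = act s (D x)" for s x
  proof (induction s rule: poly_induct)
    case (single u c)
    have "act (mon t) (act (single u c) x) = (\<lambda>t' l. c * act (mon (t + u)) x t' l)" for t
      by (simp add: act_single add.assoc)
    then have "D (act (single u c) x) =
        (\<lambda>t. uncurry_list (\<lambda>t' l. c * g (act (mon (t + u)) x) t' l))"
      by (simp only: D_def g_sc)
    moreover have "act (single u c) (D x) =
        (\<lambda>t l. c * uncurry_list (g (act (mon (t + u)) x)) l)"
      by (simp only: D_def act_single)
    ultimately show ?case
      by (auto simp: fun_eq_iff uncurry_list_def split: list.splits)
  qed (simp_all only: D0 D_add act_add_left act_zero_left)
  moreover have "D x = 0 \<longleftrightarrow> x \<in> U" for x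
  proof
    assume "D x = 0"
    then have "D x 0 (t # l) = 0" for t l by simp
    then have "g x t l = 0" for t l by (simp add: D_def uncurry_list_def)
    then have "g x = 0" by (simp add: fun_eq_iff)
    then show "x \<in> U" using g(2) by blast
  next
    assume "x \<in> U"
    then have "g (act (mon t) x) = 0" for t using U g(2) by (auto simp: submodule_of_cofree_def)
    then show "D x = 0" by (auto simp: D_def fun_eq_iff uncurry_list_def split: list.splits)
  qed
  ultimately show ?thesis unfolding cofree_endo_def using D_add by blast
qed

text \<open>The same construction as for submodules of the module of functionals, now starting from a
  linear endomorphism of the polynomial ring with kernel \<open>I\<close>.\<close>

lemma ideal_is_kernel_to_cofree:
  fixes I :: "('v, 'k::field) mpoly set"
  assumes I: "ideal I \<R>"
  shows "\<exists>\<epsilon> :: ('v, 'k) mpoly \<Rightarrow> ('v, 'k) cofree. (\<forall>f g. \<epsilon> (f + g) = \<epsilon> f + \<epsilon> g) \<and>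
    (\<forall>s f. \<epsilon> (s * f) = act s (\<epsilon> f)) \<and> (\<forall>f. \<epsilon> f = 0 \<longleftrightarrow> f \<in> I)"
proof -
  let ?sc = "\<lambda>(c::'k) (f :: ('v, 'k) mpoly). single 0 c * f"
  interpret V: vector_space ?sc
    by unfold_locales (auto simp: algebra_simps single_add mult_single simp flip: mult.assoc)
  have "V.subspace I"
    by (rule V.subspaceI) (use I in \<open>simp_all add: ideal_of_type_algebra_iff\<close>)
  then obtain g where g: "Vector_Spaces.linear ?sc ?sc g" "\<And>x. g x = 0 \<longleftrightarrow> x \<in> I"
    using V.subspace_is_kernel by blast
  interpret g: Vector_Spaces.linear ?sc ?sc g by (rule g(1))
  define v :: "('v, 'k) mpoly \<Rightarrow> ('v \<Rightarrow>\<^sub>0 nat) list \<Rightarrow> 'k"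
    where "v f l = (case l of [] \<Rightarrow> 0 | t # l' \<Rightarrow> lookup f t)" for f l
  define \<epsilon> where "\<epsilon> f = (\<lambda>t. v (g (mon t * f)))" for f
  have add: "\<epsilon> (f + f') = \<epsilon> f + \<epsilon> f'" for f f'
    by (auto simp: \<epsilon>_def fun_eq_iff distrib_left g.add v_def lookup_add split: list.splits)
  have zero: "\<epsilon> 0 = 0"
    by (auto simp: \<epsilon>_def fun_eq_iff g.zero v_def split: list.splits)
  have "\<epsilon> (s * f) = act s (\<epsilon> f)" for s f
  proof (induction s rule: poly_induct)
    case (single u c)
    have "mon t * (single u c * f) = single 0 c * (mon (t + u) * f)" for t
      by (simp add: mult_single flip: mult.assoc)
    then have "g (mon t * (single u c * f)) = single 0 c * g (mon (t + u) * f)" for t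
      by (simp only: g.scale)
    moreover have "lookup (single 0 c * h) t = c * lookup h t"
      for h :: "('v, 'k) mpoly" and t using lookup_single_times_add[of 0 c h t] by simp
    ultimately show ?case
      by (auto simp: \<epsilon>_def fun_eq_iff act_single v_def split: list.splits)
  qed (simp_all only: zero add act_add_left act_zero_left distrib_right mult_zero_left)
  moreover have "\<epsilon> f = 0 \<longleftrightarrow> f \<in> I" for f
  proof
    assume "\<epsilon> f = 0"
    then have "\<epsilon> f 0 [t] = 0" for t by simp
    then have "g f = 0"
      by (intro poly_mapping_eqI) (simp add: \<epsilon>_def v_def)
    then show "f \<in> I" using g(2) by blast
  next
    assume "f \<in> I"
    then have "g (mon t * f) = 0" for t using I g(2) by (auto simp: ideal_of_type_algebra_iff)
    then show "\<epsilon> f = 0" by (auto simp: \<epsilon>_def fun_eq_iff v_def split: list.splits)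
  qed
  ultimately show ?thesis using add by blast
qed

lemma cofree_endo_simps:
  assumes "cofree_endo D"
  shows "D (x + y) = D x + D y" "D (act s x) = act s (D x)" "D 0 = 0" "D (- x) = - D x"
    "D (x - y) = D x - D y"
proof -
  show add: "D (x + y) = D x + D y" for x y using assms by (simp add: cofree_endo_def)
  show "D (act s x) = act s (D x)" using assms by (simp add: cofree_endo_def)
  show z: "D 0 = 0" using add[of 0 0] by simp
  show u: "D (- x) = - D x" for x using add[of x "- x"] z by (metis add.right_inverse minus_unique)
  show "D (x - y) = D x - D y" by (metis add u diff_conv_add_uminus)
qed

lemma submodule_range_endo:
  assumes "cofree_endo D" shows "submodule_of_cofree (range D)"
  unfolding submodule_of_cofree_def
  by (auto simp flip: cofree_endo_simps(1,2)[OF assms] intro: range_eqI[of 0 D 0, OF cofree_endo_simps(3)[OF assms, symmetric]])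

text \<open>Each map is chosen with kernel the image of the previous one; an endomorphism of the module
  of functionals serves in every degree.\<close>

theorem cofree_resolution:
  fixes I :: "('v, 'k::field) mpoly set"
  assumes "ideal I \<R>"
  shows "\<exists>(\<epsilon> :: ('v, 'k) mpoly \<Rightarrow> ('v, 'k) cofree) D.
    (\<forall>f g. \<epsilon> (f + g) = \<epsilon> f + \<epsilon> g) \<and> (\<forall>s f. \<epsilon> (s * f) = act s (\<epsilon> f)) \<and> (\<forall>f. \<epsilon> f = 0 \<longleftrightarrow> f \<in> I) \<and>
    (\<forall>i::nat. cofree_endo (D i)) \<and> range \<epsilon> = {x. D 0 x = 0} \<and>
    (\<forall>i. range (D i) = {x. D (Suc i) x = 0})"
proof -
  obtain \<epsilon> :: "('v, 'k) mpoly \<Rightarrow> ('v, 'k) cofree" where e: "\<And>f g. \<epsilon> (f + g) = \<epsilon> f + \<epsilon> g"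
    "\<And>s f. \<epsilon> (s * f) = act s (\<epsilon> f)" "\<And>f. \<epsilon> f = 0 \<longleftrightarrow> f \<in> I"
    using ideal_is_kernel_to_cofree[OF assms] by blast
  have "\<epsilon> 0 = 0" using e(1)[of 0 0] by simp
  then have "0 \<in> range \<epsilon>" by (metis rangeI)
  then have sub: "submodule_of_cofree (range \<epsilon>)"
    unfolding submodule_of_cofree_def by (auto simp flip: e(1,2))
  have "\<exists>D. \<forall>i::nat. (cofree_endo (D i) \<and> (i = 0 \<longrightarrow> range \<epsilon> = {x. D i x = 0})) \<and>
    range (D i) = {x. D (Suc i) x = 0}"
  proof (rule dependent_nat_choice)
    show "\<exists>D. cofree_endo D \<and> (0 = (0::nat) \<longrightarrow> range \<epsilon> = {x. D x = 0})"
      using submodule_is_kernel_of_endo[OF sub] by auto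
  next
    fix D :: "('v, 'k) cofree \<Rightarrow> ('v, 'k) cofree" and i :: nat
    assume "cofree_endo D \<and> (i = 0 \<longrightarrow> range \<epsilon> = {x. D x = 0})"
    then show "\<exists>D'. (cofree_endo D' \<and> (Suc i = 0 \<longrightarrow> range \<epsilon> = {x. D' x = 0})) \<and> range D = {x. D' x = 0}"
      using submodule_is_kernel_of_endo[OF submodule_range_endo[of D]] by auto
  qed
  then obtain D where D: "\<forall>i::nat. (cofree_endo (D i) \<and> (i = 0 \<longrightarrow> range \<epsilon> = {x. D i x = 0})) \<and>
    range (D i) = {x. D (Suc i) x = 0}"
    by (elim exE)
  show ?thesis
    by (rule exI[of _ \<epsilon>], rule exI[of _ D]) (use D e in simp)
qed

section \<open>Cyclic modules\<close>

definition coset :: "'r::comm_ring_1 set \<Rightarrow> 'r \<Rightarrow> 'r set"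
  where "coset I f = (\<lambda>i. i + f) ` I"

lemma regular_module_simps [simp]:
  "carrier (regular_module R) = carrier R" "\<zero>\<^bsub>regular_module R\<^esub> = \<zero>\<^bsub>R\<^esub>"
  "x \<oplus>\<^bsub>regular_module R\<^esub> y = x \<oplus>\<^bsub>R\<^esub> y" "x \<odot>\<^bsub>regular_module R\<^esub> y = x \<otimes>\<^bsub>R\<^esub> y"
  by (simp_all add: regular_module_def)

lemma module_regular_module:
  "module \<R> (regular_module (\<R> :: 'r::comm_ring_1 ring))"
  by (rule moduleI[OF cring_of_type_algebra abelian_groupI_class]) (simp_all add: algebra_simps)

context
  fixes I :: "'r::comm_ring_1 set"
  assumes I: "ideal I \<R>"
begin

lemma coset_eq_iff: "coset I f = coset I g \<longleftrightarrow> f - g \<in> I"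
proof
  assume "coset I f = coset I g"
  moreover have "f \<in> coset I f" using I by (force simp: coset_def ideal_of_type_algebra_iff)
  ultimately show "f - g \<in> I" by (auto simp: coset_def)
next
  have sub: "coset I f \<subseteq> coset I g" if "f - g \<in> I" for f g
  proof
    fix x assume "x \<in> coset I f"
    then obtain i where "i \<in> I" "x = i + f" by (auto simp: coset_def)
    then show "x \<in> coset I g"
      using that I by (auto simp: coset_def ideal_of_type_algebra_iff intro!: image_eqI[of _ _ "i + (f - g)"])
  qed
  assume "f - g \<in> I"
  moreover from this have "g - f \<in> I" using ideal_uminus[OF I] by fastforce
  ultimately show "coset I f = coset I g" using sub by blast
qed

lemma a_r_coset_regular: "I +>\<^bsub>regular_module \<R>\<^esub> f = coset I f"
  by (auto simp: a_r_coset_def' coset_def)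

lemma cyclic_module_simps:
  "carrier (cyclic_module \<R> I) = range (coset I)"
  "\<zero>\<^bsub>cyclic_module \<R> I\<^esub> = coset I 0"
  "coset I f \<oplus>\<^bsub>cyclic_module \<R> I\<^esub> coset I g = coset I (f + g)"
  "s \<odot>\<^bsub>cyclic_module \<R> I\<^esub> coset I f = coset I (s * f)"
proof -
  show "carrier (cyclic_module \<R> I) = range (coset I)"
    by (auto simp: cyclic_module_def quotient_module_def A_RCOSETS_def' a_r_coset_regular)
  show "\<zero>\<^bsub>cyclic_module \<R> I\<^esub> = coset I 0"
    by (simp add: cyclic_module_def quotient_module_def coset_def)
  have "coset I f <+>\<^bsub>regular_module \<R>\<^esub> coset I g = coset I (f + g)" for f g
  proof (intro equalityI subsetI)
    fix x assume "x \<in> coset I f <+>\<^bsub>regular_module \<R>\<^esub> coset I g"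
    then obtain i j where "i \<in> I" "j \<in> I" "x = (i + f) + (j + g)"
      by (auto simp: set_add_def' coset_def)
    then show "x \<in> coset I (f + g)"
      using I by (auto simp: coset_def ideal_of_type_algebra_iff algebra_simps intro!: image_eqI[of _ _ "i + j"])
  next
    fix x assume "x \<in> coset I (f + g)"
    then obtain i where i: "i \<in> I" "x = (i + f) + (0 + g)" by (auto simp: coset_def algebra_simps)
    moreover have "i + f \<in> coset I f" using i by (simp add: coset_def)
    moreover have "0 + g \<in> coset I g"
      using I unfolding coset_def ideal_of_type_algebra_iff by blast
    ultimately show "x \<in> coset I f <+>\<^bsub>regular_module \<R>\<^esub> coset I g"
      unfolding set_add_def' by auto
  qed
  then show "coset I f \<oplus>\<^bsub>cyclic_module \<R> I\<^esub> coset I g = coset I (f + g)"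
    by (simp add: cyclic_module_def quotient_module_def)
  have "(\<Union>x\<in>coset I f. coset I (s * x)) = coset I (s * f)"
  proof -
    have "coset I (s * (i + f)) = coset I (s * f)" if "i \<in> I" for i
    proof -
      have "s * i \<in> I" using that I by (simp add: ideal_of_type_algebra_iff)
      then show ?thesis unfolding coset_eq_iff by (simp add: distrib_left)
    qed
    moreover have "I \<noteq> {}" using I by (auto simp: ideal_of_type_algebra_iff)
    ultimately show ?thesis by (auto simp: coset_def)
  qed
  then show "s \<odot>\<^bsub>cyclic_module \<R> I\<^esub> coset I f = coset I (s * f)"
    by (simp add: cyclic_module_def quotient_module_def a_r_coset_regular)
qed

lemma module_cyclic_module: "module \<R> (cyclic_module \<R> I)"
proof (rule moduleI[OF cring_of_type_algebra])
  show "abelian_group (cyclic_module \<R> I)"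
  proof (rule abelian_groupI)
    fix x assume "x \<in> carrier (cyclic_module \<R> I)"
    then obtain f where "x = coset I f" by (auto simp: cyclic_module_simps)
    then show "\<exists>y\<in>carrier (cyclic_module \<R> I).
        y \<oplus>\<^bsub>cyclic_module \<R> I\<^esub> x = \<zero>\<^bsub>cyclic_module \<R> I\<^esub>"
      by (auto simp: cyclic_module_simps intro!: exI[of _ "- f"])
  qed (auto simp: cyclic_module_simps algebra_simps)
qed (auto simp: cyclic_module_simps algebra_simps)

end

section \<open>Existence of injective resolutions\<close>

text \<open>The terms of the chosen resolutions have elements of a fixed type; the module of
  functionals is transported there along an injection.\<close>

definition image_module :: "(('v, 'k::field) cofree \<Rightarrow> 'e) \<Rightarrow> (('v, 'k) mpoly, 'e) module"
  where "image_module \<iota> =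
    \<lparr>carrier = range \<iota>, monoid.mult = undefined, one = undefined, ring.zero = \<iota> 0,
     add = (\<lambda>a b. \<iota> (inv_into UNIV \<iota> a + inv_into UNIV \<iota> b)), module.smult = (\<lambda>s a. \<iota> (act s (inv_into UNIV \<iota> a)))\<rparr>"

context
  fixes \<iota> :: "('v, 'k::field) cofree \<Rightarrow> 'e"
  assumes inj: "inj \<iota>"
begin

lemma image_module_simps:
  "carrier (image_module \<iota>) = range \<iota>" "\<zero>\<^bsub>image_module \<iota>\<^esub> = \<iota> 0"
  "\<iota> x \<oplus>\<^bsub>image_module \<iota>\<^esub> \<iota> y = \<iota> (x + y)" "s \<odot>\<^bsub>image_module \<iota>\<^esub> \<iota> x = \<iota> (act s x)"
  using inj by (simp_all add: image_module_def)

lemma module_image_module: "module \<R> (image_module \<iota>)"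
proof (rule moduleI[OF cring_of_type_algebra])
  show "abelian_group (image_module \<iota>)"
  proof (rule abelian_groupI)
    fix x assume "x \<in> carrier (image_module \<iota>)"
    then obtain f where "x = \<iota> f" by (auto simp: image_module_simps)
    then show "\<exists>y\<in>carrier (image_module \<iota>). y \<oplus>\<^bsub>image_module \<iota>\<^esub> x = \<zero>\<^bsub>image_module \<iota>\<^esub>"
      by (auto simp: image_module_simps intro!: exI[of _ "- f"])
  qed (auto simp: image_module_simps ac_simps)
qed (auto simp: image_module_simps act_add_left act_add_right act_times)

text \<open>The module of functionals is injective with respect to inclusions of modules with elements
  of any type, so the test modules with elements of the type of the copy need no transport.\<close>

lemma injective_image_module: "injective_module \<R> (image_module \<iota>)"
  unfolding injective_module_def
proof (intro conjI allI impI module_image_module)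
  fix B :: "(('v, 'k) mpoly, 'e) module" and A f
  assume *: "module \<R> B \<and> submodule A \<R> B \<and>
    f \<in> module_hom \<R> (B\<lparr>carrier := A\<rparr>) (image_module \<iota>)"
  then have f: "f \<in> module_hom \<R> (B\<lparr>carrier := A\<rparr>) (image_module \<iota>)" by simp
  interpret A: submodule A \<R> B using * by simp
  have fi: "f a = \<iota> (inv_into UNIV \<iota> (f a))" if "a \<in> A" for a
    using module_homD(1)[OF f, of a] that by (simp add: image_module_simps f_inv_into_f)
  have "(\<lambda>a. inv_into UNIV \<iota> (f a)) \<in> module_hom \<R> (B\<lparr>carrier := A\<rparr>) cofun_module"
  proof -
    have "inv_into UNIV \<iota> (f (a \<oplus>\<^bsub>B\<^esub> b)) = inv_into UNIV \<iota> (f a) + inv_into UNIV \<iota> (f b)" if "a \<in> A" "b \<in> A" for a b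
    proof -
      have "f (a \<oplus>\<^bsub>B\<^esub> b) = \<iota> (inv_into UNIV \<iota> (f a)) \<oplus>\<^bsub>image_module \<iota>\<^esub> \<iota> (inv_into UNIV \<iota> (f b))"
        using module_homD(2)[OF f, of a b] that fi by simp
      then show ?thesis using inj by (simp add: image_module_simps)
    qed
    moreover have "inv_into UNIV \<iota> (f (s \<odot>\<^bsub>B\<^esub> a)) = act s (inv_into UNIV \<iota> (f a))" if "a \<in> A" for a s
    proof -
      have "f (s \<odot>\<^bsub>B\<^esub> a) = s \<odot>\<^bsub>image_module \<iota>\<^esub> \<iota> (inv_into UNIV \<iota> (f a))"
        using module_homD(3)[OF f, of s a] that fi by simp
      then show ?thesis using inj by (simp add: image_module_simps)
    qed
    ultimately show ?thesis by (simp add: module_hom_def)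
  qed
  then obtain g where g: "g \<in> module_hom \<R> B cofun_module"
    "\<forall>x\<in>A. g x = inv_into UNIV \<iota> (f x)"
    using cofun_module_injective * by blast
  have "\<iota> \<circ> g \<in> module_hom \<R> B (image_module \<iota>)"
    using g(1) by (auto simp: module_hom_def image_module_simps)
  moreover have "\<forall>x\<in>A. (\<iota> \<circ> g) x = f x" using g(2) fi by simp
  ultimately show "\<exists>g\<in>module_hom \<R> B (image_module \<iota>). \<forall>x\<in>A. g x = f x" by blast
qed

lemma injective_resolution_image_module:
  fixes I :: "('v, 'k) mpoly set"
  assumes I: "ideal I \<R>"
  shows "\<exists>d \<epsilon>. injective_resolution \<R> (cyclic_module \<R> I)
    (\<lambda>_. image_module \<iota>) d \<epsilon>"
proof -
  obtain e :: "('v, 'k) mpoly \<Rightarrow> ('v, 'k) cofree" and D where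
    e: "\<forall>f g. e (f + g) = e f + e g" "\<forall>s f. e (s * f) = act s (e f)" "\<forall>f. e f = 0 \<longleftrightarrow> f \<in> I"
    and D: "\<forall>i::nat. cofree_endo (D i)" and D0: "range e = {x. D 0 x = 0}"
    and DS: "\<forall>i. range (D i) = {x. D (Suc i) x = 0}"
    using cofree_resolution[OF I] by (elim exE conjE)
  define \<epsilon> where "\<epsilon> C = \<iota> (e (SOME f. coset I f = C))" for C
  define d where "d i x = \<iota> (D i (inv_into UNIV \<iota> x))" for i x
  have e_diff: "e (f - g) = e f - e g" for f g
    using e(1)[rule_format, of "f - g" g] by (simp add: algebra_simps)
  have eps: "\<epsilon> (coset I f) = \<iota> (e f)" for f
  proof -
    have "coset I (SOME g. coset I g = coset I f) = coset I f" by (rule someI) simp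
    then have "(SOME g. coset I g = coset I f) - f \<in> I" by (simp only: coset_eq_iff[OF I])
    then have "e ((SOME g. coset I g = coset I f) - f) = 0" using e(3) by blast
    then show ?thesis by (simp add: \<epsilon>_def e_diff)
  qed
  have d: "d i (\<iota> x) = \<iota> (D i x)" for i x using inj by (simp add: d_def)
  note simps = image_module_simps cyclic_module_simps[OF I] eps d
  have \<iota>_eq: "\<iota> x = \<iota> y \<longleftrightarrow> x = y" for x y using inj by (auto dest: injD)
  have "injective_resolution \<R> (cyclic_module \<R> I)
    (\<lambda>_. image_module \<iota>) d \<epsilon>"
    unfolding injective_resolution_def
  proof (intro conjI allI injective_image_module)
    show "d i \<in> module_hom \<R> (image_module \<iota>) (image_module \<iota>)" for i
    proof -
      have "d i (\<iota> x \<oplus>\<^bsub>image_module \<iota>\<^esub> \<iota> y) = d i (\<iota> x) \<oplus>\<^bsub>image_module \<iota>\<^esub> d i (\<iota> y)"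
        "d i (s \<odot>\<^bsub>image_module \<iota>\<^esub> \<iota> x) = s \<odot>\<^bsub>image_module \<iota>\<^esub> d i (\<iota> x)" for x y s
        using D by (simp_all only: image_module_simps d cofree_endo_def)
      then show ?thesis by (auto simp: module_hom_def image_module_simps(1) d)
    qed
    show "\<epsilon> \<in> module_hom \<R> (cyclic_module \<R> I) (image_module \<iota>)"
      by (auto simp: module_hom_def simps e)
    show "inj_on \<epsilon> (carrier (cyclic_module \<R> I))"
    proof (rule inj_onI)
      fix x y assume "x \<in> carrier (cyclic_module \<R> I)"
        "y \<in> carrier (cyclic_module \<R> I)" "\<epsilon> x = \<epsilon> y"
      then obtain f g where "x = coset I f" "y = coset I g" "e f = e g"
        by (auto simp: simps \<iota>_eq)
      moreover from this have "e (f - g) = 0" by (simp add: e_diff)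
      ultimately show "x = y" using e(3) by (simp add: coset_eq_iff[OF I])
    qed
    have "\<epsilon> ` carrier (cyclic_module \<R> I) = \<iota> ` range e"
      by (simp only: simps image_image)
    also have "\<dots> = {x \<in> carrier (image_module \<iota>). d 0 x = \<zero>\<^bsub>image_module \<iota>\<^esub>}"
      unfolding D0 by (auto simp: simps \<iota>_eq)
    finally show "\<epsilon> ` carrier (cyclic_module \<R> I) =
      {x \<in> carrier (image_module \<iota>). d 0 x = \<zero>\<^bsub>image_module \<iota>\<^esub>}" .
    show "d i ` carrier (image_module \<iota>) =
      {x \<in> carrier (image_module \<iota>). d (Suc i) x = \<zero>\<^bsub>image_module \<iota>\<^esub>}" for i
    proof -
      have "d i ` carrier (image_module \<iota>) = \<iota> ` range (D i)" by (simp only: simps image_image)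
      also have "\<dots> = {x \<in> carrier (image_module \<iota>). d (Suc i) x = \<zero>\<^bsub>image_module \<iota>\<^esub>}"
        unfolding DS[rule_format] by (auto simp: simps \<iota>_eq)
      finally show ?thesis .
    qed
  qed
  then show ?thesis by blast
qed

end

text \<open>The value of a functional at an exponent vector and a list of such is stored as a constant
  polynomial, at the list of the corresponding monomials; at other lists the value does not
  matter.\<close>

lemma cofree_embeds:
  "\<exists>\<iota> :: ('v, 'k::field) cofree \<Rightarrow> ('v, 'k) mpoly list \<Rightarrow> ('v, 'k) mpoly set. inj \<iota>"
proof -
  define dec :: "('v, 'k) mpoly \<Rightarrow> 'v \<Rightarrow>\<^sub>0 nat" where "dec f = (THE t. f = mon t)" for f
  have dec: "dec (mon t) = t" for t
    unfolding dec_def by (rule the_equality) (auto simp: poly_mapping_eq_iff fun_eq_iff lookup_single when_def split: if_splits)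
  define \<iota> :: "('v, 'k) cofree \<Rightarrow> ('v, 'k) mpoly list \<Rightarrow> ('v, 'k) mpoly set" where
    "\<iota> x l = {single 0 (x (dec (hd l)) (map dec (tl l)))}" for x l
  have "x t l = y t l" if "\<iota> x = \<iota> y" for x y t l
    using fun_cong[OF that, of "mon t # map mon l"]
    by (simp add: \<iota>_def dec comp_def poly_mapping_eq_iff fun_eq_iff) (metis lookup_single_eq)
  then show ?thesis by (intro exI[of _ \<iota>] injI ext)
qed

theorem chosen_resolution_cyclic_module:
  fixes I :: "('v, 'k::field) mpoly set"
  assumes "ideal I \<R>"
  shows "\<exists>E d \<epsilon>. chosen_resolution \<R> (cyclic_module \<R> I) = (E, d) \<and>
    injective_resolution \<R> (cyclic_module \<R> I) E d \<epsilon>"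
proof -
  let ?M = "cyclic_module \<R> I"
  obtain \<iota> :: "('v, 'k::field) cofree \<Rightarrow> ('v, 'k) mpoly list \<Rightarrow> ('v, 'k) mpoly set" where "inj \<iota>"
    using cofree_embeds by blast
  then have "\<exists>p. case p of (E :: nat \<Rightarrow> (('v, 'k) mpoly, ('v, 'k) mpoly list \<Rightarrow> ('v, 'k) mpoly set) module, d) \<Rightarrow>
      \<exists>\<epsilon>. injective_resolution \<R> ?M E d \<epsilon>"
    using injective_resolution_image_module[OF _ assms] by fastforce
  from someI_ex[OF this] show ?thesis
    unfolding chosen_resolution_def by (auto split: prod.splits)
qed

section \<open>Torsion with respect to ideals of variables\<close>

abbreviation var_pow :: "'v \<Rightarrow> nat \<Rightarrow> ('v, 'k::field) mpoly"
  where "var_pow v k \<equiv> mon (single v k)"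

lemma var_pow_add: "var_pow v (k + l) = var_pow v k * (var_pow v l :: ('v, 'k::field) mpoly)"
  by (simp add: mult_single single_add)

definition var_torsion :: "'v set \<Rightarrow> (('v, 'k::field) mpoly, 'b, 's) module_scheme \<Rightarrow> 'b set"
  where "var_torsion W M = {x \<in> carrier M. \<forall>w\<in>W. \<exists>k. var_pow w k \<odot>\<^bsub>M\<^esub> x = \<zero>\<^bsub>M\<^esub>}"

lemma (in cmodule) smult_eq_zero_mono:
  assumes "x \<in> carrier M" "a \<odot> x = \<zero>"
  shows "(b * a) \<odot> x = \<zero>"
  using assms by (simp add: smult_times)

context
  fixes M :: "(('v::finite, 'k::field) mpoly, 'b, 's) module_scheme" (structure)
  assumes M: "module \<R> M"
begin

interpretation cmodule M by (rule cmodule.intro[OF M])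

lemma var_torsion_carrier: "x \<in> var_torsion W M \<Longrightarrow> x \<in> carrier M"
  by (simp add: var_torsion_def)

lemma var_pow_smult_mono:
  assumes "x \<in> carrier M" "var_pow w k \<odot> x = \<zero>" "k \<le> l"
  shows "var_pow w l \<odot> x = \<zero>"
  using smult_eq_zero_mono[OF assms(1,2), of "var_pow w (l - k)"] assms(3)
  by (simp flip: var_pow_add)

lemma var_torsion_zero: "\<zero> \<in> var_torsion W M"
  by (simp add: var_torsion_def)

lemma var_torsion_smult: "x \<in> var_torsion W M \<Longrightarrow> s \<odot> x \<in> var_torsion W M"
  unfolding var_torsion_def using smult_commute[of x _ s] by (auto, metis smult_zero)

lemma var_torsion_add:
  assumes "x \<in> var_torsion W M" "y \<in> var_torsion W M"
  shows "x \<oplus> y \<in> var_torsion W M"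
proof -
  have xy: "x \<in> carrier M" "y \<in> carrier M" using assms by (simp_all add: var_torsion_def)
  have "\<exists>k. var_pow w k \<odot> (x \<oplus> y) = \<zero>" if "w \<in> W" for w
  proof -
    obtain k l where kl: "var_pow w k \<odot> x = \<zero>" "var_pow w l \<odot> y = \<zero>"
      using assms \<open>w \<in> W\<close> unfolding var_torsion_def by blast
    then have "var_pow w (max k l) \<odot> x = \<zero>" "var_pow w (max k l) \<odot> y = \<zero>"
      using xy by (auto intro: var_pow_smult_mono[of _ _ k] var_pow_smult_mono[of _ _ l])
    then have "var_pow w (max k l) \<odot> (x \<oplus> y) = \<zero>" using xy by (simp add: smult_add_right)
    then show ?thesis by blast
  qed
  then show ?thesis using xy by (simp add: var_torsion_def)
qed

lemma var_torsion_minus: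
  assumes "x \<in> var_torsion W M" "y \<in> var_torsion W M"
  shows "x \<ominus> y \<in> var_torsion W M"
proof -
  have xy: "x \<in> carrier M" "y \<in> carrier M" using assms by (simp_all add: var_torsion_def)
  have "(- 1) \<odot> y = \<ominus> y"
  proof -
    have "(- 1) \<odot> y \<oplus> 1 \<odot> y = (- 1 + 1) \<odot> y"
      by (rule smult_add_left[OF xy(2), symmetric])
    then have "(- 1) \<odot> y \<oplus> 1 \<odot> y = \<zero>" using xy by simp
    then show ?thesis using xy minus_equality[of "(- 1) \<odot> y" y] by simp
  qed
  then show ?thesis
    using var_torsion_add[OF assms(1) var_torsion_smult[OF assms(2), of "- 1"]] by (simp add: a_minus_def)
qed

lemma var_torsion_insert:
  "x \<in> var_torsion (insert w W) M \<longleftrightarrow> x \<in> var_torsion W M \<and> (\<exists>k. var_pow w k \<odot> x = \<zero>)"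
  by (auto simp: var_torsion_def)

lemma var_torsion_uniform:
  assumes "x \<in> var_torsion W M"
  shows "\<exists>k. \<forall>w\<in>W. var_pow w k \<odot> x = \<zero>"
proof -
  have "\<forall>w\<in>W. \<exists>k. var_pow w k \<odot> x = \<zero>" using assms by (simp add: var_torsion_def)
  from bchoice[OF this] obtain k where k: "\<forall>w\<in>W. var_pow w (k w) \<odot> x = \<zero>" by (elim exE)
  have "var_pow w (Max (range k)) \<odot> x = \<zero>" if "w \<in> W" for w
    by (rule var_pow_smult_mono[of x w "k w"])
      (use k that var_torsion_carrier[OF assms] in simp_all)
  then show ?thesis by blast
qed

text \<open>The power \<open>w\<^sup>k\<close> lies in the \<open>k\<close>-th power of the ideal. Conversely, a monomial that has
  degree more than \<open>card W * k\<close> in the variables of \<open>W\<close> is divisible by one of the \<open>w\<^sup>k\<close>.\<close>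

lemma torsion_vars:
  "torsion \<R> (span_mon (meets W)) M = var_torsion W M"
proof (intro equalityI subsetI)
  fix x assume "x \<in> torsion \<R> (span_mon (meets W)) M"
  then obtain k where x: "x \<in> carrier M"
    and k: "\<forall>a\<in>ideal_power \<R> (span_mon (meets W)) k. a \<odot> x = \<zero>"
    by (auto simp: torsion_def)
  have "var_pow w k \<in> ideal_power \<R> (span_mon (meets W) :: ('v, 'k) mpoly set) k"
    if "w \<in> W" for w k
  proof (induction k)
    case (Suc k)
    have "mon (single w 1) \<in> (span_mon (meets W) :: ('v, 'k) mpoly set)"
      using that by (auto simp: meets_def intro!: bexI[of _ w])
    from ideal_prod.prod[OF this Suc, of \<R>]
    show ?case by (simp flip: var_pow_add)
  qed simp
  then show "x \<in> var_torsion W M" using x k by (auto simp: var_torsion_def)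
next
  fix x assume x: "x \<in> var_torsion W M"
  obtain k where k: "\<forall>w\<in>W. var_pow w k \<odot> x = \<zero>" using var_torsion_uniform[OF x] by blast
  have xc: "x \<in> carrier M" using x by (rule var_torsion_carrier)
  let ?deg = "\<lambda>t. \<Sum>w\<in>W. lookup t w"
  have power: "a \<in> span_mon {t. l \<le> ?deg t}"
    if "a \<in> ideal_power \<R> (span_mon (meets W)) l" for a :: "('v, 'k) mpoly" and l
    using that
  proof (induction l arbitrary: a)
    case (Suc l)
    from Suc.prems have "a \<in> span_mon (meets W) \<cdot>\<^bsub>\<R>\<^esub>
        ideal_power \<R> (span_mon (meets W)) l" by simp
    then show ?case
    proof (induction a rule: ideal_prod.induct)
      case (prod i j)
      have j: "j \<in> span_mon {t. l \<le> ?deg t}" by (rule Suc.IH) (rule prod)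
      have "Suc l \<le> ?deg t" if t: "t \<in> keys (i * j)" for t
      proof -
        obtain t1 t2 where t12: "t = t1 + t2" "t1 \<in> keys i" "t2 \<in> keys j"
          using keys_mult[of i j] t by blast
        have "t1 \<in> meets W" "l \<le> ?deg t2" using prod(1) j t12 by (auto simp: span_mon_def)
        then have "1 \<le> ?deg t1"
          by (auto simp: meets_def Suc_le_eq sum_pos2 intro: ccontr)
        then show ?thesis using \<open>l \<le> ?deg t2\<close> t12(1) by (simp add: lookup_add sum.distrib)
      qed
      then show ?case by (auto simp: span_mon_def)
    next
      case (sum s1 s2)
      then show ?case using keys_add[of s1 s2] by (auto simp: span_mon_def)
    qed
  qed (simp add: span_mon_def)
  have kill: "single t c \<odot> x = \<zero>" if "card W * k < ?deg t + 1" "W \<noteq> {}" for t c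
  proof -
    have "\<exists>w\<in>W. k \<le> lookup t w"
    proof (rule ccontr)
      assume "\<not> ?thesis"
      then have "?deg t < (\<Sum>w\<in>W. k)" using that(2) by (intro sum_strict_mono) auto
      then show False using that(1) by simp
    qed
    then obtain w where w: "w \<in> W" "k \<le> lookup t w" by blast
    have "t = single w k + (t - single w k)"
      by (rule monom_eq_single_add) (use w(2) in simp)
    then have "single t c = single (t - single w k) c * var_pow w k"
      by (simp add: mult_single add.commute)
    then show ?thesis using smult_eq_zero_mono[OF xc] k w(1) by metis
  qed
  have "a \<odot> x = \<zero>"
    if a: "a \<in> ideal_power \<R> (span_mon (meets W)) (card W * k + 1)" for a
  proof -
    have deg: "card W * k + 1 \<le> ?deg t" if "t \<in> keys a" for t
      using power[OF a] that by (auto simp: span_mon_def)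
    have "W \<noteq> {}" if "t \<in> keys a" for t using deg[OF that] by auto
    then have "single t (lookup a t) \<odot> x = \<zero>" if "t \<in> keys a" for t
      using deg[OF that] that by (intro kill) auto
    then show ?thesis by (subst poly_eq_sum_singles) (rule smult_sum_eq_zero[OF xc])
  qed
  then show "x \<in> torsion \<R> (span_mon (meets W)) M"
    using xc unfolding torsion_def by blast
qed

end

section \<open>Extension of maps from ideals\<close>

text \<open>The condition in Baer's criterion for injectivity; it does not mention test modules, hence
  no type of elements.\<close>

definition extends_from_ideals :: "('r::comm_ring_1, 'b, 's) module_scheme \<Rightarrow> bool"
  where "extends_from_ideals M \<longleftrightarrow> (\<forall>L h. ideal L \<R> \<longrightarrow>
    h \<in> module_hom \<R> ((regular_module \<R>)\<lparr>carrier := L\<rparr>) M \<longrightarrow>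
    (\<exists>y\<in>carrier M. \<forall>a\<in>L. h a = a \<odot>\<^bsub>M\<^esub> y))"

text \<open>If \<open>L\<close> kills \<open>x\<close> and \<open>z\<close> is a nonzerodivisor modulo \<open>L\<close>, then \<open>a z + b \<mapsto> a x\<close> is well
  defined on \<open>(z) + L\<close>; an extension to the ring gives a quotient of \<open>x\<close> by \<open>z\<close> that \<open>L\<close>
  still kills.\<close>

lemma divide_by_nonzerodivisor:
  fixes M :: "('r::comm_ring_1, 'b, 's) module_scheme" (structure)
  assumes M: "module \<R> M" and ext: "extends_from_ideals M"
    and L: "ideal L \<R>" and x: "x \<in> carrier M"
    and kill: "\<And>a. a \<in> L \<Longrightarrow> a \<odot> x = \<zero>" and nzd: "\<And>a. a * z \<in> L \<Longrightarrow> a \<in> L"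
  shows "\<exists>y\<in>carrier M. z \<odot> y = x \<and> (\<forall>a\<in>L. a \<odot> y = \<zero>)"
proof -
  interpret cmodule M by (rule cmodule.intro[OF M])
  define J where "J = {a * z + b | a b. b \<in> L}"
  define h where "h c = (SOME a. c - a * z \<in> L) \<odot> x" for c
  have L0: "0 \<in> L" using L by (simp add: ideal_of_type_algebra_iff)
  have h: "h (a * z + b) = a \<odot> x" if b: "b \<in> L" for a b
  proof -
    let ?a = "SOME a'. a * z + b - a' * z \<in> L"
    have "a * z + b - ?a * z \<in> L" by (rule someI[of _ a]) (simp add: b)
    then have "(a - ?a) * z \<in> L"
      using ideal_diff[OF L _ b] by (fastforce simp: algebra_simps)
    then have "(a - ?a) \<odot> x = \<zero>" using kill nzd by blast
    then have "a \<odot> x = ?a \<odot> x"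
      using smult_add_left[OF x, of "a - ?a" ?a] x by simp
    then show ?thesis by (simp add: h_def)
  qed
  have J: "ideal J \<R>"
    unfolding ideal_of_type_algebra_iff
  proof (intro conjI ballI allI)
    have "0 = 0 * z + 0" by simp
    then show "0 \<in> J" unfolding J_def using L0 by blast
    fix c d assume "c \<in> J" "d \<in> J"
    then obtain a b a' b' where "c = a * z + b" "d = a' * z + b'" "b \<in> L" "b' \<in> L"
      unfolding J_def by blast
    then have "c + d = (a + a') * z + (b + b')" "b + b' \<in> L"
      using L by (simp_all add: algebra_simps ideal_of_type_algebra_iff)
    then show "c + d \<in> J" unfolding J_def by blast
  next
    fix s c assume "c \<in> J"
    then obtain a b where "c = a * z + b" "b \<in> L" unfolding J_def by blast
    then have "s * c = (s * a) * z + s * b" "s * b \<in> L"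
      using L by (simp_all add: distrib_left mult.assoc ideal_of_type_algebra_iff)
    then show "s * c \<in> J" unfolding J_def by blast
  qed
  have "h \<in> module_hom \<R> ((regular_module \<R>)\<lparr>carrier := J\<rparr>) M"
    unfolding module_hom_def
  proof (clarsimp, intro conjI ballI allI)
    fix c d assume "c \<in> J" "d \<in> J"
    then obtain a b a' b' where *: "c = a * z + b" "d = a' * z + b'" "b \<in> L" "b' \<in> L"
      unfolding J_def by blast
    then have cd: "c + d = (a + a') * z + (b + b')" "b + b' \<in> L"
      using L by (simp_all add: algebra_simps ideal_of_type_algebra_iff)
    have "h (c + d) = (a + a') \<odot> x" unfolding cd(1) by (rule h[OF cd(2)])
    then show "h (c + d) = h c \<oplus> h d" using * x by (simp add: h smult_add_left)
  next
    fix s c assume "c \<in> J"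
    then obtain a b where *: "c = a * z + b" "b \<in> L" unfolding J_def by blast
    then have sc: "s * c = (s * a) * z + s * b" "s * b \<in> L"
      using L by (simp_all add: distrib_left mult.assoc ideal_of_type_algebra_iff)
    have "h (s * c) = (s * a) \<odot> x" unfolding sc(1) by (rule h[OF sc(2)])
    then show "h (s * c) = s \<odot> h c" using * x by (simp add: h smult_times)
  qed (use x in \<open>auto simp: h_def\<close>)
  then obtain y where y: "y \<in> carrier M" "\<forall>a\<in>J. h a = a \<odot> y"
    using ext J unfolding extends_from_ideals_def by blast
  have "z \<odot> y = x"
  proof -
    have "1 * z + 0 \<in> J" unfolding J_def using L0 by blast
    then show ?thesis using y(2) h[OF L0, of 1] x by force
  qed
  moreover have "a \<odot> y = \<zero>" if "a \<in> L" for a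
  proof -
    have "0 * z + a \<in> J" unfolding J_def using that by blast
    then show ?thesis using y(2) h[OF that, of 0] x by force
  qed
  ultimately show ?thesis using y(1) by blast
qed

text \<open>An element of the torsion is killed by the ideal of the \<open>v\<^sup>l\<close> for \<open>v \<in> W\<close> and some \<open>l\<close>.
  Modulo this ideal, the powers of a variable outside \<open>W\<close> are nonzerodivisors.\<close>

lemma var_torsion_divisible:
  fixes M :: "(('v::finite, 'k::field) mpoly, 'b, 's) module_scheme" (structure)
  assumes M: "module \<R> M" and ext: "extends_from_ideals M"
    and x: "x \<in> var_torsion W M" and w: "w \<notin> W"
  shows "\<exists>y\<in>var_torsion W M. var_pow w k \<odot> y = x"
proof -
  obtain l where l: "\<forall>v\<in>W. var_pow v l \<odot> x = \<zero>" using var_torsion_uniform[OF M x] by blast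
  interpret cmodule M by (rule cmodule.intro[OF M])
  have xc: "x \<in> carrier M" using x by (simp add: var_torsion_def)
  let ?U = "{t. \<exists>v\<in>W. l \<le> lookup t v}"
  have "upset ?U" by (auto simp: upset_def lookup_add intro: trans_le_add1)
  then have L: "ideal (span_mon ?U :: ('v, 'k) mpoly set) \<R>" by (rule ideal_span_mon)
  have mon_U: "single t c \<odot> x = \<zero>" if "t \<in> ?U" for t c
  proof -
    obtain v where v: "v \<in> W" "l \<le> lookup t v" using \<open>t \<in> ?U\<close> by auto
    have "t = single v l + (t - single v l)"
      by (rule monom_eq_single_add) (use v(2) in simp)
    then have "single t c = single (t - single v l) c * var_pow v l"
      by (simp add: mult_single add.commute)
    then show ?thesis using smult_eq_zero_mono[OF xc] l v(1) by metis
  qed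
  have kill: "a \<odot> x = \<zero>" if "a \<in> span_mon ?U" for a
    by (subst poly_eq_sum_singles, rule smult_sum_eq_zero[OF xc], rule mon_U)
      (use that in \<open>auto simp: span_mon_def\<close>)
  have nzd: "a \<in> span_mon ?U" if "a * var_pow w k \<in> span_mon ?U" for a :: "('v, 'k) mpoly"
  proof -
    have "t \<in> ?U" if t: "t \<in> keys a" for t
    proof -
      have "lookup (var_pow w k * a) (single w k + t) \<noteq> 0"
        using t lookup_single_times_add[of "single w k" 1 a t] by (simp add: in_keys_iff)
      then have "single w k + t \<in> ?U"
        using \<open>a * var_pow w k \<in> span_mon ?U\<close> by (auto simp: span_mon_def in_keys_iff mult.commute)
      then show ?thesis using w by (auto simp: lookup_add lookup_single when_def split: if_splits)
    qed
    then show ?thesis by (auto simp: span_mon_def)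
  qed
  obtain y where y: "y \<in> carrier M" "var_pow w k \<odot> y = x" "\<forall>a\<in>span_mon ?U. a \<odot> y = \<zero>"
    using divide_by_nonzerodivisor[OF M ext L xc kill nzd] by blast
  have "var_pow v l \<odot> y = \<zero>" if "v \<in> W" for v
    by (rule y(3)[rule_format]) (use that in \<open>auto intro!: bexI[of _ v]\<close>)
  then have "y \<in> var_torsion W M"
    unfolding var_torsion_def using y(1) by blast
  then show ?thesis using y(2) by blast
qed

lemma injective_module_extends_from_ideals:
  fixes E :: "('r::comm_ring_1, 'e) module" and j :: "'r \<Rightarrow> 'e"
  assumes inj: "inj j" and E: "injective_module \<R> E"
  shows "extends_from_ideals E"
  unfolding extends_from_ideals_def
proof (intro allI impI)
  fix L :: "'r set" and h :: "'r \<Rightarrow> 'e"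
  assume L: "ideal L \<R>"
    and h: "h \<in> module_hom \<R> ((regular_module \<R>)\<lparr>carrier := L\<rparr>) E"
  interpret E: cmodule E by (rule cmodule.intro) (use E in \<open>simp add: injective_module_def\<close>)
  \<comment> \<open>The test modules must have elements of type 'e, so the ring is replaced by its image under \<open>j\<close>.\<close>
  define B :: "('r, 'e) module" where "B =
    \<lparr>carrier = range j, monoid.mult = undefined, one = undefined, ring.zero = j 0,
     add = (\<lambda>a b. j (inv_into UNIV j a + inv_into UNIV j b)), module.smult = (\<lambda>s a. j (s * inv_into UNIV j a))\<rparr>"
  have B_simps: "carrier B = range j" "\<zero>\<^bsub>B\<^esub> = j 0" "j x \<oplus>\<^bsub>B\<^esub> j y = j (x + y)" "s \<odot>\<^bsub>B\<^esub> j x = j (s * x)"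
    for x y s using inj by (simp_all add: B_def)
  have B: "module \<R> B"
  proof (rule moduleI[OF cring_of_type_algebra])
    show "abelian_group B"
    proof (rule abelian_groupI)
      fix x assume "x \<in> carrier B"
      then obtain f where "x = j f" by (auto simp: B_simps)
      then show "\<exists>y\<in>carrier B. y \<oplus>\<^bsub>B\<^esub> x = \<zero>\<^bsub>B\<^esub>"
        by (auto simp: B_simps intro!: exI[of _ "- f"])
    qed (auto simp: B_simps ac_simps)
  qed (auto simp: B_simps algebra_simps)
  interpret B: cmodule B by (rule cmodule.intro[OF B])
  have sub: "submodule (j ` L) \<R> B"
  proof (rule B.submoduleI)
    show "j ` L \<subseteq> carrier B" by (auto simp: B_simps)
    show "\<zero>\<^bsub>B\<^esub> \<in> j ` L" using L by (simp add: B_simps ideal_of_type_algebra_iff)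
    show "\<ominus>\<^bsub>B\<^esub> a \<in> j ` L" if "a \<in> j ` L" for a
    proof -
      obtain f where f: "a = j f" "f \<in> L" using \<open>a \<in> j ` L\<close> by blast
      have "\<ominus>\<^bsub>B\<^esub> a = j (- f)"
        by (rule B.M.minus_equality) (auto simp: f B_simps)
      then show ?thesis using ideal_uminus[OF L f(2)] by blast
    qed
    show "a \<oplus>\<^bsub>B\<^esub> b \<in> j ` L" if "a \<in> j ` L" "b \<in> j ` L" for a b
      using that L by (auto simp: B_simps ideal_of_type_algebra_iff)
    show "s \<odot>\<^bsub>B\<^esub> a \<in> j ` L" if "a \<in> j ` L" for s a
      using that L by (auto simp: B_simps ideal_of_type_algebra_iff)
  qed
  have "(\<lambda>a. h (inv_into UNIV j a)) \<in> module_hom \<R> (B\<lparr>carrier := j ` L\<rparr>) E"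
    using module_homD[OF h] inj by (auto simp: module_hom_def B_simps)
  then obtain g where g: "g \<in> module_hom \<R> B E" "\<forall>x\<in>j ` L. g x = h (inv_into UNIV j x)"
    using E B sub unfolding injective_module_def by blast
  have "g (j 1) \<in> carrier E" using module_homD(1)[OF g(1)] by (simp add: B_simps)
  moreover have "h a = a \<odot>\<^bsub>E\<^esub> g (j 1)" if "a \<in> L" for a
    using module_homD(3)[OF g(1), of a "j 1"] g(2) that inj by (simp add: B_simps)
  ultimately show "\<exists>y\<in>carrier E. \<forall>a\<in>L. h a = a \<odot>\<^bsub>E\<^esub> y" by blast
qed

lemma submodule_ideal:
  fixes L :: "'r::comm_ring_1 set"
  assumes L: "ideal L \<R>"
  shows "submodule L \<R> (regular_module \<R>)"
proof -
  interpret R: cmodule "regular_module (\<R> :: 'r ring)"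
    by (rule cmodule.intro[OF module_regular_module])
  show ?thesis
  proof (rule R.submoduleI)
    show "\<ominus>\<^bsub>regular_module \<R>\<^esub> a \<in> L" if "a \<in> L" for a
    proof -
      have "\<ominus>\<^bsub>regular_module \<R>\<^esub> a = - a"
        by (rule R.M.minus_equality) auto
      then show ?thesis using ideal_uminus[OF L that] by simp
    qed
  qed (use L in \<open>auto simp: ideal_of_type_algebra_iff\<close>)
qed

lemma cofun_module_extends_from_ideals:
  "extends_from_ideals (cofun_module :: (('v, 'k::field) mpoly, ('v, 'z, 'k) cofun) module)"
  unfolding extends_from_ideals_def
proof (intro allI impI)
  fix L :: "('v, 'k) mpoly set" and h :: "('v, 'k) mpoly \<Rightarrow> ('v, 'z, 'k) cofun"
  assume L: "ideal L \<R>"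
    and h: "h \<in> module_hom \<R> ((regular_module \<R>)\<lparr>carrier := L\<rparr>) cofun_module"
  obtain g where g: "g \<in> module_hom \<R> (regular_module \<R>) cofun_module"
    "\<forall>x\<in>L. g x = h x"
    using cofun_module_injective[OF module_regular_module submodule_ideal[OF L] h] by blast
  have "h a = a \<odot>\<^bsub>cofun_module\<^esub> g 1" if "a \<in> L" for a
    using module_homD(3)[OF g(1), of a 1] g(2) that by simp
  then show "\<exists>y\<in>carrier cofun_module. \<forall>a\<in>L. h a = a \<odot>\<^bsub>cofun_module\<^esub> y" by auto
qed

section \<open>Comparison of resolutions\<close>

text \<open>The homomorphism \<open>q\<close> factors over the image of \<open>p\<close>, a submodule of \<open>B\<close>, from which
  injectivity extends it.\<close>

lemma extend_along:
  fixes p :: "'a \<Rightarrow> 'b" and q :: "'a \<Rightarrow> ('v, 'z, 'k::field) cofun"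
    and B :: "(('v, 'k) mpoly, 'b) module"
  assumes N: "module \<R> N" and B: "module \<R> B"
    and p: "p \<in> module_hom \<R> N B"
    and q: "q \<in> module_hom \<R> N cofun_module"
    and ker: "\<And>x. x \<in> carrier N \<Longrightarrow> p x = \<zero>\<^bsub>B\<^esub> \<Longrightarrow> q x = 0"
  shows "\<exists>g\<in>module_hom \<R> B cofun_module. \<forall>x\<in>carrier N. g (p x) = q x"
proof -
  interpret N: cmodule N by (rule cmodule.intro[OF N])
  interpret B: cmodule B by (rule cmodule.intro[OF B])
  interpret C: cmodule "cofun_module :: (('v, 'k) mpoly, ('v, 'z, 'k) cofun) module"
    by (rule cmodule.intro[OF module_cofun_module])
  note pD = module_homD[OF p] and qD = module_homD[OF q]
  have eq: "q x = q y" if "x \<in> carrier N" "y \<in> carrier N" "p x = p y" for x y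
  proof -
    have "p (x \<ominus>\<^bsub>N\<^esub> y) = p x \<ominus>\<^bsub>B\<^esub> p y"
      by (rule module_hom_minus[OF N B p that(1,2)])
    also have "\<dots> = \<zero>\<^bsub>B\<^esub>"
      using pD(1)[OF that(2)] by (simp add: that(3) a_minus_def B.M.r_neg)
    finally have "p (x \<ominus>\<^bsub>N\<^esub> y) = \<zero>\<^bsub>B\<^esub>" .
    then have "q (x \<ominus>\<^bsub>N\<^esub> y) = 0" using that by (intro ker) auto
    then have "q (x \<ominus>\<^bsub>N\<^esub> y) + q y = q y" by simp
    moreover have "q (x \<ominus>\<^bsub>N\<^esub> y) + q y = q (x \<ominus>\<^bsub>N\<^esub> y \<oplus>\<^bsub>N\<^esub> y)"
      using qD(2)[of "x \<ominus>\<^bsub>N\<^esub> y" y] that by simp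
    moreover have "x \<ominus>\<^bsub>N\<^esub> y \<oplus>\<^bsub>N\<^esub> y = x"
      using that by (simp add: a_minus_def N.M.a_assoc N.M.l_neg)
    ultimately show ?thesis by simp
  qed
  define h where "h b = q (SOME x. x \<in> carrier N \<and> p x = b)" for b
  have h: "h (p x) = q x" if "x \<in> carrier N" for x
  proof -
    have "(SOME y. y \<in> carrier N \<and> p y = p x) \<in> carrier N \<and> p (SOME y. y \<in> carrier N \<and> p y = p x) = p x"
      by (rule someI[of _ x]) (simp add: that)
    then show ?thesis unfolding h_def using eq that by blast
  qed
  have sub: "submodule (p ` carrier N) \<R> B"
  proof (rule B.submoduleI)
    show "p ` carrier N \<subseteq> carrier B" using pD(1) by blast
    show "\<zero>\<^bsub>B\<^esub> \<in> p ` carrier N"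
      using module_hom_zero[OF N B p] by (metis N.M.zero_closed image_eqI)
    show "\<ominus>\<^bsub>B\<^esub> a \<in> p ` carrier N" if "a \<in> p ` carrier N" for a
    proof -
      obtain x where x: "x \<in> carrier N" "a = p x" using \<open>a \<in> p ` carrier N\<close> by blast
      have "p (\<ominus>\<^bsub>N\<^esub> x) \<oplus>\<^bsub>B\<^esub> a = \<zero>\<^bsub>B\<^esub>"
        using x pD(2)[of "\<ominus>\<^bsub>N\<^esub> x" x] by (simp add: N.M.l_neg module_hom_zero[OF N B p])
      then have "\<ominus>\<^bsub>B\<^esub> a = p (\<ominus>\<^bsub>N\<^esub> x)" using x pD(1) by (intro B.M.minus_equality) auto
      then show ?thesis using x by blast
    qed
    show "a \<oplus>\<^bsub>B\<^esub> b \<in> p ` carrier N" if "a \<in> p ` carrier N" "b \<in> p ` carrier N" for a b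
      using that by (auto simp flip: pD(2))
    show "s \<odot>\<^bsub>B\<^esub> a \<in> p ` carrier N" if "a \<in> p ` carrier N" for s a
      using that by (auto simp flip: pD(3))
  qed
  have "h \<in> module_hom \<R> (B\<lparr>carrier := p ` carrier N\<rparr>) cofun_module"
    unfolding module_hom_def using qD by (auto simp: h simp flip: pD(2,3))
  then obtain g where "g \<in> module_hom \<R> B cofun_module"
    "\<forall>x\<in>p ` carrier N. g x = h x"
    using cofun_module_injective[OF B sub] by blast
  then show ?thesis using h by auto
qed

text \<open>The usual inductive construction. The invariant is that \<open>D i \<circ> \<phi> i\<close> vanishes on the kernel
  of \<open>d i\<close>; it makes this composition factor over the image of \<open>d i\<close>.\<close>

lemma comparison_map:
  fixes E :: "nat \<Rightarrow> (('v, 'k::field) mpoly, 'e) module"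
    and D :: "nat \<Rightarrow> ('v, 'z, 'k) cofun \<Rightarrow> ('v, 'z, 'k) cofun"
  assumes M: "module \<R> M"
    and E: "injective_resolution \<R> M E d \<epsilon>"
    and \<eta>: "\<eta> \<in> module_hom \<R> M cofun_module"
    and D: "\<And>i. D i \<in> module_hom \<R> cofun_module cofun_module"
    and D\<eta>: "\<And>x. x \<in> carrier M \<Longrightarrow> D 0 (\<eta> x) = 0" and DD: "\<And>i x. D (Suc i) (D i x) = 0"
  shows "\<exists>\<phi>. (\<forall>i. \<phi> i \<in> module_hom \<R> (E i) cofun_module) \<and>
    (\<forall>i. \<forall>x\<in>carrier (E i). \<phi> (Suc i) (d i x) = D i (\<phi> i x)) \<and>
    (\<forall>x\<in>carrier M. \<phi> 0 (\<epsilon> x) = \<eta> x)"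
proof -
  have Em: "module \<R> (E i)" for i
    using E by (simp add: injective_resolution_def injective_module_def)
  have d: "d i \<in> module_hom \<R> (E i) (E (Suc i))" for i
    using E by (simp add: injective_resolution_def)
  have eps: "\<epsilon> \<in> module_hom \<R> M (E 0)" "inj_on \<epsilon> (carrier M)"
    and eps_im: "\<epsilon> ` carrier M = {x \<in> carrier (E 0). d 0 x = \<zero>\<^bsub>E 1\<^esub>}"
    using E by (simp_all add: injective_resolution_def)
  have exact: "d i ` carrier (E i) = {x \<in> carrier (E (Suc i)). d (Suc i) x = \<zero>\<^bsub>E (Suc (Suc i))\<^esub>}" for i
    using E by (simp add: injective_resolution_def)
  interpret M: cmodule M by (rule cmodule.intro[OF M])
  let ?P = "\<lambda>i \<phi>. \<phi> \<in> module_hom \<R> (E i) cofun_module \<and>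
    (\<forall>x\<in>carrier (E i). d i x = \<zero>\<^bsub>E (Suc i)\<^esub> \<longrightarrow> D i (\<phi> x) = 0) \<and>
    (i = 0 \<longrightarrow> (\<forall>x\<in>carrier M. \<phi> (\<epsilon> x) = \<eta> x))"
  let ?Q = "\<lambda>i \<phi> \<psi>. \<forall>x\<in>carrier (E i). \<psi> (d i x) = D i (\<phi> x)"
  have "\<exists>\<phi>. \<forall>i. ?P i (\<phi> i) \<and> ?Q i (\<phi> i) (\<phi> (Suc i))"
  proof (rule dependent_nat_choice)
    have "\<exists>g\<in>module_hom \<R> (E 0) cofun_module. \<forall>x\<in>carrier M. g (\<epsilon> x) = \<eta> x"
    proof (rule extend_along[OF M Em eps(1) \<eta>])
      fix x assume x: "x \<in> carrier M" "\<epsilon> x = \<zero>\<^bsub>E 0\<^esub>"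
      then have "\<epsilon> x = \<epsilon> \<zero>\<^bsub>M\<^esub>" by (simp add: module_hom_zero[OF M Em eps(1)])
      then have "x = \<zero>\<^bsub>M\<^esub>" using inj_onD[OF eps(2), of x "\<zero>\<^bsub>M\<^esub>"] x by simp
      then show "\<eta> x = 0" using module_hom_zero[OF M module_cofun_module \<eta>] by simp
    qed
    then obtain g where g: "g \<in> module_hom \<R> (E 0) cofun_module"
      "\<forall>x\<in>carrier M. g (\<epsilon> x) = \<eta> x" by blast
    have "D 0 (g x) = 0" if "x \<in> carrier (E 0)" "d 0 x = \<zero>\<^bsub>E (Suc 0)\<^esub>" for x
    proof -
      have "x \<in> \<epsilon> ` carrier M" using that eps_im by simp
      then obtain y where "y \<in> carrier M" "x = \<epsilon> y" by blast
      then show ?thesis using g(2) D\<eta> by simp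
    qed
    then show "\<exists>\<phi>. ?P 0 \<phi>" using g by blast
  next
    fix \<phi> and i :: nat assume P: "?P i \<phi>"
    have "(\<lambda>x. D i (\<phi> x)) \<in> module_hom \<R> (E i) cofun_module"
    proof -
      have 1: "\<phi> (x \<oplus>\<^bsub>E i\<^esub> y) = \<phi> x + \<phi> y" if "x \<in> carrier (E i)" "y \<in> carrier (E i)" for x y
        using module_homD(2)[OF conjunct1[OF P] that] by simp
      have 2: "\<phi> (s \<odot>\<^bsub>E i\<^esub> x) = act s (\<phi> x)" if "x \<in> carrier (E i)" for x s
        using module_homD(3)[OF conjunct1[OF P] _ that, of s] by simp
      have 3: "D i (x + y) = D i x + D i y" for x y
        using module_homD(2)[OF D[of i], of x y] by simp
      have 4: "D i (act s x) = act s (D i x)" for s x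
        using module_homD(3)[OF D[of i], of s x] by simp
      show ?thesis by (auto simp: module_hom_def 1 2 3 4)
    qed
    then obtain g where g: "g \<in> module_hom \<R> (E (Suc i)) cofun_module"
      "\<forall>x\<in>carrier (E i). g (d i x) = D i (\<phi> x)"
      using extend_along[OF Em Em d, of "\<lambda>x. D i (\<phi> x)" i] P by blast
    have "D (Suc i) (g x) = 0" if "x \<in> carrier (E (Suc i))" "d (Suc i) x = \<zero>\<^bsub>E (Suc (Suc i))\<^esub>" for x
    proof -
      have "x \<in> d i ` carrier (E i)" using that exact by simp
      then obtain y where "y \<in> carrier (E i)" "x = d i y" by blast
      then show ?thesis using g(2) DD by simp
    qed
    then show "\<exists>\<psi>. ?P (Suc i) \<psi> \<and> ?Q i \<phi> \<psi>" using g by blast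
  qed
  then obtain \<phi> where \<phi>: "\<forall>i. ?P i (\<phi> i) \<and> ?Q i (\<phi> i) (\<phi> (Suc i))" by (elim exE)
  show ?thesis by (rule exI[of _ \<phi>]) (use \<phi> in auto)
qed

section \<open>Vanishing\<close>

text \<open>The part of an injective resolution that matters for local cohomology in positive degrees:
  the complex is exact there, and its terms satisfy Baer's condition. The resolved module is
  the kernel in degree zero.\<close>

locale divisible_complex =
  fixes E :: "nat \<Rightarrow> (('v::finite, 'k::field) mpoly, 'e) module" and d :: "nat \<Rightarrow> 'e \<Rightarrow> 'e"
  assumes modules: "\<And>i. module \<R> (E i)"
    and extends: "\<And>i. extends_from_ideals (E i)"
    and d_hom: "\<And>i. d i \<in> module_hom \<R> (E i) (E (Suc i))"
    and exact: "\<And>i. d i ` carrier (E i) = {x \<in> carrier (E (Suc i)). d (Suc i) x = \<zero>\<^bsub>E (Suc (Suc i))\<^esub>}"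
begin

abbreviation tors where "tors W i \<equiv> var_torsion W (E i)"

definition cocycles :: "'v set \<Rightarrow> nat \<Rightarrow> 'e set"
  where "cocycles W i = {x \<in> tors W i. d i x = \<zero>\<^bsub>E (Suc i)\<^esub>}"

definition coboundaries :: "'v set \<Rightarrow> nat \<Rightarrow> 'e set"
  where "coboundaries W i = (case i of 0 \<Rightarrow> {\<zero>\<^bsub>E 0\<^esub>} | Suc j \<Rightarrow> d j ` tors W j)"

lemma cmodules: "cmodule (E i)"
  by (rule cmodule.intro[OF modules])

lemma d_carrier: "x \<in> carrier (E i) \<Longrightarrow> d i x \<in> carrier (E (Suc i))"
  using module_homD(1)[OF d_hom] .

lemma d_smult: "x \<in> carrier (E i) \<Longrightarrow> d i (s \<odot>\<^bsub>E i\<^esub> x) = s \<odot>\<^bsub>E (Suc i)\<^esub> d i x"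
  using module_homD(3)[OF d_hom] by simp

lemma d_zero: "d i \<zero>\<^bsub>E i\<^esub> = \<zero>\<^bsub>E (Suc i)\<^esub>"
  by (rule module_hom_zero[OF modules modules d_hom])

lemma d_minus: "x \<in> carrier (E i) \<Longrightarrow> y \<in> carrier (E i) \<Longrightarrow>
    d i (x \<ominus>\<^bsub>E i\<^esub> y) = d i x \<ominus>\<^bsub>E (Suc i)\<^esub> d i y"
  by (rule module_hom_minus[OF modules modules d_hom])

lemma d_d: "x \<in> carrier (E i) \<Longrightarrow> d (Suc i) (d i x) = \<zero>\<^bsub>E (Suc (Suc i))\<^esub>"
  using exact[of i] by blast

lemma d_tors: "x \<in> tors W i \<Longrightarrow> d i x \<in> tors W (Suc i)"
  unfolding var_torsion_def using d_carrier d_smult[of x i] d_zero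
  by (auto, metis)

lemma tors_carrier: "x \<in> tors W i \<Longrightarrow> x \<in> carrier (E i)"
  by (simp add: var_torsion_def)

text \<open>Multiplication by \<open>w\<close> is bijective on \<open>\<Gamma>\<^sub>W(E) / \<Gamma>\<^bsub>W \<union> {w}\<^esub>(E)\<close>, so this quotient has the
  cohomology of \<open>\<Gamma>\<^sub>W(E)\<close> localized at \<open>w\<close>. If the localization vanishes in degree \<open>j\<close>, then
  by the long exact sequence \<open>H\<^bsup>j+1\<^esup>\<close> of \<open>\<Gamma>\<^bsub>W \<union> {w}\<^esub>(E)\<close> embeds into \<open>H\<^bsup>j+1\<^esup>\<close> of \<open>\<Gamma>\<^sub>W(E)\<close>.\<close>

lemma vanish_insert:
  assumes w: "w \<notin> W" and van: "cocycles W (Suc j) \<subseteq> coboundaries W (Suc j)"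
    and loc: "\<And>x. x \<in> cocycles W j \<Longrightarrow> \<exists>k. var_pow w k \<odot>\<^bsub>E j\<^esub> x \<in> coboundaries W j"
  shows "cocycles (insert w W) (Suc j) \<subseteq> coboundaries (insert w W) (Suc j)"
proof
  fix x assume x: "x \<in> cocycles (insert w W) (Suc j)"
  interpret E: cmodule "E j" by (rule cmodules)
  interpret E': cmodule "E (Suc j)" by (rule cmodules)
  obtain N where N: "var_pow w N \<odot>\<^bsub>E (Suc j)\<^esub> x = \<zero>\<^bsub>E (Suc j)\<^esub>"
    using x by (auto simp: cocycles_def var_torsion_insert[OF modules])
  have "x \<in> cocycles W (Suc j)"
    using x by (auto simp: cocycles_def var_torsion_insert[OF modules])
  then obtain f where f: "f \<in> tors W j" "x = d j f"
    using van by (auto simp: coboundaries_def)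
  note fc = tors_carrier[OF f(1)]
  have "var_pow w N \<odot>\<^bsub>E j\<^esub> f \<in> cocycles W j"
    using f N fc by (simp add: cocycles_def var_torsion_smult[OF modules] d_smult)
  then obtain k where "var_pow w k \<odot>\<^bsub>E j\<^esub> (var_pow w N \<odot>\<^bsub>E j\<^esub> f) \<in> coboundaries W j"
    using loc by blast
  then have k: "var_pow w (k + N) \<odot>\<^bsub>E j\<^esub> f \<in> coboundaries W j"
    using fc by (simp add: var_pow_add E.smult_times)
  \<comment> \<open>a cocycle that differs from \<open>f\<close> by \<open>w\<close>-torsion, to correct \<open>f\<close> by\<close>
  have "\<exists>c\<in>carrier (E j). d j c = \<zero>\<^bsub>E (Suc j)\<^esub> \<and> c \<in> tors W j \<and>
      var_pow w (k + N) \<odot>\<^bsub>E j\<^esub> f = var_pow w (k + N) \<odot>\<^bsub>E j\<^esub> c"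
  proof (cases j)
    case 0
    then have "coboundaries W j = {\<zero>\<^bsub>E j\<^esub>}" by (simp add: coboundaries_def)
    then have "var_pow w (k + N) \<odot>\<^bsub>E j\<^esub> f = var_pow w (k + N) \<odot>\<^bsub>E j\<^esub> \<zero>\<^bsub>E j\<^esub>"
      using k by simp
    then show ?thesis
      using d_zero var_torsion_zero[OF modules] E.M.zero_closed by blast
  next
    case (Suc j')
    then obtain g where g: "g \<in> tors W j'" "var_pow w (k + N) \<odot>\<^bsub>E j\<^esub> f = d j' g"
      using k by (auto simp: coboundaries_def)
    obtain g' where g': "g' \<in> tors W j'" "var_pow w (k + N) \<odot>\<^bsub>E j'\<^esub> g' = g"
      using var_torsion_divisible[OF modules extends g(1) w] by blast
    have "var_pow w (k + N) \<odot>\<^bsub>E j\<^esub> f = var_pow w (k + N) \<odot>\<^bsub>E j\<^esub> d j' g'"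
      using g(2) g' d_smult[of g' j'] tors_carrier[OF g'(1)] Suc by metis
    then show ?thesis
      using Suc d_carrier d_d d_tors[OF g'(1)] tors_carrier[OF g'(1)] by blast
  qed
  then obtain c where c: "c \<in> carrier (E j)" "d j c = \<zero>\<^bsub>E (Suc j)\<^esub>" "c \<in> tors W j"
      "var_pow w (k + N) \<odot>\<^bsub>E j\<^esub> f = var_pow w (k + N) \<odot>\<^bsub>E j\<^esub> c"
    by blast
  let ?f = "f \<ominus>\<^bsub>E j\<^esub> c"
  have "var_pow w (k + N) \<odot>\<^bsub>E j\<^esub> ?f =
      var_pow w (k + N) \<odot>\<^bsub>E j\<^esub> f \<ominus>\<^bsub>E j\<^esub> var_pow w (k + N) \<odot>\<^bsub>E j\<^esub> c"
    by (rule E.smult_minus[OF fc c(1)])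
  also have "\<dots> = \<zero>\<^bsub>E j\<^esub>"
    using c(1) by (simp add: c(4) a_minus_def E.M.r_neg)
  finally have "var_pow w (k + N) \<odot>\<^bsub>E j\<^esub> ?f = \<zero>\<^bsub>E j\<^esub>" .
  then have "?f \<in> tors (insert w W) j"
    using var_torsion_minus[OF modules f(1) c(3)] by (auto simp: var_torsion_insert[OF modules])
  moreover have "d j ?f = x"
    using c fc d_minus[of f j c] f(2) d_carrier[OF fc] by (simp add: a_minus_def)
  ultimately show "x \<in> coboundaries (insert w W) (Suc j)"
    by (auto simp: coboundaries_def)
qed

text \<open>Adding first the variables that are nilpotent on \<open>H\<^sup>0\<close> keeps the complex acyclic, and each
  further variable raises the cohomological dimension by at most one.\<close>

theorem vanish:
  assumes nil: "\<And>v x. v \<in> A \<Longrightarrow> x \<in> carrier (E 0) \<Longrightarrow> d 0 x = \<zero>\<^bsub>E 1\<^esub> \<Longrightarrow>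
      \<exists>k. var_pow v k \<odot>\<^bsub>E 0\<^esub> x = \<zero>\<^bsub>E 0\<^esub>"
    and i: "card (W - A) < i"
  shows "cocycles W i \<subseteq> coboundaries W i"
proof -
  have base: "cocycles W' (Suc j) \<subseteq> coboundaries W' (Suc j)" if "W' \<subseteq> A" for W' j
    using finite[of W'] that
  proof (induction W' arbitrary: j rule: finite_induct)
    case empty
    show ?case using exact[of j] by (auto simp: cocycles_def coboundaries_def var_torsion_def)
  next
    case (insert w W')
    show ?case
    proof (rule vanish_insert[OF insert.hyps(2)])
      show "cocycles W' (Suc j) \<subseteq> coboundaries W' (Suc j)" using insert by blast
      fix x assume x: "x \<in> cocycles W' j"
      show "\<exists>k. var_pow w k \<odot>\<^bsub>E j\<^esub> x \<in> coboundaries W' j"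
      proof (cases j)
        case 0
        then show ?thesis using nil[of w x] x insert.prems
          by (auto simp: cocycles_def coboundaries_def var_torsion_def)
      next
        case (Suc j')
        then have "x \<in> coboundaries W' j" using insert x by blast
        moreover have "var_pow w 0 \<odot>\<^bsub>E j\<^esub> x = x"
          using x cmodule.smult_1[OF cmodules] by (auto simp: cocycles_def var_torsion_def)
        ultimately show ?thesis by metis
      qed
    qed
  qed
  have "cocycles (W \<inter> A \<union> F) i \<subseteq> coboundaries (W \<inter> A \<union> F) i"
    if "card F < i" "F \<inter> A = {}" for F i
    using finite[of F] that
  proof (induction F arbitrary: i rule: finite_induct)
    case empty
    then show ?case using base[of "W \<inter> A" "i - 1"] by simp
  next
    case (insert w F)
    then obtain j where j: "i = Suc j" "card F < j" by (cases i) auto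
    have "cocycles (insert w (W \<inter> A \<union> F)) (Suc j) \<subseteq> coboundaries (insert w (W \<inter> A \<union> F)) (Suc j)"
    proof (rule vanish_insert)
      show "w \<notin> W \<inter> A \<union> F" using insert by auto
      show "cocycles (W \<inter> A \<union> F) (Suc j) \<subseteq> coboundaries (W \<inter> A \<union> F) (Suc j)"
        using insert j by auto
      fix x assume x: "x \<in> cocycles (W \<inter> A \<union> F) j"
      then have "x \<in> coboundaries (W \<inter> A \<union> F) j" using insert j by blast
      moreover have "var_pow w 0 \<odot>\<^bsub>E j\<^esub> x = x"
        using x cmodule.smult_1[OF cmodules] by (auto simp: cocycles_def var_torsion_def)
      ultimately show "\<exists>k. var_pow w k \<odot>\<^bsub>E j\<^esub> x \<in> coboundaries (W \<inter> A \<union> F) j" by metis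
    qed
    then show ?case by (simp add: j)
  qed
  moreover have "W \<inter> A \<union> (W - A) = W" by blast
  ultimately show ?thesis using i by (metis Diff_disjoint Int_commute)
qed

end

section \<open>Nonvanishing\<close>

context divisible_complex
begin

text \<open>Division by \<open>w\<^sup>k\<close> followed by the connecting map of \<open>0 \<rightarrow> \<Gamma>\<^bsub>W \<union> {w}\<^esub>(E) \<rightarrow> \<Gamma>\<^sub>W(E) \<rightarrow> \<Gamma>\<^sub>W(E)\<^sub>w
  \<rightarrow> 0\<close>, iterated over the variables in the list \<open>ws\<close>: the final cocycle \<open>e'\<close>, of degree \<open>i +
  length ws\<close>, represents a class that comes from \<open>e / (w\<^sub>1 \<cdots> w\<^sub>r)\<^sup>k\<close>. A relation is used
  because the quotients \<open>f\<close> are not unique.\<close>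

inductive climbs :: "nat \<Rightarrow> 'v set \<Rightarrow> nat \<Rightarrow> 'e \<Rightarrow> 'v list \<Rightarrow> 'e \<Rightarrow> bool" for k where
  Nil: "climbs k W i e [] e"
| Cons: "f \<in> tors W i \<Longrightarrow> var_pow w k \<odot>\<^bsub>E i\<^esub> f = e \<Longrightarrow> climbs k (insert w W) (Suc i) (d i f) ws e' \<Longrightarrow>
    climbs k W i e (w # ws) e'"

lemma climbs_exists:
  assumes "e \<in> cocycles W i" "distinct ws" "set ws \<inter> W = {}"
  shows "\<exists>e'. climbs k W i e ws e' \<and> e' \<in> cocycles (W \<union> set ws) (i + length ws)"
  using assms
proof (induction ws arbitrary: W i e)
  case Nil
  then show ?case by (auto intro: climbs.Nil)
next
  case (Cons w ws)
  have e: "e \<in> tors W i" "d i e = \<zero>\<^bsub>E (Suc i)\<^esub>" using Cons.prems(1) by (auto simp: cocycles_def)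
  have "w \<notin> W" using Cons.prems(3) by simp
  then obtain f where f: "f \<in> tors W i" "var_pow w k \<odot>\<^bsub>E i\<^esub> f = e"
    using var_torsion_divisible[OF modules extends e(1)] by blast
  have fc: "f \<in> carrier (E i)" by (rule tors_carrier[OF f(1)])
  have "var_pow w k \<odot>\<^bsub>E (Suc i)\<^esub> d i f = \<zero>\<^bsub>E (Suc i)\<^esub>"
    using d_smult[OF fc, of "var_pow w k"] f(2) e(2) by simp
  then have "d i f \<in> cocycles (insert w W) (Suc i)"
    using d_tors[OF f(1)] d_d[OF fc] by (auto simp: cocycles_def var_torsion_insert[OF modules])
  moreover have "distinct ws" "set ws \<inter> insert w W = {}" using Cons.prems by auto
  ultimately obtain e' where "climbs k (insert w W) (Suc i) (d i f) ws e'"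
    "e' \<in> cocycles (insert w W \<union> set ws) (Suc i + length ws)"
    using Cons.IH by blast
  then show ?case using climbs.Cons[OF f] by auto
qed

lemma zero_coboundary: "\<zero>\<^bsub>E i\<^esub> \<in> coboundaries W i"
proof (cases i)
  case (Suc j)
  then show ?thesis
    using var_torsion_zero[OF modules] d_zero[of j] by (auto simp: coboundaries_def intro!: image_eqI)
qed (simp add: coboundaries_def)

end

lemma var_torsion_module_hom:
  assumes "module \<R> M" "module \<R> N"
    and "f \<in> module_hom \<R> M N" "x \<in> var_torsion W M"
  shows "f x \<in> var_torsion W N"
proof -
  have x: "x \<in> carrier M" using assms(4) by (simp add: var_torsion_def)
  have "s \<odot>\<^bsub>N\<^esub> f x = \<zero>\<^bsub>N\<^esub>" if "s \<odot>\<^bsub>M\<^esub> x = \<zero>\<^bsub>M\<^esub>" for s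
    using module_homD(3)[OF assms(3) _ x, of s] that module_hom_zero[OF assms(1-3)] by simp
  then show ?thesis
    using assms(4) module_homD(1)[OF assms(3) x] unfolding var_torsion_def by blast
qed

lemma climbs_map:
  assumes "divisible_complex E d" "divisible_complex E' d'"
    and \<phi>: "\<And>i. \<phi> i \<in> module_hom \<R> (E i) (E' i)"
    and comm: "\<And>i x. x \<in> carrier (E i) \<Longrightarrow> \<phi> (Suc i) (d i x) = d' i (\<phi> i x)"
    and "divisible_complex.climbs E d k W i e ws e'"
  shows "divisible_complex.climbs E' d' k W i (\<phi> i e) ws (\<phi> (i + length ws) e')"
proof -
  interpret E: divisible_complex E d by fact
  interpret E': divisible_complex E' d' by fact
  show ?thesis using assms(5)
  proof (induction rule: E.climbs.induct)
    case (Nil W i e)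
    then show ?case by (simp add: E'.climbs.Nil)
  next
    case (Cons f W i w e ws e')
    have fc: "f \<in> carrier (E i)" by (rule E.tors_carrier[OF Cons(1)])
    have "\<phi> i f \<in> E'.tors W i"
      by (rule var_torsion_module_hom[OF E.modules E'.modules \<phi> Cons(1)])
    moreover have "var_pow w k \<odot>\<^bsub>E' i\<^esub> \<phi> i f = \<phi> i e"
      using module_homD(3)[OF \<phi> _ fc, of "var_pow w k"] Cons(2) by simp
    ultimately show ?case
      using Cons(4) comm[OF fc] by (auto intro!: E'.climbs.Cons)
  qed
qed

lemma coboundaries_map:
  assumes "divisible_complex E d" "divisible_complex E' d'"
    and \<phi>: "\<And>i. \<phi> i \<in> module_hom \<R> (E i) (E' i)"
    and comm: "\<And>i x. x \<in> carrier (E i) \<Longrightarrow> \<phi> (Suc i) (d i x) = d' i (\<phi> i x)"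
    and x: "x \<in> divisible_complex.coboundaries E d W i"
  shows "\<phi> i x \<in> divisible_complex.coboundaries E' d' W i"
proof -
  interpret E: divisible_complex E d by fact
  interpret E': divisible_complex E' d' by fact
  show ?thesis
  proof (cases i)
    case 0
    then show ?thesis
      using x module_hom_zero[OF E.modules E'.modules \<phi>]
      by (simp add: E.coboundaries_def E'.coboundaries_def)
  next
    case (Suc j)
    then obtain g where "g \<in> E.tors W j" "x = d j g" using x by (auto simp: E.coboundaries_def)
    then show ?thesis
      using var_torsion_module_hom[OF E.modules E'.modules \<phi>] comm[OF E.tors_carrier]
      by (auto simp: E'.coboundaries_def Suc intro!: image_eqI)
  qed
qed

text \<open>Downward induction. If \<open>D f\<close> times a monomial is a combination of cocycles \<open>z v\<close> with
  coefficients \<open>v\<^bsup>k + l v\<^esup>\<close>, up to a coboundary, then vanishing writes \<open>z v = D (h v)\<close> with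
  \<open>h v\<close> in the torsion for one variable less. The difference of \<open>f\<close> times the monomial and
  the combination of the \<open>h v\<close> is a cocycle \<open>x\<close>, and multiplication by a high power of \<open>w\<close>
  turns the \<open>h v\<close> into cocycles as well and \<open>w\<^sup>k f\<close> into \<open>e\<close>.\<close>

lemma climbs_down:
  fixes D :: "nat \<Rightarrow> ('v::finite, 'z, 'k::field) cofun \<Rightarrow> ('v, 'z, 'k) cofun"
  assumes dc: "divisible_complex (\<lambda>_. cofun_module) D"
    and van: "\<And>W j. card (W - A) < j \<Longrightarrow>
      divisible_complex.cocycles (\<lambda>_. cofun_module) D W j \<subseteq>
      divisible_complex.coboundaries (\<lambda>_. cofun_module) D W j"
    and "divisible_complex.climbs (\<lambda>_. cofun_module) D k W i e ws e'"
    and "e' \<in> divisible_complex.coboundaries (\<lambda>_. cofun_module) D (W \<union> set ws) (i + length ws)"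
    and "distinct ws" "set ws \<inter> W = {}" "set ws \<inter> A = {}" "card (W - A) = i"
  shows "\<exists>l z. (\<forall>v\<in>set ws. z v \<in> divisible_complex.cocycles (\<lambda>_. cofun_module) D W i) \<and>
    act (mon (\<Sum>v\<in>set ws. single v (l v))) e - (\<Sum>v\<in>set ws. act (var_pow v (k + l v)) (z v))
      \<in> divisible_complex.coboundaries (\<lambda>_. cofun_module) D W i"
proof -
  interpret divisible_complex "\<lambda>_. cofun_module" D by (rule dc)
  have D_zero: "D i 0 = 0" for i using d_zero[of i] by simp
  have D_act: "D i (act s x) = act s (D i x)" for i s x using d_smult[of x i s] by simp
  have D_add: "D i (x + y) = D i x + D i y" for i x y
    using module_homD(2)[OF d_hom[of i], of x y] by simp
  have D_diff: "D i (x - y) = D i x - D i y" for i x y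
    using D_add[of i "x - y" y] by (metis add_diff_cancel_right' diff_add_cancel)
  have D_sum: "D i (\<Sum>v\<in>Z. g v) = (\<Sum>v\<in>Z. D i (g v))" if "finite Z" for i g and Z :: "'v set"
    using that by (induction Z rule: finite_induct) (simp_all only: sum.empty sum.insert D_zero D_add not_False_eq_True)
  note M = module_cofun_module[where ?'v='v and ?'z='z and ?'k='k]
  have tors_act: "act s x \<in> var_torsion W cofun_module" if "x \<in> var_torsion W cofun_module"
    for s and x :: "('v, 'z, 'k) cofun" and W
    using var_torsion_smult[OF M that, of s] by simp
  have tors_add: "x + y \<in> var_torsion W cofun_module"
    if "x \<in> var_torsion W cofun_module" "y \<in> var_torsion W cofun_module"
    for x y :: "('v, 'z, 'k) cofun" and W
    using var_torsion_add[OF M that] by simp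
  have tors_diff: "x - y \<in> var_torsion W cofun_module"
    if "x \<in> var_torsion W cofun_module" "y \<in> var_torsion W cofun_module"
    for x y :: "('v, 'z, 'k) cofun" and W
    using tors_add[OF that(1) tors_act[OF that(2), of "- 1"]]
    by (metis (no_types, lifting) act_add_left act_one act_zero_left add.commute add.right_inverse
        add_eq_0_iff diff_conv_add_uminus)
  have tors_sum: "(\<Sum>v\<in>Z. g v) \<in> var_torsion W cofun_module"
    if "finite Z" "\<And>v. v \<in> Z \<Longrightarrow> g v \<in> var_torsion W cofun_module"
    for g :: "'v \<Rightarrow> ('v, 'z, 'k) cofun" and W and Z :: "'v set"
    using that var_torsion_zero[OF M, of W]
    by (induction Z rule: finite_induct) (auto simp: tors_add)
  show ?thesis using assms(3-8)
  proof (induction rule: climbs.induct)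
    case (Nil W i e)
    then show ?case by simp
  next
    case (Cons f W i w e ws e')
    have w: "w \<notin> W" "w \<notin> A" "w \<notin> set ws" using Cons.prems by auto
    have card: "card (insert w W - A) = Suc i"
      using Cons.prems(5) w by (simp add: insert_Diff_if)
    have "\<exists>l z. (\<forall>v\<in>set ws. z v \<in> cocycles (insert w W) (Suc i)) \<and>
      act (mon (\<Sum>v\<in>set ws. single v (l v))) (D i f) - (\<Sum>v\<in>set ws. act (var_pow v (k + l v)) (z v))
        \<in> coboundaries (insert w W) (Suc i)"
      using Cons.prems w card by (intro Cons.IH) auto
    then obtain l z where z: "\<forall>v\<in>set ws. z v \<in> cocycles (insert w W) (Suc i)"
      and b: "act (mon (\<Sum>v\<in>set ws. single v (l v))) (D i f) -
          (\<Sum>v\<in>set ws. act (var_pow v (k + l v)) (z v)) \<in> coboundaries (insert w W) (Suc i)"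
      by (elim exE conjE)
    let ?P = "mon (\<Sum>v\<in>set ws. single v (l v)) :: ('v, 'k) mpoly"
    obtain g where g: "g \<in> tors (insert w W) i"
      "act ?P (D i f) - (\<Sum>v\<in>set ws. act (var_pow v (k + l v)) (z v)) = D i g"
      using b by (auto simp: coboundaries_def)
    have "\<exists>h. h \<in> tors W i \<and> D i h = z v" if "v \<in> set ws" for v
    proof -
      have "z v \<in> cocycles W (Suc i)"
        using z that by (auto simp: cocycles_def var_torsion_insert[OF M])
      moreover have "card (W - A) < Suc i" using Cons.prems(5) by simp
      ultimately have "z v \<in> coboundaries W (Suc i)" using van by blast
      then show ?thesis by (auto simp: coboundaries_def)
    qed
    then have "\<forall>v\<in>set ws. \<exists>h. h \<in> tors W i \<and> D i h = z v" by blast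
    from bchoice[OF this] obtain h where h: "\<forall>v\<in>set ws. h v \<in> tors W i \<and> D i (h v) = z v"
      by (elim exE)
    define x where "x = act ?P f - (\<Sum>v\<in>set ws. act (var_pow v (k + l v)) (h v)) - g"
    have f: "f \<in> tors W i" "act (var_pow w k) f = e" using Cons.hyps by simp_all
    have gW: "g \<in> tors W i" using g(1) by (simp add: var_torsion_insert[OF M])
    have "D i (\<Sum>v\<in>set ws. act (var_pow v (k + l v)) (h v)) = (\<Sum>v\<in>set ws. act (var_pow v (k + l v)) (z v))"
      using h by (simp add: D_sum D_act)
    then have "D i x = 0"
      by (simp only: x_def D_diff D_act g(2)) simp
    moreover have "x \<in> tors W i"
      unfolding x_def using f(1) gW h by (intro tors_diff tors_act tors_sum) auto
    ultimately have x: "x \<in> cocycles W i" by (simp add: cocycles_def)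
    \<comment> \<open>a power of \<open>w\<close> that kills the elements \<open>z v\<close> and \<open>g\<close>, all of them \<open>w\<close>-torsion\<close>
    have "\<forall>v\<in>set ws. \<exists>n. act (var_pow w n) (z v) = 0"
      using z by (auto simp: cocycles_def var_torsion_def)
    from bchoice[OF this] obtain n where n: "\<forall>v\<in>set ws. act (var_pow w (n v)) (z v) = 0"
      by (elim exE)
    obtain n' where n': "act (var_pow w n') g = 0" using g(1) by (auto simp: var_torsion_def)
    define L where "L = n' + (\<Sum>v\<in>set ws. n v)"
    have Lz: "act (var_pow w (k + L)) (z v) = 0" if "v \<in> set ws" for v
    proof -
      have "n v \<le> (\<Sum>v\<in>set ws. n v)" using that by (intro member_le_sum) auto
      then show ?thesis
        using var_pow_smult_mono[OF M, of "z v" w "n v" "k + L"] n that by (simp add: L_def)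
    qed
    have Lg: "act (var_pow w (k + L)) g = 0"
      using var_pow_smult_mono[OF M, of g w n' "k + L"] n' by (simp add: L_def)
    define l' where "l' = l(w := L)"
    define z' where "z' v = (if v = w then x else act (var_pow w (k + L)) (h v))" for v
    have z': "z' v \<in> cocycles W i" if "v \<in> set (w # ws)" for v
    proof (cases "v = w")
      case False
      then have v: "v \<in> set ws" using that by simp
      then show ?thesis
        using False h Lz[OF v] by (simp add: z'_def cocycles_def D_act tors_act)
    qed (simp add: z'_def x)
    have sum_l: "(\<Sum>v\<in>set (w # ws). single v (l' v)) =
        single w L + (\<Sum>v\<in>set ws. single v (l v))"
    proof -
      have "(\<Sum>v\<in>set ws. single v (l' v)) = (\<Sum>v\<in>set ws. single v (l v))"
        using w by (intro sum.cong) (auto simp: l'_def)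
      then show ?thesis using w by (simp add: l'_def)
    qed
    have mon_e: "act (mon (\<Sum>v\<in>set (w # ws). single v (l' v))) e =
        act (var_pow w (k + L)) (act ?P f)"
      unfolding sum_l f(2)[symmetric] act_times[symmetric] by (simp add: mult_single single_add ac_simps)
    have "(\<Sum>v\<in>set (w # ws). act (var_pow v (k + l' v)) (z' v)) =
        act (var_pow w (k + L)) x + (\<Sum>v\<in>set ws. act (var_pow v (k + l' v)) (z' v))"
      using w by (simp add: l'_def z'_def)
    also have "(\<Sum>v\<in>set ws. act (var_pow v (k + l' v)) (z' v)) =
        (\<Sum>v\<in>set ws. act (var_pow w (k + L)) (act (var_pow v (k + l v)) (h v)))"
      using w by (intro sum.cong) (auto simp: l'_def z'_def mult.commute simp flip: act_times)
    also have "\<dots> = act (var_pow w (k + L)) (\<Sum>v\<in>set ws. act (var_pow v (k + l v)) (h v))"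
      by (rule act_sum_right[symmetric])
    also have "act (var_pow w (k + L)) x + \<dots> =
        act (var_pow w (k + L)) (act ?P f) - act (var_pow w (k + L)) g"
      unfolding x_def act_diff_right by simp
    finally have sum_z: "(\<Sum>v\<in>set (w # ws). act (var_pow v (k + l' v)) (z' v)) =
        act (var_pow w (k + L)) (act ?P f)" by (simp add: Lg)
    have "act (mon (\<Sum>v\<in>set (w # ws). single v (l' v))) e -
        (\<Sum>v\<in>set (w # ws). act (var_pow v (k + l' v)) (z' v)) \<in> coboundaries W i"
      unfolding mon_e sum_z using zero_coboundary[where i=i and W=W] by simp
    then show ?case using z' by blast
  qed
qed

section \<open>Local cohomology of cyclic modules\<close>

lemma zero_module_quotient_iff:
  fixes M :: "('a, 'b, 's) module_scheme"
  assumes M: "abelian_group M" and Z: "\<zero>\<^bsub>M\<^esub> \<in> Z" "Z \<subseteq> carrier M"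
    and B: "\<zero>\<^bsub>M\<^esub> \<in> B" "B \<subseteq> carrier M" "\<And>a b. a \<in> B \<Longrightarrow> b \<in> B \<Longrightarrow> a \<oplus>\<^bsub>M\<^esub> b \<in> B"
      "\<And>a b. a \<in> B \<Longrightarrow> b \<in> B \<Longrightarrow> a \<ominus>\<^bsub>M\<^esub> b \<in> B"
  shows "zero_module (quotient_module (M\<lparr>carrier := Z\<rparr>) B) \<longleftrightarrow> Z \<subseteq> B"
proof -
  interpret abelian_group M by fact
  have rcos: "B +>\<^bsub>M\<lparr>carrier := Z\<rparr>\<^esub> z = (\<lambda>b. b \<oplus>\<^bsub>M\<^esub> z) ` B" for z
    by (auto simp: a_r_coset_def')
  have "carrier (quotient_module (M\<lparr>carrier := Z\<rparr>) B) = a_rcosets\<^bsub>M\<lparr>carrier := Z\<rparr>\<^esub> B"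
    "\<zero>\<^bsub>quotient_module (M\<lparr>carrier := Z\<rparr>) B\<^esub> = B"
    by (simp_all only: quotient_module_def partial_object.simps ring.simps)
  moreover have "a_rcosets\<^bsub>M\<lparr>carrier := Z\<rparr>\<^esub> B = (\<lambda>z. (\<lambda>b. b \<oplus>\<^bsub>M\<^esub> z) ` B) ` Z"
    unfolding A_RCOSETS_def' rcos by auto
  ultimately have zm: "zero_module (quotient_module (M\<lparr>carrier := Z\<rparr>) B) \<longleftrightarrow> (\<lambda>z. (\<lambda>b. b \<oplus>\<^bsub>M\<^esub> z) ` B) ` Z = {B}"
    unfolding zero_module_def by simp
  show ?thesis
  proof
    assume "zero_module (quotient_module (M\<lparr>carrier := Z\<rparr>) B)"
    then have im: "(\<lambda>z. (\<lambda>b. b \<oplus>\<^bsub>M\<^esub> z) ` B) ` Z = {B}" by (simp only: zm)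
    have eq: "(\<lambda>b. b \<oplus>\<^bsub>M\<^esub> z) ` B = B" if "z \<in> Z" for z
      using imageI[OF that, of "\<lambda>z. (\<lambda>b. b \<oplus>\<^bsub>M\<^esub> z) ` B"] unfolding im by simp
    show "Z \<subseteq> B"
    proof
      fix z assume "z \<in> Z"
      then have "\<zero>\<^bsub>M\<^esub> \<oplus>\<^bsub>M\<^esub> z \<in> B" using eq B(1) by blast
      then show "z \<in> B" using \<open>z \<in> Z\<close> Z(2) by auto
    qed
  next
    assume ZB: "Z \<subseteq> B"
    have "(\<lambda>b. b \<oplus>\<^bsub>M\<^esub> z) ` B = B" if "z \<in> Z" for z
    proof (intro equalityI subsetI)
      fix b assume b: "b \<in> B"
      have "b = (b \<ominus>\<^bsub>M\<^esub> z) \<oplus>\<^bsub>M\<^esub> z"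
        using subsetD[OF B(2) b] subsetD[OF Z(2) that] by (simp add: a_minus_def a_assoc l_neg)
      then show "b \<in> (\<lambda>b. b \<oplus>\<^bsub>M\<^esub> z) ` B" using B(4)[OF b] that ZB by blast
    qed (use that ZB B(3) in auto)
    then show "zero_module (quotient_module (M\<lparr>carrier := Z\<rparr>) B)" unfolding zm using Z(1) by auto
  qed
qed

context divisible_complex
begin

lemma d_add: "x \<in> carrier (E i) \<Longrightarrow> y \<in> carrier (E i) \<Longrightarrow>
    d i (x \<oplus>\<^bsub>E i\<^esub> y) = d i x \<oplus>\<^bsub>E (Suc i)\<^esub> d i y"
  using module_homD(2)[OF d_hom] .

lemma zero_module_cohomology_iff:
  "zero_module (quotient_module ((E i)\<lparr>carrier := cocycles W i\<rparr>) (coboundaries W i)) \<longleftrightarrow>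
    cocycles W i \<subseteq> coboundaries W i"
proof (rule zero_module_quotient_iff)
  interpret E: cmodule "E i" by (rule cmodules)
  show "abelian_group (E i)" by (rule E.M.abelian_group_axioms)
  show "\<zero>\<^bsub>E i\<^esub> \<in> cocycles W i" by (simp add: cocycles_def var_torsion_zero[OF modules] d_zero)
  show "cocycles W i \<subseteq> carrier (E i)" by (auto simp: cocycles_def var_torsion_def)
  show "\<zero>\<^bsub>E i\<^esub> \<in> coboundaries W i" by (rule zero_coboundary)
  show "coboundaries W i \<subseteq> carrier (E i)"
    using d_carrier tors_carrier[OF var_torsion_zero[OF modules]]
    by (cases i) (auto simp: coboundaries_def var_torsion_def)
  show "a \<oplus>\<^bsub>E i\<^esub> b \<in> coboundaries W i" if "a \<in> coboundaries W i" "b \<in> coboundaries W i" for a b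
  proof (cases i)
    case 0
    then show ?thesis using that E.M.l_zero[OF E.M.zero_closed] by (simp add: coboundaries_def)
  next
    case (Suc j)
    then obtain x y where "a = d j x" "b = d j y" "x \<in> tors W j" "y \<in> tors W j"
      using \<open>a \<in> coboundaries W i\<close> \<open>b \<in> coboundaries W i\<close> by (auto simp: coboundaries_def)
    then have "a \<oplus>\<^bsub>E i\<^esub> b = d j (x \<oplus>\<^bsub>E j\<^esub> y)" "x \<oplus>\<^bsub>E j\<^esub> y \<in> tors W j"
      using d_add tors_carrier var_torsion_add[OF modules] Suc by auto
    then show ?thesis by (auto simp: coboundaries_def Suc)
  qed
  show "a \<ominus>\<^bsub>E i\<^esub> b \<in> coboundaries W i" if "a \<in> coboundaries W i" "b \<in> coboundaries W i" for a b
  proof (cases i)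
    case 0
    then show ?thesis using that E.M.r_neg[OF E.M.zero_closed] by (simp add: coboundaries_def a_minus_def)
  next
    case (Suc j)
    then obtain x y where "a = d j x" "b = d j y" "x \<in> tors W j" "y \<in> tors W j"
      using \<open>a \<in> coboundaries W i\<close> \<open>b \<in> coboundaries W i\<close> by (auto simp: coboundaries_def)
    then have "a \<ominus>\<^bsub>E i\<^esub> b = d j (x \<ominus>\<^bsub>E j\<^esub> y)" "x \<ominus>\<^bsub>E j\<^esub> y \<in> tors W j"
      using d_minus tors_carrier var_torsion_minus[OF modules] Suc by auto
    then show ?thesis by (auto simp: coboundaries_def Suc)
  qed
qed

end

lemma divisible_complex_of_injective_resolution:
  fixes E :: "nat \<Rightarrow> (('v::finite, 'k::field) mpoly, 'e) module" and j :: "('v, 'k) mpoly \<Rightarrow> 'e"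
  assumes "injective_resolution \<R> M E d \<epsilon>" "inj j"
  shows "divisible_complex E d"
proof (rule divisible_complex.intro)
  have inj: "injective_module \<R> (E i)" for i
    using assms(1) by (simp add: injective_resolution_def)
  show "module \<R> (E i)" for i using inj[of i] by (simp add: injective_module_def)
  show "extends_from_ideals (E i)" for i
    by (rule injective_module_extends_from_ideals[OF assms(2) inj])
qed (use assms(1) in \<open>auto simp: injective_resolution_def\<close>)

lemma cyclic_module_resolution:
  fixes I :: "('v::finite, 'k::field) mpoly set"
  assumes I: "ideal I \<R>"
  obtains E d \<epsilon> where
    "injective_resolution \<R> (cyclic_module \<R> I) E d
      (\<epsilon> :: ('v, 'k) mpoly set \<Rightarrow> ('v, 'k) mpoly list \<Rightarrow> ('v, 'k) mpoly set)"
    "divisible_complex E d"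
    "\<And>W i. zero_module (local_cohomology \<R> (span_mon (meets W)) i
        (cyclic_module \<R> I)) \<longleftrightarrow>
      divisible_complex.cocycles E d W i \<subseteq> divisible_complex.coboundaries E d W i"
proof -
  obtain E d and \<epsilon> :: "('v, 'k) mpoly set \<Rightarrow> ('v, 'k) mpoly list \<Rightarrow> ('v, 'k) mpoly set"
    where ch: "chosen_resolution \<R> (cyclic_module \<R> I) = (E, d)"
    and res: "injective_resolution \<R> (cyclic_module \<R> I) E d \<epsilon>"
    using chosen_resolution_cyclic_module[OF I] by (elim exE conjE)
  have "inj (\<lambda>(f :: ('v, 'k) mpoly) (l :: ('v, 'k) mpoly list). {f})"
    by (rule injI) (metis singleton_inject)
  then have dc: "divisible_complex E d"
    by (rule divisible_complex_of_injective_resolution[OF res])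
  interpret divisible_complex E d by (rule dc)
  have Z: "{x \<in> torsion \<R> (span_mon (meets W)) (E i). d i x = \<zero>\<^bsub>E (Suc i)\<^esub>} = cocycles W i"
    for W i by (simp add: torsion_vars[OF modules] cocycles_def)
  have B: "(case i of 0 \<Rightarrow> {\<zero>\<^bsub>E 0\<^esub>} | Suc j \<Rightarrow> d j ` torsion \<R> (span_mon (meets W)) (E j)) =
      coboundaries W i"
    for W i by (cases i) (simp_all add: torsion_vars[OF modules] coboundaries_def)
  have "zero_module (local_cohomology \<R> (span_mon (meets W)) i
      (cyclic_module \<R> I)) \<longleftrightarrow> cocycles W i \<subseteq> coboundaries W i" for W i
    unfolding local_cohomology_def ch Let_def prod.case Z B by (rule zero_module_cohomology_iff)
  with res dc show ?thesis by (rule that)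
qed

lemma lookup_sum_single:
  fixes l :: "'v \<Rightarrow> nat"
  assumes "finite Z"
  shows "lookup (\<Sum>v\<in>Z. single v (l v)) w = (if w \<in> Z then l w else 0)"
  using assms by (simp add: lookup_sum lookup_single when_def)

text \<open>In the case \<open>A = {}\<close> the bound is the number of generators of the ideal; variables with a
  power in \<open>I\<close> do not count.\<close>

theorem local_cohomology_vanishes:
  fixes I :: "('v::finite, 'k::field) mpoly set"
  assumes I: "ideal I \<R>" and A: "\<And>v. v \<in> A \<Longrightarrow> \<exists>k. var_pow v k \<in> I"
    and i: "card (W - A) < i"
  shows "zero_module (local_cohomology \<R> (span_mon (meets W)) i
    (cyclic_module \<R> I))"
proof -
  let ?M = "cyclic_module \<R> I"
  obtain E d and \<epsilon> :: "('v, 'k) mpoly set \<Rightarrow> ('v, 'k) mpoly list \<Rightarrow> ('v, 'k) mpoly set"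
    where res: "injective_resolution \<R> ?M E d \<epsilon>"
    and dc: "divisible_complex E d"
    and lc: "\<And>W i. zero_module (local_cohomology \<R> (span_mon (meets W)) i ?M) \<longleftrightarrow>
      divisible_complex.cocycles E d W i \<subseteq> divisible_complex.coboundaries E d W i"
    using cyclic_module_resolution[OF I] by blast
  interpret divisible_complex E d by (rule dc)
  have eps: "\<epsilon> \<in> module_hom \<R> ?M (E 0)"
    and im: "\<epsilon> ` carrier ?M = {x \<in> carrier (E 0). d 0 x = \<zero>\<^bsub>E 1\<^esub>}"
    using res by (simp_all add: injective_resolution_def)
  show ?thesis
    unfolding lc
  proof (rule vanish[OF _ i])
    fix v x assume v: "v \<in> A" and x: "x \<in> carrier (E 0)" "d 0 x = \<zero>\<^bsub>E 1\<^esub>"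
    obtain f where f: "x = \<epsilon> (coset I f)" using x im by (auto simp: cyclic_module_simps[OF I])
    obtain k where k: "var_pow v k \<in> I" using A[OF v] by blast
    have "var_pow v k \<odot>\<^bsub>E 0\<^esub> x = \<epsilon> (var_pow v k \<odot>\<^bsub>?M\<^esub> coset I f)"
      unfolding f by (rule module_homD(3)[OF eps, symmetric]) (simp_all add: cyclic_module_simps[OF I])
    also have "var_pow v k \<odot>\<^bsub>?M\<^esub> coset I f = \<zero>\<^bsub>?M\<^esub>"
    proof -
      have "f * var_pow v k \<in> I" using I k by (simp add: ideal_of_type_algebra_iff)
      then show ?thesis by (simp add: cyclic_module_simps[OF I] coset_eq_iff[OF I] mult.commute)
    qed
    also have "\<epsilon> \<dots> = \<zero>\<^bsub>E 0\<^esub>" by (rule module_hom_zero[OF module_cyclic_module[OF I] modules eps])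
    finally show "\<exists>k. var_pow v k \<odot>\<^bsub>E 0\<^esub> x = \<zero>\<^bsub>E 0\<^esub>" by blast
  qed
qed

text \<open>The hypotheses say that, among the monomials in the variables of \<open>W\<close>, those that kill the
  residue class of \<open>u\<close> are those divisible by a variable in \<open>V\<close>. The class constructed here
  has, in each variable of \<open>W - V\<close>, degree \<open>-1\<close>: it is that of \<open>m / (w\<^sub>1 \<cdots> w\<^sub>r)\<^bsup>K+1\<^esup>\<close>, where
  \<open>m\<close> is the multiple of \<open>u\<close> of degree \<open>K\<close> in each of these variables.\<close>

theorem local_cohomology_nonzero:
  fixes U :: "('v::finite \<Rightarrow>\<^sub>0 nat) set"
  assumes U: "upset U"
    and kill: "\<And>v. v \<in> V \<inter> W \<Longrightarrow> u + single v 1 \<in> U"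
    and free: "\<And>t. keys t \<subseteq> W - V \<Longrightarrow> u + t \<notin> U"
  shows "\<not> zero_module (local_cohomology \<R> (span_mon (meets W)) (card (W - V))
    (cyclic_module \<R> (span_mon U :: ('v, 'k::field) mpoly set)))"
proof
  let ?I = "span_mon U :: ('v, 'k) mpoly set"
  let ?M = "cyclic_module \<R> ?I"
  have I: "ideal ?I \<R>" by (rule ideal_span_mon[OF U])
  assume zero: "zero_module (local_cohomology \<R> (span_mon (meets W)) (card (W - V)) ?M)"
  obtain E d and \<epsilon> :: "('v, 'k) mpoly set \<Rightarrow> ('v, 'k) mpoly list \<Rightarrow> ('v, 'k) mpoly set"
    where res: "injective_resolution \<R> ?M E d \<epsilon>"
    and dc: "divisible_complex E d"
    and lc: "\<And>W i. zero_module (local_cohomology \<R> (span_mon (meets W)) i ?M) \<longleftrightarrow>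
      divisible_complex.cocycles E d W i \<subseteq> divisible_complex.coboundaries E d W i"
    using cyclic_module_resolution[OF I] by blast
  interpret E: divisible_complex E d by (rule dc)
  have eps: "\<epsilon> \<in> module_hom \<R> ?M (E 0)"
    and im: "\<epsilon> ` carrier ?M = {x \<in> carrier (E 0). d 0 x = \<zero>\<^bsub>E 1\<^esub>}"
    using res by (simp_all add: injective_resolution_def)
  \<comment> \<open>a larger ideal, modulo which all variables outside \<open>W - V\<close> are nilpotent; it still contains no multiple of \<open>u\<close> by
    a monomial in the variables of \<open>W - V\<close>\<close>
  define U' where "U' = {t. \<exists>v. v \<notin> W - V \<and> lookup u v < lookup t v}"
  have U': "upset U'" unfolding upset_def U'_def
    by (auto simp: lookup_add intro: trans_less_add1) 
  let ?I' = "span_mon U' :: ('v, 'k) mpoly set"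
  have I': "ideal ?I' \<R>" by (rule ideal_span_mon[OF U'])
  have "U \<subseteq> U'"
  proof
    fix t assume t: "t \<in> U"
    show "t \<in> U'"
    proof (rule ccontr)
      assume "t \<notin> U'"
      then have le: "lookup t v \<le> lookup u v" if "v \<notin> W - V" for v
        using that unfolding U'_def by (auto simp: not_less)
      define s where "s = (\<Sum>v\<in>W - V. single v (lookup t v))"
      have "u + s = t + (u + s - t)"
        by (rule monom_le_imp_add) (use le in \<open>auto simp: s_def lookup_add lookup_sum_single\<close>)
      then have "u + s \<in> U" using U t by (metis upset_def)
      moreover have "keys s \<subseteq> W - V"
        by (auto simp: s_def in_keys_iff lookup_sum_single split: if_splits)
      ultimately show False using free by blast
    qed
  qed
  then have II': "?I \<subseteq> ?I'" by (auto simp: span_mon_def)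
  obtain e :: "('v, 'k) mpoly \<Rightarrow> ('v, 'k) cofree" and D where
    e: "\<forall>f g. e (f + g) = e f + e g" "\<forall>s f. e (s * f) = act s (e f)" "\<forall>f. e f = 0 \<longleftrightarrow> f \<in> ?I'"
    and D: "\<forall>i::nat. cofree_endo (D i)" and D0: "range e = {x. D 0 x = 0}"
    and DS: "\<forall>i. range (D i) = {x. D (Suc i) x = 0}"
    using cofree_resolution[OF I'] by (elim exE conjE)
  have D_hom: "D i \<in> module_hom \<R> cofun_module cofun_module" for i
    using D by (simp add: module_hom_def cofree_endo_def)
  have dc': "divisible_complex (\<lambda>_. cofun_module) D"
    by (rule divisible_complex.intro) (simp_all add: module_cofun_module cofun_module_extends_from_ideals D_hom DS)
  interpret X: divisible_complex "\<lambda>_. cofun_module" D by (rule dc')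
  have van: "X.cocycles W' j \<subseteq> X.coboundaries W' j" if "card (W' - W \<inter> V) < j" for W' j
  proof (rule X.vanish[OF _ that])
    fix v x assume v: "v \<in> W \<inter> V" and "x \<in> carrier (cofun_module :: (('v, 'k) mpoly, ('v, 'k) cofree) module)"
      and "D 0 x = \<zero>\<^bsub>cofun_module\<^esub>"
    then have "x \<in> range e" using D0 by simp
    then obtain f where f: "x = e f" by blast
    have "var_pow v (Suc (lookup u v)) \<in> ?I'" using v by (auto simp: U'_def intro!: exI[of _ v])
    then have "f * var_pow v (Suc (lookup u v)) \<in> ?I'"
      using I' unfolding ideal_of_type_algebra_iff by blast
    then have "act (var_pow v (Suc (lookup u v))) x = 0"
      unfolding f e(2)[rule_format, symmetric] using e(3) by (simp add: mult.commute)
    then show "\<exists>k. var_pow v k \<odot>\<^bsub>cofun_module\<^esub> x = \<zero>\<^bsub>cofun_module\<^esub>" by auto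
  qed
  define \<eta> where "\<eta> C = e (SOME f. coset ?I f = C)" for C
  have e_diff: "e (f - g) = e f - e g" for f g
    using e(1)[rule_format, of "f - g" g] by (simp add: algebra_simps)
  have eta: "\<eta> (coset ?I f) = e f" for f
  proof -
    have "coset ?I (SOME g. coset ?I g = coset ?I f) = coset ?I f" by (rule someI) simp
    then have "(SOME g. coset ?I g = coset ?I f) - f \<in> ?I'" using II' by (auto simp only: coset_eq_iff[OF I])
    then have "e ((SOME g. coset ?I g = coset ?I f) - f) = 0" using e(3) by blast
    then show ?thesis by (simp add: \<eta>_def e_diff)
  qed
  have \<eta>_hom: "\<eta> \<in> module_hom \<R> ?M cofun_module"
    by (auto simp: module_hom_def cyclic_module_simps[OF I] eta e(1,2))
  have "D 0 (\<eta> x) = 0" if "x \<in> carrier ?M" for x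
    using that D0 by (auto simp: cyclic_module_simps[OF I] eta)
  moreover have "D (Suc i) (D i x) = 0" for i x using DS by blast
  ultimately have "\<exists>\<phi>. (\<forall>i. \<phi> i \<in> module_hom \<R> (E i) cofun_module) \<and>
      (\<forall>i. \<forall>x\<in>carrier (E i). \<phi> (Suc i) (d i x) = D i (\<phi> i x)) \<and>
      (\<forall>x\<in>carrier ?M. \<phi> 0 (\<epsilon> x) = \<eta> x)"
    by (rule comparison_map[OF module_cyclic_module[OF I] res \<eta>_hom D_hom])
  then obtain \<phi> where \<phi>: "\<forall>i. \<phi> i \<in> module_hom \<R> (E i) cofun_module"
    and comm: "\<forall>i. \<forall>x\<in>carrier (E i). \<phi> (Suc i) (d i x) = D i (\<phi> i x)"
    and \<phi>0: "\<forall>x\<in>carrier ?M. \<phi> 0 (\<epsilon> x) = \<eta> x"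
    by (elim exE conjE)
  define K where "K = (\<Sum>v\<in>UNIV. lookup u v)"
  have K: "lookup u v \<le> K" for v unfolding K_def by (rule member_le_sum) auto
  define m where "m = u + (\<Sum>v\<in>W - V. single v (K - lookup u v))"
  have m: "lookup m v = (if v \<in> W - V then K else lookup u v)" for v
    using K[of v] by (auto simp: m_def lookup_add lookup_sum_single)
  obtain ws where ws: "set ws = W - V" "distinct ws"
    using finite_distinct_list[of "W - V"] by auto
  define e0 where "e0 = \<epsilon> (coset ?I (mon m))"
  have e0: "e0 \<in> E.cocycles (W \<inter> V) 0"
  proof -
    have c: "coset ?I (mon m) \<in> carrier ?M" by (simp add: cyclic_module_simps[OF I])
    then have "e0 \<in> carrier (E 0)" "d 0 e0 = \<zero>\<^bsub>E (Suc 0)\<^esub>" using im unfolding e0_def by auto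
    moreover have "var_pow v 1 \<odot>\<^bsub>E 0\<^esub> e0 = \<zero>\<^bsub>E 0\<^esub>" if v: "v \<in> W \<inter> V" for v
    proof -
      have "var_pow v 1 \<odot>\<^bsub>E 0\<^esub> e0 = \<epsilon> (var_pow v 1 \<odot>\<^bsub>?M\<^esub> coset ?I (mon m))"
        unfolding e0_def by (rule module_homD(3)[OF eps _ c, symmetric]) simp
      also have "var_pow v 1 \<odot>\<^bsub>?M\<^esub> coset ?I (mon m) = \<zero>\<^bsub>?M\<^esub>"
      proof -
        have "u + single v 1 \<in> U" using v by (intro kill) auto
        then have "u + single v 1 + (m - u) \<in> U" using U unfolding upset_def by blast
        moreover have "u + single v 1 + (m - u) = single v 1 + m"
          by (simp add: m_def ac_simps)
        ultimately have "mon (single v 1 + m) \<in> ?I" by simp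
        then show ?thesis
          by (simp add: cyclic_module_simps[OF I] coset_eq_iff[OF I] mult_single)
      qed
      also have "\<epsilon> \<dots> = \<zero>\<^bsub>E 0\<^esub>" by (rule module_hom_zero[OF module_cyclic_module[OF I] E.modules eps])
      finally show ?thesis .
    qed
    ultimately show ?thesis unfolding E.cocycles_def var_torsion_def by blast
  qed
  obtain e' where e': "E.climbs (Suc K) (W \<inter> V) 0 e0 ws e'" "e' \<in> E.cocycles (W \<inter> V \<union> set ws) (0 + length ws)"
    using E.climbs_exists[OF e0 ws(2)] ws(1) by blast
  have WV: "W \<inter> V \<union> set ws = W" "length ws = card (W - V)"
    using ws distinct_card[OF ws(2)] by auto
  have "e' \<in> E.coboundaries W (card (W - V))"
    using zero e'(2) unfolding lc WV by auto
  then have top: "\<phi> (length ws) e' \<in> X.coboundaries (W \<inter> V \<union> set ws) (0 + length ws)"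
    using coboundaries_map[OF dc dc', of \<phi> e' W "length ws"] \<phi> comm by (simp add: WV)
  have climb: "X.climbs (Suc K) (W \<inter> V) 0 (\<phi> 0 e0) ws (\<phi> (length ws) e')"
    using climbs_map[OF dc dc', of \<phi>, OF _ _ e'(1)] \<phi> comm by simp
  have "\<exists>l z. (\<forall>v\<in>set ws. z v \<in> X.cocycles (W \<inter> V) 0) \<and>
    act (mon (\<Sum>v\<in>set ws. single v (l v))) (\<phi> 0 e0) -
      (\<Sum>v\<in>set ws. act (var_pow v (Suc K + l v)) (z v)) \<in> X.coboundaries (W \<inter> V) 0"
    by (rule climbs_down[OF dc' van climb top]) (use ws in auto)
  then obtain l z where z: "\<forall>v\<in>set ws. z v \<in> X.cocycles (W \<inter> V) 0"
    and eq: "act (mon (\<Sum>v\<in>set ws. single v (l v))) (\<phi> 0 e0) -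
      (\<Sum>v\<in>set ws. act (var_pow v (Suc K + l v)) (z v)) \<in> X.coboundaries (W \<inter> V) 0"
    by (elim exE conjE)
  have "\<forall>v\<in>set ws. \<exists>g. z v = e g"
  proof
    fix v assume "v \<in> set ws"
    then have "D 0 (z v) = 0" using z by (auto simp: X.cocycles_def)
    then have "z v \<in> range e" using D0 by simp
    then show "\<exists>g. z v = e g" by blast
  qed
  from bchoice[OF this] obtain g where g: "\<forall>v\<in>set ws. z v = e (g v)" by (elim exE)
  have e_sum: "e (\<Sum>v\<in>Z. h v) = (\<Sum>v\<in>Z. e (h v))" if "finite Z" for Z :: "'v set" and h
  proof -
    have "e 0 = 0" using e(3) I' by (simp add: ideal_of_type_algebra_iff)
    with that show ?thesis
      by (induction Z rule: finite_induct) (simp_all only: sum.empty sum.insert not_False_eq_True e(1)[rule_format])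
  qed
  let ?s = "\<Sum>v\<in>set ws. single v (l v)"
  let ?f = "mon ?s * mon m - (\<Sum>v\<in>set ws. var_pow v (Suc K + l v) * g v)"
  have "\<phi> 0 e0 = e (mon m)"
    using \<phi>0 by (simp add: e0_def cyclic_module_simps[OF I] eta)
  moreover have "(\<Sum>v\<in>set ws. act (var_pow v (Suc K + l v)) (z v)) =
      e (\<Sum>v\<in>set ws. var_pow v (Suc K + l v) * g v)"
    unfolding e_sum[OF finite_set] using g e(2) by (intro sum.cong) auto
  ultimately have "e ?f = 0"
    using eq unfolding e_diff e(2)[rule_format] by (simp add: X.coboundaries_def)
  then have f: "?f \<in> ?I'" using e(3) by blast
  \<comment> \<open>the exponent \<open>?s + m\<close> is outside \<open>U'\<close> and too small in each \<open>v\<close> to be divisible by the \<open>v\<close>-power in the sum\<close>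
  have "lookup (var_pow v (Suc K + l v) * g v) (?s + m) = 0" if v: "v \<in> set ws" for v
  proof (rule lookup_single_times_not)
    fix r
    have "lookup (?s + m) v = l v + K"
      using v ws(1) by (simp add: lookup_add lookup_sum_single m)
    then show "?s + m \<noteq> single v (Suc K + l v) + r"
      by (metis add_Suc add_leD1 lookup_add lookup_single_eq not_less_eq_eq order_refl add.commute)
  qed
  then have "lookup ?f (?s + m) = 1"
    by (simp add: lookup_minus lookup_sum mult_single)
  then have "?s + m \<in> U'" using f by (auto simp: span_mon_def in_keys_iff)
  then obtain v where v: "v \<notin> W - V" "lookup u v < lookup (?s + m) v"
    unfolding U'_def by blast
  moreover have "lookup (?s + m) v = lookup u v"
    using v(1) by (auto simp: lookup_add lookup_sum_single ws(1) m)
  ultimately show False by simp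
qed

section \<open>Leading terms and monomial primes\<close>

text \<open>A substitute for a monomial order, since the variables are not ordered: number them, and
  use the order on exponent vectors indexed by natural numbers.\<close>

lemma additive_order_embedding:
  obtains \<omega> :: "('v::finite \<Rightarrow>\<^sub>0 nat) \<Rightarrow> (nat \<Rightarrow>\<^sub>0 nat)"
  where "inj \<omega>" "\<And>s t. \<omega> (s + t) = \<omega> s + \<omega> t"
proof -
  obtain h :: "'v \<Rightarrow> nat" where h: "inj h"
    using finite_imp_inj_to_nat_seg[OF finite, of UNIV] by blast
  define \<omega> :: "('v \<Rightarrow>\<^sub>0 nat) \<Rightarrow> (nat \<Rightarrow>\<^sub>0 nat)"
    where "\<omega> t = (\<Sum>v\<in>UNIV. single (h v) (lookup t v))" for t
  have "lookup (\<omega> t) (h w) = lookup t w" for t w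
  proof -
    have "lookup (\<omega> t) (h w) = (\<Sum>v\<in>UNIV. if v = w then lookup t v else 0)"
      unfolding \<omega>_def lookup_sum
      by (intro sum.cong) (auto simp: lookup_single when_def inj_eq[OF h])
    then show ?thesis by simp
  qed
  then have "inj \<omega>" by (intro injI poly_mapping_eqI) metis
  moreover have "\<omega> (s + t) = \<omega> s + \<omega> t" for s t
    by (simp add: \<omega>_def lookup_add single_add sum.distrib)
  ultimately show ?thesis by (rule that)
qed

text \<open>The product of the leading terms of the parts of \<open>f\<close> and \<open>g\<close> with exponents in \<open>F\<close> and \<open>G\<close>
  does not cancel in \<open>f * g\<close>, provided that the other terms do not interfere.\<close>

lemma leading_term_of_product:
  fixes f g :: "('v::finite, 'k::field) mpoly"
  assumes F: "F \<subseteq> keys f" "F \<noteq> {}" and G: "G \<subseteq> keys g" "G \<noteq> {}"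
    and sep: "\<And>t0 s0 t s. t0 \<in> F \<Longrightarrow> s0 \<in> G \<Longrightarrow> t \<in> keys f \<Longrightarrow> s \<in> keys g \<Longrightarrow>
      t + s = t0 + s0 \<Longrightarrow> t \<in> F \<and> s \<in> G"
  shows "\<exists>t\<in>F. \<exists>s\<in>G. lookup (f * g) (t + s) \<noteq> 0"
proof -
  obtain \<omega> :: "('v \<Rightarrow>\<^sub>0 nat) \<Rightarrow> (nat \<Rightarrow>\<^sub>0 nat)" where \<omega>: "inj \<omega>" "\<And>s t. \<omega> (s + t) = \<omega> s + \<omega> t"
    using additive_order_embedding by blast
  have fin: "finite F" "finite G" using F G by (auto intro: finite_subset[OF _ finite_keys])
  have ex_max: "\<exists>t\<in>Z. \<forall>s\<in>Z. \<omega> s \<le> \<omega> t" if "finite Z" "Z \<noteq> {}" for Z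
  proof -
    have "Max (\<omega> ` Z) \<in> \<omega> ` Z" using that by (intro Max_in) auto
    then obtain t where "t \<in> Z" "Max (\<omega> ` Z) = \<omega> t" by blast
    then show ?thesis using that by (metis Max_ge finite_imageI image_eqI)
  qed
  obtain t0 where t0: "t0 \<in> F" "\<And>t. t \<in> F \<Longrightarrow> \<omega> t \<le> \<omega> t0" using ex_max[OF fin(1) F(2)] by blast
  obtain s0 where s0: "s0 \<in> G" "\<And>s. s \<in> G \<Longrightarrow> \<omega> s \<le> \<omega> s0" using ex_max[OF fin(2) G(2)] by blast
  let ?term = "\<lambda>t. lookup (single t (lookup f t) * g) (t0 + s0)"
  have other: "?term t = 0" if t: "t \<in> keys f" "t \<noteq> t0" for t
  proof (cases "\<exists>r. t0 + s0 = t + r")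
    case True
    then obtain r where r: "t0 + s0 = t + r" by blast
    have "lookup g r = 0"
    proof (rule ccontr)
      assume "lookup g r \<noteq> 0"
      then have "t \<in> F \<and> r \<in> G"
        using sep[OF t0(1) s0(1) t(1), of r] r by (simp add: in_keys_iff)
      then have le: "\<omega> t \<le> \<omega> t0" "\<omega> r \<le> \<omega> s0" using t0 s0 by auto
      have "\<omega> t + \<omega> r = \<omega> t0 + \<omega> s0" using r \<omega>(2) by metis
      then have "\<omega> t = \<omega> t0"
        using le add_less_le_mono[of "\<omega> t" "\<omega> t0" "\<omega> r" "\<omega> s0"] by (metis order_less_le)
      then show False using \<omega>(1) t(2) by (simp add: inj_eq)
    qed
    then show ?thesis by (simp add: r lookup_single_times_add)
  next
    case False
    then show ?thesis by (intro lookup_single_times_not) blast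
  qed
  have "f * g = (\<Sum>t\<in>keys f. single t (lookup f t)) * g"
    using poly_eq_sum_singles[of f] by simp
  then have "lookup (f * g) (t0 + s0) = (\<Sum>t\<in>keys f. ?term t)"
    by (simp only: sum_distrib_right lookup_sum)
  also have "\<dots> = ?term t0"
    using t0(1) F(1) other by (subst sum.remove[of _ t0]) (auto intro!: sum.neutral)
  also have "\<dots> \<noteq> 0"
    using t0(1) s0(1) F(1) G(1) by (simp add: lookup_single_times_add in_keys_iff subset_iff)
  finally show ?thesis using t0(1) s0(1) by blast
qed

lemma primeideal_of_type_algebra_iff:
  fixes P :: "'r::comm_ring_1 set"
  shows "primeideal P \<R> \<longleftrightarrow>
    ideal P \<R> \<and> 1 \<notin> P \<and> (\<forall>a b. a * b \<in> P \<longrightarrow> a \<in> P \<or> b \<in> P)"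
proof
  assume P: "primeideal P \<R>"
  then interpret primeideal P "\<R> :: 'r ring" .
  have "1 \<notin> P" using I_notcarr one_imp_carrier by auto
  then show "ideal P \<R> \<and> 1 \<notin> P \<and> (\<forall>a b. a * b \<in> P \<longrightarrow> a \<in> P \<or> b \<in> P)"
    using I_prime is_ideal by auto
next
  assume "ideal P \<R> \<and> 1 \<notin> P \<and> (\<forall>a b. a * b \<in> P \<longrightarrow> a \<in> P \<or> b \<in> P)"
  then show "primeideal P \<R>"
    by (intro primeidealI cring_of_type_algebra) auto
qed

text \<open>Terms outside the ideal have products outside the ideal, so the leading ones among them do
  not cancel.\<close>

lemma primeideal_meets:
  "primeideal (span_mon (meets V) :: ('v::finite, 'k::field) mpoly set) \<R>"
  unfolding primeideal_of_type_algebra_iff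
proof (intro conjI allI impI)
  show "ideal (span_mon (meets V) :: ('v, 'k) mpoly set) \<R>"
    by (rule ideal_span_mon[OF upset_meets])
  show "1 \<notin> (span_mon (meets V) :: ('v, 'k) mpoly set)" by (simp add: span_mon_def meets_def)
  fix a b :: "('v, 'k) mpoly" assume ab: "a * b \<in> span_mon (meets V)"
  show "a \<in> span_mon (meets V) \<or> b \<in> span_mon (meets V)"
  proof (rule ccontr)
    assume "\<not> ?thesis"
    then have "\<exists>t\<in>keys a - meets V. \<exists>s\<in>keys b - meets V.
        lookup (a * b) (t + s) \<noteq> 0"
    proof (intro leading_term_of_product)
      fix t0 s0 t s
      assume "t0 \<in> keys a - meets V" "s0 \<in> keys b - meets V"
        and ts: "t \<in> keys a" "s \<in> keys b" and eq: "t + s = t0 + s0"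
      then have "t0 + s0 \<notin> meets V" by (auto simp: meets_def lookup_add)
      then have "t + s \<notin> meets V" unfolding eq .
      then have "t \<notin> meets V" "s \<notin> meets V" by (auto simp: meets_def lookup_add)
      then show "t \<in> keys a - meets V \<and> s \<in> keys b - meets V"
        using ts by blast
    qed (auto simp: span_mon_def)
    then obtain t s where "t \<notin> meets V" "s \<notin> meets V" "t + s \<in> keys (a * b)"
      by (auto simp: in_keys_iff)
    then show False using ab by (auto simp: span_mon_def meets_def lookup_add)
  qed
qed

text \<open>A prime that contains a product of variables contains one of them.\<close>

lemma monomial_in_prime:
  fixes P :: "('v::finite, 'k::field) mpoly set"
  assumes P: "primeideal P \<R>" and t: "mon t \<in> P"
  shows "t \<in> meets {v. var_pow v 1 \<in> P}"
  using t
proof (induction "\<Sum>v\<in>UNIV. lookup t v" arbitrary: t rule: less_induct)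
  case less
  have "t \<noteq> 0" using less.prems P by (auto simp: primeideal_of_type_algebra_iff)
  then obtain v where v: "lookup t v \<noteq> 0"
    by (metis lookup_zero poly_mapping_eqI)
  define s where "s = t - single v 1"
  have t: "t = single v 1 + s"
    unfolding s_def by (rule monom_eq_single_add) (use v in simp)
  have "var_pow v 1 * mon s \<in> P" using less.prems by (simp add: t mult_single)
  then consider "var_pow v 1 \<in> P" | "mon s \<in> P" using P unfolding primeideal_of_type_algebra_iff by blast
  then show ?case
  proof cases
    case 1
    then show ?thesis using v unfolding meets_def by blast
  next
    case 2
    have "(\<Sum>w\<in>UNIV. lookup s w) < (\<Sum>w\<in>UNIV. lookup t w)"
      by (rule sum_strict_mono_ex1) (auto simp: t lookup_add intro: exI[of _ v])
    then have "s \<in> meets {v. var_pow v 1 \<in> P}" using 2 by (rule less.hyps)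
    then show ?thesis unfolding t using upset_meets by (metis add.commute upset_def)
  qed
qed

section \<open>Associated primes of monomial ideals\<close>

lemma associated_primes_cyclic:
  fixes I :: "'r::comm_ring_1 set"
  assumes I: "ideal I \<R>"
  shows "associated_primes \<R> (cyclic_module \<R> I) =
    {P. primeideal P \<R> \<and> (\<exists>f. P = {a. a * f \<in> I})}"
  unfolding associated_primes_def
  by (simp add: cyclic_module_simps[OF I] coset_eq_iff[OF I])

lemma upset_ideal_quotient:
  assumes "upset U" shows "upset {s. u + s \<in> U}"
  using assms by (auto simp: upset_def simp flip: add.assoc)

text \<open>Write \<open>P = (I : f)\<close> with the least number of terms in \<open>f\<close>. If a monomial killed some terms
  of \<open>f\<close> modulo \<open>I\<close> but not all, then, not being in \<open>P\<close>, it would multiply \<open>f\<close> to an element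
  with the same annihilator and, modulo \<open>I\<close>, fewer terms. So all terms \<open>u\<close> of \<open>f\<close> have the
  same monomials in their annihilators, and a comparison of leading terms shows \<open>P = (I :
  u)\<close>. A monomial prime is generated by variables.\<close>

lemma associated_prime_monomial:
  fixes P :: "('v::finite, 'k::field) mpoly set"
  assumes U: "upset U"
    and P: "P \<in> associated_primes \<R>
      (cyclic_module \<R> (span_mon U :: ('v, 'k) mpoly set))"
  shows "\<exists>u V. P = span_mon (meets V) \<and> (\<forall>v\<in>V. u + single v 1 \<in> U) \<and>
    (\<forall>t. t \<notin> meets V \<longrightarrow> u + t \<notin> U)"
proof -
  let ?I = "span_mon U :: ('v, 'k) mpoly set"
  have I: "ideal ?I \<R>" by (rule ideal_span_mon[OF U])
  have prime: "primeideal P \<R>" and ex: "\<exists>f. P = {a. a * f \<in> ?I}"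
    using P unfolding associated_primes_cyclic[OF I] by blast+
  have P1: "1 \<notin> P" and Pmult: "a * b \<in> P \<Longrightarrow> a \<in> P \<or> b \<in> P" for a b
    using prime unfolding primeideal_of_type_algebra_iff by blast+
  have Pid: "ideal P \<R>" using prime by (simp add: primeideal_def)
  have Ims: "b \<in> ?I \<Longrightarrow> a * b \<in> ?I" for a b using I unfolding ideal_of_type_algebra_iff by blast
  from ex_has_least_nat[of "\<lambda>f. P = {a. a * f \<in> ?I}" _ "\<lambda>f. card (keys f)"] ex
  obtain f where f: "P = {a. a * f \<in> ?I}"
    and least: "\<And>g. P = {a. a * g \<in> ?I} \<Longrightarrow> card (keys f) \<le> card (keys g)"
    by blast
  have same: "t' + s \<in> U" if t: "t \<in> keys f" "t' \<in> keys f" "t + s \<in> U" for t t' s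
  proof (rule ccontr)
    assume t's: "t' + s \<notin> U"
    let ?Z = "{t \<in> keys f. t + s \<notin> U}"
    define g where "g = (\<Sum>t\<in>?Z. single (t + s) (lookup f t))"
    have sf: "mon s * f = (\<Sum>t\<in>keys f. single (t + s) (lookup f t))"
    proof -
      have "mon s * f = mon s * (\<Sum>t\<in>keys f. single t (lookup f t))"
        using poly_eq_sum_singles[of f] by simp
      then show ?thesis by (simp add: sum_distrib_left mult_single add.commute)
    qed
    have "mon s * f - g = (\<Sum>t\<in>keys f - ?Z. single (t + s) (lookup f t))"
      unfolding sf g_def by (subst sum_diff) auto
    also have "\<dots> \<in> ?I" by (rule ideal_sum[OF I]) (auto simp: span_mon_def)
    finally have diff: "mon s * f - g \<in> ?I" .
    have "mon s \<notin> P"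
    proof
      assume "mon s \<in> P"
      then have "mon s * f \<in> ?I" using f by blast
      moreover have "s + t' \<in> keys (mon s * f)"
        using t(2) by (simp add: in_keys_iff lookup_single_times_add)
      ultimately show False using t's by (auto simp: span_mon_def add.commute)
    qed
    have "a * g \<in> ?I \<longleftrightarrow> a \<in> P" for a
    proof -
      have "a * (mon s * f - g) \<in> ?I" by (rule Ims[OF diff])
      moreover have "a * g = a * (mon s * f) - a * (mon s * f - g)" by (simp add: algebra_simps)
      moreover have "a * (mon s * f) = a * g + a * (mon s * f - g)" by (simp add: algebra_simps)
      ultimately have "a * g \<in> ?I \<longleftrightarrow> a * (mon s * f) \<in> ?I"
        using ideal_diff[OF I] I unfolding ideal_of_type_algebra_iff by metis
      also have "\<dots> \<longleftrightarrow> a * mon s \<in> P" unfolding f by (simp add: mult.assoc)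
      also have "\<dots> \<longleftrightarrow> a \<in> P"
        using Pmult \<open>mon s \<notin> P\<close> Pid unfolding ideal_of_type_algebra_iff by (metis mult.commute)
      finally show ?thesis .
    qed
    then have "card (keys f) \<le> card (keys g)" by (intro least) blast
    also have "\<dots> \<le> card ((\<lambda>t. t + s) ` ?Z)"
    proof (rule card_mono)
      have "keys g \<subseteq> (\<Union>t\<in>?Z. keys (single (t + s) (lookup f t)))"
        unfolding g_def by (rule keys_sum)
      then show "keys g \<subseteq> (\<lambda>t. t + s) ` ?Z" by (auto split: if_splits)
    qed simp
    also have "\<dots> \<le> card ?Z" by (rule card_image_le) simp
    also have "\<dots> < card (keys f)" using t by (intro psubset_card_mono) auto
    finally show False by simp
  qed
  have "f \<noteq> 0" using P1 f I by (auto simp: ideal_of_type_algebra_iff)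
  then obtain u where u: "u \<in> keys f"
    by (metis keys_eq_empty all_not_in_conv)
  define L where "L = {s. u + s \<in> U}"
  have L: "upset L" unfolding L_def by (rule upset_ideal_quotient[OF U])
  have L_all: "t + s \<in> U \<longleftrightarrow> s \<in> L" if "t \<in> keys f" for t s
    unfolding L_def using same u that by blast
  have "P = span_mon L"
  proof (intro equalityI subsetI)
    fix g :: "('v, 'k) mpoly" assume "g \<in> span_mon L"
    then have "\<exists>t s. k = t + s \<and> t \<in> keys f \<and> s \<in> L" if "k \<in> keys (f * g)" for k
      using keys_mult[of f g] that unfolding span_mon_def by blast
    then have "f * g \<in> ?I" using L_all unfolding span_mon_def by blast
    then show "g \<in> P" unfolding f by (simp add: mult.commute)
  next
    fix g :: "('v, 'k) mpoly" assume g: "g \<in> P"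
    show "g \<in> span_mon L"
    proof (rule ccontr)
      assume "g \<notin> span_mon L"
      then have "\<exists>t\<in>keys f. \<exists>s\<in>keys g - L. lookup (f * g) (t + s) \<noteq> 0"
      proof (intro leading_term_of_product)
        fix t0 s0 t s
        assume *: "t0 \<in> keys f" "s0 \<in> keys g - L"
          "t \<in> keys f" "s \<in> keys g" and eq: "t + s = t0 + s0"
        have "s \<notin> L" using L_all[OF *(3), of s] L_all[OF *(1), of s0] *(2) eq by auto
        then show "t \<in> keys f \<and> s \<in> keys g - L" using * by blast
      qed (use u in \<open>auto simp: span_mon_def\<close>)
      then obtain t s where "t \<in> keys f" "s \<notin> L" "t + s \<in> keys (f * g)"
        by (auto simp: in_keys_iff)
      moreover have "f * g \<in> ?I" using g unfolding f by (simp add: mult.commute)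
      ultimately show False using L_all by (auto simp: span_mon_def)
    qed
  qed
  define V where "V = {v. var_pow v 1 \<in> P}"
  have V: "V = {v. single v 1 \<in> L}" unfolding V_def \<open>P = span_mon L\<close> by simp
  have "L = meets V"
  proof (intro equalityI subsetI)
    fix t assume "t \<in> L"
    then have "mon t \<in> P" unfolding \<open>P = span_mon L\<close> by simp
    then show "t \<in> meets V" unfolding V_def by (rule monomial_in_prime[OF prime])
  next
    fix t assume "t \<in> meets V"
    then obtain v where v: "single v 1 \<in> L" "lookup t v \<noteq> 0"
      unfolding meets_def V by blast
    have "t = single v 1 + (t - single v 1)"
      by (rule monom_eq_single_add) (use v in simp)
    then show "t \<in> L" using L v(1) unfolding upset_def by metis
  qed
  show ?thesis
  proof (intro exI conjI ballI allI impI)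
    show "P = span_mon (meets V)" using \<open>P = span_mon L\<close> \<open>L = meets V\<close> by simp
    show "u + single v 1 \<in> U" if "v \<in> V" for v
      using that unfolding V L_def by simp
    show "u + t \<notin> U" if "t \<notin> meets V" for t
      using that unfolding \<open>L = meets V\<close>[symmetric] L_def by simp
  qed
qed

text \<open>The minimal primes are associated. Let \<open>V\<close> be a minimal set of variables in \<open>P\<close> whose ideal
  contains \<open>I\<close>. Then \<open>I\<close> contains, for each \<open>v \<in> V\<close>, a monomial in \<open>v\<close> and variables outside
  \<open>V\<close>. This bounds the degree of the monomials in the variables of \<open>V\<close> that remain outside
  \<open>I\<close> when multiplied by arbitrary monomials in the other variables. One of largest degree,
  times a suitable monomial in the other variables, has annihilator \<open>(V)\<close>.\<close>

lemma associated_prime_below: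
  fixes P :: "('v::finite, 'k::field) mpoly set"
  assumes U: "upset U" and prime: "primeideal P \<R>" and IP: "span_mon U \<subseteq> P"
  obtains V where "span_mon (meets V) \<subseteq> P"
    "span_mon (meets V) \<in> associated_primes \<R>
      (cyclic_module \<R> (span_mon U :: ('v, 'k) mpoly set))"
proof -
  let ?I = "span_mon U :: ('v, 'k) mpoly set"
  have I: "ideal ?I \<R>" by (rule ideal_span_mon[OF U])
  let ?VP = "{v. var_pow v 1 \<in> P}"
  have V0: "?VP \<subseteq> ?VP \<and> U \<subseteq> meets ?VP"
    using monomial_in_prime[OF prime] IP by (meson mon_in_span_mon subset_iff)
  have "\<exists>V. (V \<subseteq> ?VP \<and> U \<subseteq> meets V) \<and>
      (\<forall>V'. V' \<subseteq> ?VP \<and> U \<subseteq> meets V' \<longrightarrow> card V \<le> card V')"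
    by (rule ex_has_least_nat[of "\<lambda>V. V \<subseteq> ?VP \<and> U \<subseteq> meets V" ?VP card, OF V0])
  then obtain V where V: "V \<subseteq> ?VP" "U \<subseteq> meets V"
    and least: "\<forall>V'. V' \<subseteq> ?VP \<and> U \<subseteq> meets V' \<longrightarrow> card V \<le> card V'"
    by (elim exE conjE)
  have "\<forall>v\<in>V. \<exists>g. g \<in> U \<and> g \<notin> meets (V - {v})"
  proof
    fix v assume v: "v \<in> V"
    have "card (V - {v}) < card V" using v by (intro psubset_card_mono) auto
    then have "\<not> U \<subseteq> meets (V - {v})" using least[rule_format, of "V - {v}"] V(1) by fastforce
    then show "\<exists>g. g \<in> U \<and> g \<notin> meets (V - {v})" by blast
  qed
  from bchoice[OF this] obtain g where g: "\<And>v. v \<in> V \<Longrightarrow> g v \<in> U \<and> g v \<notin> meets (V - {v})" by blast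
  let ?Q = "\<lambda>u. keys u \<subseteq> V \<and> (\<forall>t. t \<notin> meets V \<longrightarrow> u + t \<notin> U)"
  let ?deg = "\<lambda>u. \<Sum>v\<in>V. lookup u v"
  have Q0: "?Q 0" using V(2) by auto
  have bound: "?deg u < Suc (\<Sum>v\<in>V. lookup (g v) v)" if u: "?Q u" for u
  proof -
    have "lookup u v \<le> lookup (g v) v" if v: "v \<in> V" for v
    proof (rule ccontr)
      assume "\<not> ?thesis"
      then have ge: "lookup (g v) v \<le> lookup u v" by simp
      define t where "t = (\<Sum>w\<in>- V. single w (lookup (g v) w))"
      have "t \<notin> meets V" by (auto simp: t_def meets_def lookup_sum_single)
      moreover have "u + t = g v + (u + t - g v)"
      proof (rule monom_le_imp_add)
        fix w
        have "lookup (g v) w = 0" if "w \<in> V" "w \<noteq> v"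
          using g[OF v] that by (auto simp: meets_def)
        then show "lookup (g v) w \<le> lookup (u + t) w"
          using ge by (cases "w \<in> V"; cases "w = v") (auto simp: t_def lookup_add lookup_sum_single)
      qed
      then have "u + t \<in> U" using U g[OF v] unfolding upset_def by metis
      ultimately show False using u by blast
    qed
    then have "?deg u \<le> (\<Sum>v\<in>V. lookup (g v) v)" by (intro sum_mono)
    then show ?thesis by simp
  qed
  have "\<exists>u. ?Q u \<and> (\<forall>u'. ?Q u' \<longrightarrow> ?deg u' \<le> ?deg u)"
    by (rule ex_has_greatest_nat[of ?Q 0 ?deg, OF Q0]) (use bound in blast)
  then obtain u where u: "?Q u" and max: "\<And>u'. ?Q u' \<Longrightarrow> ?deg u' \<le> ?deg u" by blast
  have "\<forall>v\<in>V. \<exists>t. t \<notin> meets V \<and> u + single v 1 + t \<in> U"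
  proof
    fix v assume v: "v \<in> V"
    have "?deg u < ?deg (u + single v 1)"
      using v by (intro sum_strict_mono_ex1) (auto simp: lookup_add intro!: bexI[of _ v])
    then have "\<not> ?Q (u + single v 1)" using max by (meson not_less)
    moreover have "keys (u + single v 1) \<subseteq> V"
      using u v keys_add[of u "single v 1"] by auto
    ultimately show "\<exists>t. t \<notin> meets V \<and> u + single v 1 + t \<in> U" by blast
  qed
  from bchoice[OF this] obtain t where
    t: "\<And>v. v \<in> V \<Longrightarrow> t v \<notin> meets V \<and> u + single v 1 + t v \<in> U" by blast
  define T where "T = (\<Sum>v\<in>V. t v)"
  have T: "T \<notin> meets V"
    using t by (auto simp: T_def meets_def lookup_sum)
  define w where "w = u + T"
  have wU: "w + single v 1 \<in> U" if v: "v \<in> V" for v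
  proof -
    have "T = t v + (\<Sum>v\<in>V - {v}. t v)" unfolding T_def using v by (intro sum.remove) auto
    then have "w + single v 1 = u + single v 1 + t v + (\<Sum>v\<in>V - {v}. t v)"
      by (simp add: w_def ac_simps)
    then show ?thesis using t[OF v] U unfolding upset_def by metis
  qed
  have wfree: "w + s \<notin> U" if s: "s \<notin> meets V" for s
  proof -
    have "T + s \<notin> meets V" using T s by (auto simp: meets_def lookup_add)
    then show ?thesis using u by (simp add: w_def add.assoc)
  qed
  have "span_mon (meets V) = {a. a * mon w \<in> ?I}"
  proof (intro equalityI subsetI CollectI)
    fix a :: "('v, 'k) mpoly" assume a: "a \<in> span_mon (meets V)"
    have "s + w \<in> U" if "s \<in> keys a" for s
    proof -
      have "s \<in> meets V" using a that by (auto simp: span_mon_def)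
      then obtain v where v: "v \<in> V" "lookup s v \<noteq> 0" unfolding meets_def by blast
      have "s = single v 1 + (s - single v 1)"
        by (rule monom_eq_single_add) (use v in simp)
      then have "s + w = w + single v 1 + (s - single v 1)"
        by (metis add.assoc add.commute)
      then show ?thesis using wU[OF v(1)] U unfolding upset_def by metis
    qed
    then show "a * mon w \<in> ?I"
      using keys_mult[of a "mon w"] unfolding span_mon_def by auto
  next
    fix a :: "('v, 'k) mpoly" assume "a \<in> {a. a * mon w \<in> ?I}"
    then have a: "mon w * a \<in> ?I" by (simp add: mult.commute)
    have "s \<in> meets V" if "s \<in> keys a" for s
    proof (rule ccontr)
      assume "s \<notin> meets V"
      then have "w + s \<notin> U" by (rule wfree)
      moreover have "w + s \<in> keys (mon w * a)"
        using that by (simp add: in_keys_iff lookup_single_times_add)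
      ultimately show False using a by (auto simp: span_mon_def)
    qed
    then show "a \<in> span_mon (meets V)" by (auto simp: span_mon_def)
  qed
  then have "span_mon (meets V) \<in> associated_primes \<R>
      (cyclic_module \<R> ?I)"
    unfolding associated_primes_cyclic[OF I] using primeideal_meets by blast
  moreover have "span_mon (meets V) \<subseteq> P"
  proof (rule span_mon_subset_ideal)
    show Pid: "ideal P \<R>" using prime by (simp add: primeideal_def)
    fix t assume "t \<in> meets V"
    then obtain v where v: "var_pow v 1 \<in> P" "lookup t v \<noteq> 0"
      using V(1) unfolding meets_def by blast
    have "t = (t - single v 1) + single v 1"
      using monom_eq_single_add[of 1 t v] v(2) by (simp add: add.commute)
    then have "mon t = mon (t - single v 1) * (var_pow v 1 :: ('v, 'k) mpoly)"
      by (simp add: mult_single)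
    then show "mon t \<in> P" using Pid v(1) unfolding ideal_of_type_algebra_iff by metis
  qed
  ultimately show ?thesis using that by blast
qed

section \<open>Dimension\<close>

text \<open>Prime ideals of the quotient ring correspond to the primes that contain the ideal, and the
  correspondence preserves strict inclusions.\<close>

lemma krull_dim_quotient:
  fixes J :: "'r::comm_ring_1 set"
  assumes J: "ideal J \<R>"
  shows "krull_dim (\<R> Quot J) =
    Sup {enat n | n. \<exists>C :: nat \<Rightarrow> 'r set.
      (\<forall>i\<le>n. primeideal (C i) \<R> \<and> J \<subseteq> C i) \<and> (\<forall>i<n. C i \<subset> C (Suc i))}"
proof -
  let ?R = "\<R> :: 'r ring"
  let ?Q = "?R Quot J"
  interpret R: cring ?R by (rule cring_of_type_algebra)
  interpret J: ideal J ?R by (rule J)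
  interpret hom: ring_hom_ring ?R ?Q "(+>\<^bsub>?R\<^esub>) J" by (rule J.rcos_ring_hom_ring)
  have cos: "J +>\<^bsub>?R\<^esub> r = coset J r" for r by (auto simp: a_r_coset_def' coset_def)
  have carr: "carrier ?Q = range (coset J)" by (auto simp: FactRing_def A_RCOSETS_def' cos)
  have mult: "coset J a \<otimes>\<^bsub>?Q\<^esub> coset J b = coset J (a * b)" for a b
    using hom.hom_mult[of a b] by (simp add: cos)
  let ?down = "\<lambda>P. {r. coset J r \<in> P}"
  have down: "primeideal (?down P) ?R \<and> J \<subseteq> ?down P" if P: "primeideal P ?Q" for P
  proof
    show "primeideal (?down P) ?R"
      using hom.primeideal_vimage[OF R.cring_axioms P] by (simp add: cos)
    have "\<zero>\<^bsub>?Q\<^esub> \<in> P"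
      using P by (simp add: primeideal_def ideal_def additive_subgroup.zero_closed)
    then have "coset J 0 \<in> P" using hom.hom_zero by (simp add: cos)
    moreover have "coset J r = coset J 0" if "r \<in> J" for r using that by (simp add: coset_eq_iff[OF J])
    ultimately show "J \<subseteq> ?down P" by auto
  qed
  have up: "primeideal (coset J ` P) ?Q" if P: "primeideal P ?R" "J \<subseteq> P" for P
  proof -
    have mem: "coset J a \<in> coset J ` P \<longleftrightarrow> a \<in> P" for a
    proof
      assume "coset J a \<in> coset J ` P"
      then obtain b where "b \<in> P" "a - b \<in> J" by (auto simp: coset_eq_iff[OF J])
      moreover have "a = (a - b) + b" by simp
      ultimately show "a \<in> P"
        using P unfolding primeideal_def ideal_of_type_algebra_iff by (metis subsetD)
    qed simp
    have "ideal P ?R" using P(1) by (simp add: primeideal_def)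
    then have id: "ideal (coset J ` P) ?Q"
      using R.ring_ideal_imp_quot_ideal[OF J, of P] by (simp add: cos)
    show ?thesis
    proof (rule primeidealI[OF id J.quotient_is_cring[OF R.cring_axioms]])
      have "1 \<notin> P" using P(1) by (simp add: primeideal_of_type_algebra_iff)
      then have "coset J 1 \<notin> coset J ` P" by (simp add: mem)
      then show "carrier ?Q \<noteq> coset J ` P" by (auto simp: carr)
    next
      fix a b assume "a \<in> carrier ?Q" "b \<in> carrier ?Q" and ab: "a \<otimes>\<^bsub>?Q\<^esub> b \<in> coset J ` P"
      then obtain f g where fg: "a = coset J f" "b = coset J g" unfolding carr by blast
      then have "f * g \<in> P" using ab by (simp add: mult mem)
      then have "f \<in> P \<or> g \<in> P" using P(1) by (simp add: primeideal_of_type_algebra_iff)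
      then show "a \<in> coset J ` P \<or> b \<in> coset J ` P" by (simp add: fg mem)
    qed
  qed
  have "(\<exists>C. (\<forall>i\<le>n. primeideal (C i) ?Q) \<and> (\<forall>i<n. C i \<subset> C (Suc i))) \<longleftrightarrow>
      (\<exists>C. (\<forall>i\<le>n. primeideal (C i) ?R \<and> J \<subseteq> C i) \<and> (\<forall>i<n. C i \<subset> C (Suc i)))" for n
  proof
    assume "\<exists>C. (\<forall>i\<le>n. primeideal (C i) ?Q) \<and> (\<forall>i<n. C i \<subset> C (Suc i))"
    then obtain C where C: "\<forall>i\<le>n. primeideal (C i) ?Q" "\<forall>i<n. C i \<subset> C (Suc i)" by blast
    have sub: "C i \<subseteq> range (coset J)" if "i \<le> n" for i
    proof -
      have "additive_subgroup (C i) ?Q" using C(1) that by (simp add: primeideal_def ideal_def)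
      then show ?thesis using additive_subgroup.a_subset carr by blast
    qed
    have "?down (C i) \<subset> ?down (C (Suc i))" if "i < n" for i
      using C(2) that sub[of "Suc i"] by (auto simp: psubset_eq) 
    then show "\<exists>C. (\<forall>i\<le>n. primeideal (C i) ?R \<and> J \<subseteq> C i) \<and> (\<forall>i<n. C i \<subset> C (Suc i))"
      using C(1) down by (intro exI[of _ "\<lambda>i. ?down (C i)"]) blast
  next
    assume "\<exists>C. (\<forall>i\<le>n. primeideal (C i) ?R \<and> J \<subseteq> C i) \<and> (\<forall>i<n. C i \<subset> C (Suc i))"
    then obtain C where C: "\<forall>i\<le>n. primeideal (C i) ?R \<and> J \<subseteq> C i" "\<forall>i<n. C i \<subset> C (Suc i)" by blast
    have "coset J ` C i \<subset> coset J ` C (Suc i)" if i: "i < n" for i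
    proof -
      obtain a where a: "a \<in> C (Suc i)" "a \<notin> C i" using C(2) i by blast
      have "coset J a \<notin> coset J ` C i"
      proof
        assume "coset J a \<in> coset J ` C i"
        then obtain b where "b \<in> C i" "a - b \<in> J" by (auto simp: coset_eq_iff[OF J])
        moreover have "a = (a - b) + b" by simp
        moreover have "ideal (C i) ?R" "J \<subseteq> C i" using C(1) i by (auto simp: primeideal_def)
        ultimately have "a \<in> C i" unfolding ideal_of_type_algebra_iff by (metis subsetD)
        then show False using a by simp
      qed
      then show ?thesis using a C(2) i by blast
    qed
    moreover have "primeideal (coset J ` C i) ?Q" if "i \<le> n" for i
      using C(1) that up[of "C i"] by blast
    ultimately show "\<exists>C. (\<forall>i\<le>n. primeideal (C i) ?Q) \<and> (\<forall>i<n. C i \<subset> C (Suc i))"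
      by (intro exI[of _ "\<lambda>i. coset J ` C i"] conjI allI impI)
  qed
  then show ?thesis unfolding krull_dim_def by simp
qed

text \<open>A chain of primes over \<open>J\<close> is a chain over any ideal contained in its first member.\<close>

lemma krull_dim_quotient_le:
  fixes J J' :: "'r::comm_ring_1 set"
  assumes J: "ideal J \<R>"
    and J': "\<And>P. primeideal P \<R> \<Longrightarrow> J \<subseteq> P \<Longrightarrow>
      \<exists>J'. ideal J' \<R> \<and> J' \<subseteq> P \<and> krull_dim (\<R> Quot J') \<le> N"
  shows "krull_dim (\<R> Quot J) \<le> N"
  unfolding krull_dim_quotient[OF J]
proof (rule Sup_least, clarify)
  fix n and C :: "nat \<Rightarrow> 'r set"
  assume C: "\<forall>i\<le>n. primeideal (C i) \<R> \<and> J \<subseteq> C i" "\<forall>i<n. C i \<subset> C (Suc i)"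
  obtain J' where J': "ideal J' \<R>" "J' \<subseteq> C 0"
    "krull_dim (\<R> Quot J') \<le> N"
    using assms(2)[of "C 0"] C(1) by blast
  have "C 0 \<subseteq> C i" if "i \<le> n" for i
    using that
  proof (induction i)
    case (Suc i)
    then show ?case using C(2) by (meson Suc_leD Suc_le_lessD order.trans psubset_imp_subset)
  qed simp
  then have "\<forall>i\<le>n. primeideal (C i) \<R> \<and> J' \<subseteq> C i" using C(1) J'(2) by blast
  then have "enat n \<le> krull_dim (\<R> Quot J')"
    unfolding krull_dim_quotient[OF J'(1)] using C(2) by (intro Sup_upper) blast
  then show "enat n \<le> N" using J'(3) by (rule order_trans)
qed

text \<open>Renaming variables is an automorphism of the polynomial ring, so the dimension modulo an
  ideal of variables depends only on their number.\<close>

lemma krull_dim_vars_le: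
  fixes V V' :: "'v::finite set"
  assumes card: "card V = card V'"
  shows "krull_dim (\<R> Quot (span_mon (meets V') :: ('v, 'k::field) mpoly set)) \<le>
    krull_dim (\<R> Quot (span_mon (meets V) :: ('v, 'k) mpoly set))"
proof -
  obtain f g where f: "bij_betw f V V'" and g: "bij_betw g (- V) (- V')"
  proof -
    have "card (- V) = card (- V')" using card by (simp add: Compl_eq_Diff_UNIV card_Diff_subset)
    then show ?thesis using that finite_same_card_bij[of V V'] finite_same_card_bij[of "- V" "- V'"] card
      by auto
  qed
  define \<pi> where "\<pi> v = (if v \<in> V then f v else g v)" for v
  have im: "\<pi> ` V = V'" using f by (auto simp: \<pi>_def bij_betw_def)
  have "bij_betw \<pi> (V \<union> - V) (V' \<union> - V')"
    using f g by (intro bij_betw_combine)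
      (auto simp: \<pi>_def intro: bij_betw_cong[THEN iffD1, rotated])
  then have bij: "bij \<pi>" by simp
  define \<tau> :: "('v \<Rightarrow>\<^sub>0 nat) \<Rightarrow> 'v \<Rightarrow>\<^sub>0 nat" where "\<tau> = Poly_Mapping.map_key \<pi>"
  have \<tau>: "lookup (\<tau> t) v = lookup t (\<pi> v)" for t v
    using bij_is_inj[OF bij] by (simp add: \<tau>_def Poly_Mapping.map_key.rep_eq)
  have inj_\<tau>: "inj \<tau>"
  proof (intro injI poly_mapping_eqI)
    fix s t v assume "\<tau> s = \<tau> t"
    then have "lookup s (\<pi> (inv_into UNIV \<pi> v)) = lookup t (\<pi> (inv_into UNIV \<pi> v))"
      by (metis \<tau>)
    then show "lookup s v = lookup t v"
      using bij by (simp add: surj_f_inv_f bij_is_surj)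
  qed
  have surj_\<tau>: "\<exists>s. t = \<tau> s" for t
  proof -
    let ?s = "Poly_Mapping.map_key (inv_into UNIV \<pi>) t"
    have "lookup ?s v = lookup t (inv_into UNIV \<pi> v)" for v
      using bij_is_inj[OF bij_imp_bij_inv[OF bij]] by (simp add: Poly_Mapping.map_key.rep_eq)
    then have "\<tau> ?s = t" using bij by (intro poly_mapping_eqI) (simp add: \<tau> bij_is_inj)
    then show ?thesis by metis
  qed
  have \<tau>_add: "\<tau> (s + t) = \<tau> s + \<tau> t" for s t
    by (intro poly_mapping_eqI) (simp add: \<tau> lookup_add)
  define \<Psi> :: "('v, 'k) mpoly \<Rightarrow> ('v, 'k) mpoly" where "\<Psi> = Poly_Mapping.map_key \<tau>"
  have \<Psi>: "lookup (\<Psi> f) t = lookup f (\<tau> t)" for f t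
    using inj_\<tau> by (simp add: \<Psi>_def Poly_Mapping.map_key.rep_eq)
  have \<Psi>_add: "\<Psi> (f + g) = \<Psi> f + \<Psi> g" for f g
    by (intro poly_mapping_eqI) (simp add: \<Psi> lookup_add)
  have \<Psi>_0: "\<Psi> 0 = 0" by (intro poly_mapping_eqI) (simp add: \<Psi>)
  have \<Psi>_single: "\<Psi> (single (\<tau> t) c) = single t c" for t c
    by (intro poly_mapping_eqI) (simp add: \<Psi> lookup_single inj_eq[OF inj_\<tau>])
  have \<Psi>_mult: "\<Psi> (f * g) = \<Psi> f * \<Psi> g" for f g
  proof (induction f rule: poly_induct)
    case (single t c)
    obtain t' where t': "t = \<tau> t'" using surj_\<tau> by blast
    show ?case
    proof (induction g rule: poly_induct)
      case (single s b)
      obtain s' where s': "s = \<tau> s'" using surj_\<tau> by blast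
      show ?case by (simp add: t' s' mult_single \<Psi>_single flip: \<tau>_add)
    qed (simp_all add: \<Psi>_0 \<Psi>_add distrib_left)
  qed (simp_all add: \<Psi>_0 \<Psi>_add distrib_right)
  have \<Psi>_1: "\<Psi> 1 = 1"
  proof -
    have "\<tau> 0 = 0" by (intro poly_mapping_eqI) (simp add: \<tau>)
    then show ?thesis using \<Psi>_single[of 0 1] by simp
  qed
  have surj_\<Psi>: "\<exists>f. g = \<Psi> f" for g
  proof (induction g rule: poly_induct)
    case zero
    then show ?case using \<Psi>_0 by metis
  next
    case (single t c)
    then show ?case using \<Psi>_single by metis
  next
    case (add f g)
    then show ?case using \<Psi>_add by metis
  qed
  let ?R = "\<R> :: ('v, 'k) mpoly ring"
  let ?J = "span_mon (meets V) :: ('v, 'k) mpoly set" and ?J' = "span_mon (meets V') :: ('v, 'k) mpoly set"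
  have J: "ideal ?J ?R" "ideal ?J' ?R" by (simp_all add: ideal_span_mon upset_meets)
  have pre_prime: "primeideal {f. \<Psi> f \<in> P} ?R" if P: "primeideal P ?R" for P
    using P unfolding primeideal_of_type_algebra_iff ideal_of_type_algebra_iff
    by (simp add: \<Psi>_0 \<Psi>_1 \<Psi>_add \<Psi>_mult)
  have J_sub: "\<Psi> f \<in> ?J'" if f: "f \<in> ?J" for f
  proof -
    have "t \<in> meets V'" if "t \<in> keys (\<Psi> f)" for t
    proof -
      have "\<tau> t \<in> keys f" using that by (simp add: in_keys_iff \<Psi>)
      then have "\<tau> t \<in> meets V" using f by (auto simp: span_mon_def)
      then show ?thesis unfolding im[symmetric] by (auto simp: meets_def \<tau>)
    qed
    then show ?thesis by (auto simp: span_mon_def)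
  qed
  show ?thesis
    unfolding krull_dim_quotient[OF J(1)] krull_dim_quotient[OF J(2)]
  proof (rule Sup_subset_mono, clarify)
    fix n and C :: "nat \<Rightarrow> ('v, 'k) mpoly set"
    assume C: "\<forall>i\<le>n. primeideal (C i) ?R \<and> ?J' \<subseteq> C i" "\<forall>i<n. C i \<subset> C (Suc i)"
    have "{f. \<Psi> f \<in> C i} \<subset> {f. \<Psi> f \<in> C (Suc i)}" if i: "i < n" for i
    proof -
      obtain h where h: "h \<in> C (Suc i)" "h \<notin> C i" using C(2) i by blast
      obtain h' where "h = \<Psi> h'" using surj_\<Psi> by blast
      then show ?thesis using h C(2) i by blast
    qed
    then show "\<exists>n'. enat n = enat n' \<and> (\<exists>C. (\<forall>i\<le>n'. primeideal (C i) ?R \<and> ?J \<subseteq> C i) \<and> (\<forall>i<n'. C i \<subset> C (Suc i)))"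
      using C(1) pre_prime J_sub
      by (intro exI[of _ n] conjI refl exI[of _ "\<lambda>i. {f. \<Psi> f \<in> C i}"]) blast+
  qed
qed

section \<open>Relative Cohen--Macaulay and relative unmixed monomial quotients\<close>

lemma annihilator_cyclic_module:
  fixes I :: "'r::comm_ring_1 set"
  assumes I: "ideal I \<R>"
  shows "annihilator \<R> (cyclic_module \<R> I) = I"
proof -
  have "(\<forall>f. a * f \<in> I) \<longleftrightarrow> a \<in> I" for a
    using I unfolding ideal_of_type_algebra_iff by (metis mult.commute mult_1)
  then show ?thesis
    unfolding annihilator_def by (simp add: cyclic_module_simps[OF I] coset_eq_iff[OF I])
qed

text \<open>The dimension modulo \<open>I\<close> is attained modulo associated primes, because every prime over \<open>I\<close>
  contains one.\<close>

lemma unmixed_monomial: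
  fixes U :: "('v::finite \<Rightarrow>\<^sub>0 nat) set"
  assumes U: "upset U"
    and card: "\<And>V. span_mon (meets V) \<in> associated_primes \<R>
      (cyclic_module \<R> (span_mon U :: ('v, 'k::field) mpoly set)) \<Longrightarrow> card V = c"
  shows "unmixed \<R> (cyclic_module \<R> (span_mon U :: ('v, 'k) mpoly set))"
  unfolding unmixed_def
proof
  let ?R = "\<R> :: ('v, 'k) mpoly ring"
  let ?I = "span_mon U :: ('v, 'k) mpoly set"
  have I: "ideal ?I ?R" by (rule ideal_span_mon[OF U])
  have id: "ideal (span_mon (meets V) :: ('v, 'k) mpoly set) ?R" for V
    by (rule ideal_span_mon[OF upset_meets])
  fix P assume P: "P \<in> associated_primes ?R (cyclic_module ?R ?I)"
  obtain V where V: "P = span_mon (meets V)"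
    using associated_prime_monomial[OF U P] by blast
  have IP: "?I \<subseteq> P"
  proof
    fix a assume "a \<in> ?I"
    then have "a * f \<in> ?I" for f using I unfolding ideal_of_type_algebra_iff by (metis mult.commute)
    then show "a \<in> P" using P unfolding associated_primes_cyclic[OF I] by blast
  qed
  have "krull_dim (?R Quot P) = krull_dim (?R Quot ?I)"
  proof (rule antisym)
    show "krull_dim (?R Quot P) \<le> krull_dim (?R Quot ?I)"
      by (rule krull_dim_quotient_le) (use V id I IP in blast)+
    show "krull_dim (?R Quot ?I) \<le> krull_dim (?R Quot P)"
    proof (rule krull_dim_quotient_le[OF I])
      fix P' assume P': "primeideal P' ?R" "?I \<subseteq> P'"
      obtain V' where V': "span_mon (meets V') \<subseteq> P'"
        "span_mon (meets V') \<in> associated_primes ?R (cyclic_module ?R ?I)"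
        using associated_prime_below[OF U P'] by blast
      have "card V = card V'" using card[OF V'(2)] card P V by simp
      then have "krull_dim (?R Quot span_mon (meets V')) \<le> krull_dim (?R Quot P)"
        unfolding V by (rule krull_dim_vars_le)
      then show "\<exists>J'. ideal J' ?R \<and> J' \<subseteq> P' \<and> krull_dim (?R Quot J') \<le> krull_dim (?R Quot P)"
        using V'(1) id by blast
    qed
  qed
  moreover have "ideal P ?R" unfolding V by (rule id)
  ultimately show "module_dim ?R (cyclic_module ?R P) = module_dim ?R (cyclic_module ?R ?I)"
    by (simp add: module_dim_def annihilator_cyclic_module I)
qed

lemma cohomological_dim_vars:
  "cohomological_dim \<R> (span_mon (meets W))
    (cyclic_module \<R> (span_mon (meets V) :: ('v::finite, 'k::field) mpoly set)) = card (W - V)"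
proof -
  let ?M = "cyclic_module \<R> (span_mon (meets V) :: ('v, 'k) mpoly set)"
  let ?H = "\<lambda>i. local_cohomology \<R> (span_mon (meets W)) i ?M"
  have "\<not> zero_module (?H (card (W - V)))"
  proof (rule local_cohomology_nonzero[OF upset_meets, where u = 0])
    show "0 + single v 1 \<in> meets V" if "v \<in> V \<inter> W" for v
      using that by (auto simp: meets_def intro!: bexI[of _ v])
    show "0 + t \<notin> meets V" if "keys t \<subseteq> W - V" for t
      using that by (auto simp: meets_def in_keys_iff)
  qed
  moreover have "zero_module (?H i)" if "card (W - V) < i" for i
  proof (rule local_cohomology_vanishes[OF ideal_span_mon[OF upset_meets] _ that])
    show "\<exists>k. var_pow v k \<in> (span_mon (meets V) :: ('v, 'k) mpoly set)" if "v \<in> V" for v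
      using that by (auto simp: meets_def intro!: exI[of _ 1] bexI[of _ v])
  qed
  ultimately show ?thesis
    unfolding cohomological_dim_def by (intro Greatest_equality) (blast, metis not_less)
qed

text \<open>The degree \<open>card (W - V)\<close>, in which the local cohomology is not zero, lies between the
  grade and the cohomological dimension.\<close>

lemma relative_Cohen_Macaulay_associated_prime:
  fixes U :: "('v::finite \<Rightarrow>\<^sub>0 nat) set"
  assumes U: "upset U"
    and CM: "relative_Cohen_Macaulay \<R> (span_mon (meets W))
      (cyclic_module \<R> (span_mon U :: ('v, 'k::field) mpoly set))"
    and u: "\<forall>v\<in>V. u + single v 1 \<in> U" "\<forall>t. t \<notin> meets V \<longrightarrow> u + t \<notin> U"
  shows "cohomological_dim \<R> (span_mon (meets W))
    (cyclic_module \<R> (span_mon U :: ('v, 'k) mpoly set)) = card (W - V)"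
proof -
  let ?M = "cyclic_module \<R> (span_mon U :: ('v, 'k) mpoly set)"
  let ?J = "span_mon (meets W) :: ('v, 'k) mpoly set"
  have nz: "\<not> zero_module (local_cohomology \<R> ?J (card (W - V)) ?M)"
  proof (rule local_cohomology_nonzero[OF U, where u = u])
    show "u + t \<notin> U" if "keys t \<subseteq> W - V" for t
      by (rule u(2)[rule_format]) (use that in \<open>auto simp: meets_def in_keys_iff\<close>)
  qed (use u(1) in auto)
  have "grade \<R> ?J ?M \<le> card (W - V)"
    unfolding grade_def using nz by (rule Least_le)
  moreover have "card (W - V) \<le> cohomological_dim \<R> ?J ?M"
    unfolding cohomological_dim_def
  proof (rule Greatest_le_nat[of "\<lambda>i. \<not> zero_module (local_cohomology \<R> ?J i ?M)", OF nz])
    fix i assume "\<not> zero_module (local_cohomology \<R> ?J i ?M)"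
    then show "i \<le> card W"
      using local_cohomology_vanishes[OF ideal_span_mon[OF U], of "{}" W i]
      by (metis Diff_empty empty_iff not_less)
  qed
  ultimately show ?thesis using CM unfolding relative_Cohen_Macaulay_def by simp
qed

lemma ideal_P_eq: "ideal_P = (span_mon (meets (range Inl)) :: ('m::finite, 'n::finite, 'k::field) bipoly set)"
proof -
  have "range x_var = (\<lambda>v. mon (single v 1) :: ('m, 'n, 'k) bipoly) ` range Inl"
    by (auto simp: x_var_def monomial_def image_image)
  then show ?thesis by (simp only: ideal_P_def genideal_vars)
qed

lemma ideal_Q_eq: "ideal_Q = (span_mon (meets (range Inr)) :: ('m::finite, 'n::finite, 'k::field) bipoly set)"
proof -
  have "range y_var = (\<lambda>v. mon (single v 1) :: ('m, 'n, 'k) bipoly) ` range Inr"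
    by (auto simp: y_var_def monomial_def image_image)
  then show ?thesis by (simp only: ideal_Q_def genideal_vars)
qed

theorem proposition1p20:
  fixes I :: "('m::finite, 'n::finite, 'k::field) bipoly set"
    and p q :: nat
  assumes infinite_field: "infinite (UNIV :: 'k set)"
    and monomial: "monomial_ideal I"
    and nonzero: "I \<noteq> carrier bipoly_ring"
    and CM_P: "relative_Cohen_Macaulay bipoly_ring ideal_P (cyclic_module bipoly_ring I)"
    and cd_P: "cohomological_dim bipoly_ring ideal_P (cyclic_module bipoly_ring I) = p"
    and unmixed_Q: "relative_unmixed bipoly_ring ideal_Q (cyclic_module bipoly_ring I)"
    and cd_Q: "cohomological_dim bipoly_ring ideal_Q (cyclic_module bipoly_ring I) = q"
  shows "unmixed bipoly_ring (cyclic_module bipoly_ring I)"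
proof -
  obtain T where T: "I = genideal bipoly_ring (monomial ` T)"
    using monomial unfolding monomial_ideal_def by blast
  define U where "U = {t + s | t s. t \<in> T}"
  have U: "upset U" unfolding upset_def U_def by (auto simp: add.assoc) blast
  have I: "I = span_mon U"
    unfolding T U_def genideal_monomials[symmetric] by (simp add: monomial_def)
  show ?thesis
    unfolding I
  proof (rule unmixed_monomial[OF U])
    fix V assume V: "span_mon (meets V) \<in> associated_primes bipoly_ring
      (cyclic_module bipoly_ring (span_mon U :: ('m, 'n, 'k) bipoly set))"
    obtain u V' where V': "(span_mon (meets V) :: ('m, 'n, 'k) bipoly set) = span_mon (meets V')"
      and u: "\<forall>v\<in>V'. u + single v 1 \<in> U" "\<forall>t. t \<notin> meets V' \<longrightarrow> u + t \<notin> U"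
      using associated_prime_monomial[OF U V] by (elim exE conjE)
    have "v \<in> V \<longleftrightarrow> v \<in> V'" for v
    proof -
      have "mon (single v 1) \<in> (span_mon (meets Z) :: ('m, 'n, 'k) bipoly set) \<longleftrightarrow> v \<in> Z" for Z
        by (auto simp: meets_def lookup_single when_def)
      then show ?thesis using V' by metis
    qed
    then have "V' = V" by blast
    have "card (range Inl - V) = p"
      using relative_Cohen_Macaulay_associated_prime[OF U CM_P[unfolded I ideal_P_eq] u] cd_P
      by (simp add: I ideal_P_eq \<open>V' = V\<close>)
    moreover have "card (range Inr - V) = q"
      using unmixed_Q V cd_Q unfolding relative_unmixed_def I ideal_Q_eq
      by (metis cohomological_dim_vars)
    moreover have "card (- V) = card (range Inl - V) + card (range Inr - V)"
    proof -
      have "x \<in> range Inl \<union> range Inr" for x :: "'m + 'n" by (cases x) auto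
      then have "- V = (range Inl - V) \<union> (range Inr - V)" by blast
      moreover have "(range Inl - V) \<inter> (range Inr - V) = {}" by auto
      ultimately show ?thesis by (simp add: card_Un_disjoint)
    qed
    moreover have "card V + card (- V) = card (UNIV :: ('m + 'n) set)"
      by (metis Compl_disjoint Compl_partition card_Un_disjoint finite)
    ultimately show "card V = card (UNIV :: ('m + 'n) set) - (p + q)" by linarith
  qed
qed

end
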